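(* For a nondegenerate triangle $T=[\boldsymbol{v}_1,\boldsymbol{v}_2,\boldsymbol{v}_3]\subset\mathbb{R}^2$, let $S_1,\dots,S_{39}$ be the basis $\mathcal{B}_c$ of the $C^3$ piecewise quintics on the Powell-Sabin 12-split of $T$, with dual points $\boldsymbol{p}^*_{j,1},\dots,\boldsymbol{p}^*_{j,5}$, $j=1,\dots,39$ (see context). For $f:T\to\mathbb{R}$ define $$Q(f):=\sum_{j=1}^{39}S_j\sum_{k=1}^{5}\frac{1}{5!}k^5(-1)^{k-1}\sum_{1\le r_1<\cdots<r_k\le5}f\left(\frac{\boldsymbol{p}^*_{j,r_1}+\cdots+\boldsymbol{p}^*_{j,r_k}}{k}\right).$$ Then $Q$ is a quasi-interpolant that reproduces all bivariate polynomials of total degree at most 5 (i.e., $Q(f)=f$ on $T$ for each such polynomial $f$) and has approximation order 6: there is a constant $C$, independent of $T$ and $f$, such that for every $f\in C^6(T)$, $$\|f-Q(f)\|_{L_\infty(T)}\le C\,h^6\,\|D^6f\|_{L_\infty(T)},$$ where $h$ is the length of the longest edge of $T$ and $\|D^6f\|_{L_\infty(T)}$ is the supremum over $T$ of the norm of the sixth derivative of $f$.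
   Context: Let $\boldsymbol{v}_4=(\boldsymbol{v}_1+\boldsymbol{v}_2)/2$, $\boldsymbol{v}_5=(\boldsymbol{v}_2+\boldsymbol{v}_3)/2$, $\boldsymbol{v}_6=(\boldsymbol{v}_1+\boldsymbol{v}_3)/2$, $\boldsymbol{v}_{10}=(\boldsymbol{v}_1+\boldsymbol{v}_2+\boldsymbol{v}_3)/3$. The Powell-Sabin 12-split of $T$ is the subdivision of $T$ into 12 triangles obtained by drawing all segments connecting pairs among $\boldsymbol{v}_1,\dots,\boldsymbol{v}_6$. Simplex splines: for nonnegative integers $m_1,\dots,m_6$ with sum 8, let $K$ be the multiset containing $\boldsymbol{v}_i$ with multiplicity $m_i$ (and having convex hull of positive area). Choose a nondegenerate simplex $\sigma\subset\mathbb{R}^7$ whose 8 vertices are mapped onto the elements of $K$ (with multiplicity) by the projection $\pi:\mathbb{R}^7\to\mathbb{R}^2$ onto the first two coordinates, and define $$Q[m_1m_2m_3m_4m_5m_6](\boldsymbol{x})=\frac{\mathrm{area}(T)}{\binom{7}{2}}\cdot\frac{\mathrm{vol}_5(\sigma\cap\pi^{-1}(\boldsymbol{x}))}{\mathrm{vol}_7(\sigma)},\quad \boldsymbol{x}\in T,$$ independent of the choice of $\sigma$. (The bracket notation $Q[\cdot]$ for simplex splines is unrelated to the operator $Q(f)$.) The basis $\mathcal{B}_c=\{S_1,\dots,S_{39}\}$, together with a multiset of five dual points $\{\boldsymbol{p}^*_{j,1},\dots,\boldsymbol{p}^*_{j,5}\}$ for each $S_j$, is the union of the $S_3$-orbits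 (permutations of $\boldsymbol{v}_1,\boldsymbol{v}_2,\boldsymbol{v}_3$ with the induced permutations of $\boldsymbol{v}_4,\boldsymbol{v}_5,\boldsymbol{v}_6$, acting simultaneously on the function and its dual points) of: $\frac14Q[600101]$ with $\{\boldsymbol{v}_1,\boldsymbol{v}_1,\boldsymbol{v}_1,\boldsymbol{v}_1,\boldsymbol{v}_1\}$; $\frac14Q[500201]$ with $\{\boldsymbol{v}_1,\boldsymbol{v}_1,\boldsymbol{v}_1,\boldsymbol{v}_1,\boldsymbol{v}_4\}$; $\frac12Q[410201]$ with $\{\boldsymbol{v}_1,\boldsymbol{v}_1,\boldsymbol{v}_1,\boldsymbol{v}_4,\boldsymbol{v}_4\}$; $\frac12Q[320201]$ with $\{\boldsymbol{v}_1,\boldsymbol{v}_1,\boldsymbol{v}_2,\boldsymbol{v}_4,\boldsymbol{v}_4\}$; $\frac34Q[220211]$ with $\{\boldsymbol{v}_1,\boldsymbol{v}_2,\boldsymbol{v}_4,\boldsymbol{v}_4,\boldsymbol{v}_{10}\}$; $Q[141110]$ with $\{\boldsymbol{v}_2,\boldsymbol{v}_2,\boldsymbol{v}_2,\boldsymbol{v}_4,\boldsymbol{v}_5\}$; $\frac12Q[131210]$ with $\{\boldsymbol{v}_1,\boldsymbol{v}_2,\boldsymbol{v}_2,\boldsymbol{v}_4,\boldsymbol{v}_5\}$; $\frac34Q[121211]$ with $\{\boldsymbol{v}_1,\boldsymbol{v}_2,\boldsymbol{v}_4,\boldsymbol{v}_5,\boldsymbol{v}_{10}\}$. *)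

theory Defs
  imports "HOL-Analysis.Analysis" "HOL-Combinatorics.Permutations" "HOL-Library.Multiset"
begin

text \<open>
  The relevant points are referred to by their indices 1, ..., 6 and 10, so that the
  \<open>S\<^sub>3\<close>-action and the equality of basis labels are purely combinatorial.
\<close>

definition ps_point :: "real^2 \<Rightarrow> real^2 \<Rightarrow> real^2 \<Rightarrow> nat \<Rightarrow> real^2" where
  "ps_point v1 v2 v3 i =
    (if i = 1 then v1
     else if i = 2 then v2
     else if i = 3 then v3
     else if i = 4 then (1/2) *\<^sub>R (v1 + v2)
     else if i = 5 then (1/2) *\<^sub>R (v2 + v3)
     else if i = 6 then (1/2) *\<^sub>R (v1 + v3)
     else if i = 10 then (1/3) *\<^sub>R (v1 + v2 + v3)
     else undefined)"

definition closed_triangle :: "real^2 \<Rightarrow> real^2 \<Rightarrow> real^2 \<Rightarrow> (real^2) set" where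
  "closed_triangle v1 v2 v3 = convex hull {v1, v2, v3}"

definition longest_edge :: "real^2 \<Rightarrow> real^2 \<Rightarrow> real^2 \<Rightarrow> real" where
  "longest_edge v1 v2 v3 = Max {dist v1 v2, dist v2 v3, dist v1 v3}"

text \<open>
  The space \<open>\<real>\<^sup>7\<close> is rendered as \<open>\<real>\<^sup>2 \<times> \<real>\<^sup>5\<close>, with \<^const>\<open>fst\<close> as the projection \<open>\<pi>\<close>; the fibre
  of \<open>\<pi>\<close> over \<open>x\<close> is then identified with \<open>\<real>\<^sup>5\<close>. A set \<open>P\<close> of eight vertices lifts the knot
  multiset \<open>K\<close> if its convex hull is a nondegenerate 7-simplex whose vertices are projected
  onto the elements of \<open>K\<close>, multiplicities included.
\<close>

definition lifts_knots :: "((real^2) \<times> (real^5)) set \<Rightarrow> (real^2) multiset \<Rightarrow> bool" where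
  "lifts_knots P K \<longleftrightarrow>
     finite P \<and> card P = 8 \<and> \<not> affine_dependent P \<and> image_mset fst (mset_set P) = K"

definition knot_simplex :: "(real^2) multiset \<Rightarrow> ((real^2) \<times> (real^5)) set" where
  "knot_simplex K = convex hull (SOME P. lifts_knots P K)"

definition simplex_spline ::
    "real^2 \<Rightarrow> real^2 \<Rightarrow> real^2 \<Rightarrow> nat multiset \<Rightarrow> real^2 \<Rightarrow> real" where
  "simplex_spline v1 v2 v3 m x =
    (let \<sigma> = knot_simplex (image_mset (ps_point v1 v2 v3) m)
     in measure lborel (closed_triangle v1 v2 v3) / real (7 choose 2) *
        (measure lborel {y. (x, y) \<in> \<sigma>} / measure lborel \<sigma>))"

definition knots :: "nat list \<Rightarrow> nat multiset" where
  "knots ms = (\<Sum>i<length ms. replicate_mset (ms ! i) (Suc i))"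

definition edge_midpoint :: "nat \<Rightarrow> nat \<Rightarrow> nat" where
  "edge_midpoint a b = (if {a, b} = {1, 2} then 4 else if {a, b} = {2, 3} then 5 else 6)"

definition induced_perm :: "(nat \<Rightarrow> nat) \<Rightarrow> nat \<Rightarrow> nat" where
  "induced_perm p i =
    (if i = 4 then edge_midpoint (p 1) (p 2)
     else if i = 5 then edge_midpoint (p 2) (p 3)
     else if i = 6 then edge_midpoint (p 1) (p 3)
     else p i)"

text \<open>
  A label \<open>(c, m, d)\<close> stands for the basis function \<open>c\<close> times the simplex spline with knots
  \<open>m\<close>, together with its multiset \<open>d\<close> of five dual points.
\<close>

type_synonym label = "real \<times> nat multiset \<times> nat multiset"

definition generators :: "label set" where
  "generators =
    {(1/4, knots [6,0,0,1,0,1], {#1,1,1,1,1#}),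
     (1/4, knots [5,0,0,2,0,1], {#1,1,1,1,4#}),
     (1/2, knots [4,1,0,2,0,1], {#1,1,1,4,4#}),
     (1/2, knots [3,2,0,2,0,1], {#1,1,2,4,4#}),
     (3/4, knots [2,2,0,2,1,1], {#1,2,4,4,10#}),
     (1,   knots [1,4,1,1,1,0], {#2,2,2,4,5#}),
     (1/2, knots [1,3,1,2,1,0], {#1,2,2,4,5#}),
     (3/4, knots [1,2,1,2,1,1], {#1,2,4,5,10#})}"

definition act :: "(nat \<Rightarrow> nat) \<Rightarrow> label \<Rightarrow> label" where
  "act p = (\<lambda>(c, m, d). (c, image_mset (induced_perm p) m, image_mset (induced_perm p) d))"

definition basis_labels :: "label set" where
  "basis_labels = (\<Union>p\<in>{p. p permutes {1, 2, 3}}. act p ` generators)"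

lemma finite_basis_labels: "finite basis_labels"
  unfolding basis_labels_def generators_def
  by (intro finite_UN_I finite_permutations finite_imageI) auto

lemma permutes_123:
  "{p. p permutes {1, 2, 3::nat}} =
   {id, Transposition.transpose 1 2, Transposition.transpose 1 3, Transposition.transpose 2 3,
    Transposition.transpose 1 2 \<circ> Transposition.transpose 2 3,
    Transposition.transpose 1 3 \<circ> Transposition.transpose 2 3}"
proof -
  have 1: "{p. p permutes {3::nat}} = {id}" by auto
  have 2: "{p. p permutes {2, 3::nat}} = {id, Transposition.transpose 2 3}"
    unfolding permutes_insert[of 2 "{3}"] 1 by force
  show ?thesis
    unfolding permutes_insert[of 1 "{2, 3}"] 2 by force
qed

lemma multiset_eq_on:
  assumes "set_mset A \<subseteq> set I" "set_mset B \<subseteq> set I" "map (count A) I = map (count B) I"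
  shows "A = B"
proof (rule multiset_eqI)
  fix i
  show "count A i = count B i"
  proof (cases "i \<in> set I")
    case True
    with assms(3) show ?thesis by simp
  next
    case False
    with assms(1,2) have "i \<notin># A" "i \<notin># B" by blast+
    then show ?thesis by (simp add: not_in_iff)
  qed
qed

lemma knots_6:
  "knots [a, b, c, d, e, f] =
    replicate_mset a 1 + replicate_mset b 2 + replicate_mset c 3 +
    replicate_mset d 4 + replicate_mset e 5 + replicate_mset f 6"
proof -
  have "{..<6::nat} = {0, 1, 2, 3, 4, 5}" by auto
  then show ?thesis by (simp add: knots_def numeral_eq_Suc)
qed

lemma induced_perm_mem:
  assumes "p permutes {1, 2, 3}" "i \<in> {1, 2, 3, 4, 5, 6, 10}"
  shows "induced_perm p i \<in> {1, 2, 3, 4, 5, 6, 10}"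
proof -
  have mid: "edge_midpoint a b \<in> {1, 2, 3, 4, 5, 6, 10}" for a b
    by (simp add: edge_midpoint_def)
  show ?thesis
  proof (cases "i \<in> {4, 5, 6}")
    case True
    then have "\<exists>a b. induced_perm p i = edge_midpoint a b"
      unfolding induced_perm_def by (metis empty_iff insert_iff)
    with mid show ?thesis by metis
  next
    case False
    then have eq: "induced_perm p i = p i" by (simp add: induced_perm_def)
    show ?thesis
    proof (cases "i \<in> {1, 2, 3}")
      case True
      then have "p i \<in> {1, 2, 3}" using permutes_in_image[OF assms(1), of i] by blast
      then show ?thesis unfolding eq by blast
    next
      case False
      then have "p i = i" using assms(1) by (rule permutes_not_in[rotated])
      with assms(2) show ?thesis unfolding eq by metis
    qed
  qed
qed

lemma basis_labels_indices:
  assumes "(c, m, d) \<in> basis_labels"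
  shows "set_mset m \<subseteq> {1, 2, 3, 4, 5, 6, 10} \<and> set_mset d \<subseteq> {1, 2, 3, 4, 5, 6, 10}"
proof -
  obtain p m' d' where p: "p permutes {1, 2, 3}" and g: "(c, m', d') \<in> generators"
    and md: "m = image_mset (induced_perm p) m'" "d = image_mset (induced_perm p) d'"
    using assms unfolding basis_labels_def act_def by auto
  have "set_mset m' \<subseteq> {1, 2, 3, 4, 5, 6, 10} \<and> set_mset d' \<subseteq> {1, 2, 3, 4, 5, 6, 10}"
    using g unfolding generators_def knots_6 insert_iff empty_iff prod.inject
    by (elim disjE conjE FalseE) simp_all
  then show ?thesis
    unfolding md set_image_mset image_subset_iff using induced_perm_mem[OF p] by blast
qed

lemma card_basis_labels: "card basis_labels = 39"
proof -
  let ?I = "[1, 2, 3, 4, 5, 6, 10::nat]"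
  define g :: "label \<Rightarrow> nat list \<times> nat list \<times> real"
    where "g = (\<lambda>(c, m, d). (map (count m) ?I, map (count d) ?I, c))"
  have "inj_on g basis_labels"
  proof (rule inj_onI)
    fix j j' assume *: "j \<in> basis_labels" "j' \<in> basis_labels" "g j = g j'"
    obtain c m d c' m' d' where j: "j = (c, m, d)" "j' = (c', m', d')"
      by (metis prod_cases3)
    have eq: "map (count m) ?I = map (count m') ?I" "map (count d) ?I = map (count d') ?I" "c = c'"
      using *(3) unfolding g_def j prod.case prod.inject by blast+
    have "m = m'" "d = d'"
      using basis_labels_indices *(1,2) eq unfolding j
      by (intro multiset_eq_on[where I = ?I]; simp)+
    with eq show "j = j'" unfolding j by simp
  qed
  hence "card basis_labels = card (g ` basis_labels)"
    by (simp add: card_image)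
  also have "\<dots> = 39"
    unfolding basis_labels_def permutes_123 generators_def
    apply (simp only: UN_insert UN_empty image_insert image_empty Un_empty_right
        Un_insert_left Un_empty_left)
    apply (simp only: g_def act_def prod.case knots_6 image_mset_union image_replicate_mset
        image_mset_add_mset image_mset_empty)
    apply (simp only: induced_perm_def edge_midpoint_def Transposition.transpose_def o_apply
        id_apply doubleton_eq_iff numeral_eq_iff num.simps one_eq_numeral_iff
        numeral_eq_one_iff if_True if_False simp_thms refl)
    apply (simp only: list.map count_union count_replicate_mset count_add_mset count_empty
        numeral_eq_iff one_eq_numeral_iff numeral_eq_one_iff num.simps if_True if_False
        simp_thms add_0_left add_0_right)
    apply (simp add: card_insert_if numeral_eq_Suc)
    done
  finally show ?thesis .
qed

definition basis_fun ::
    "real^2 \<Rightarrow> real^2 \<Rightarrow> real^2 \<Rightarrow> label \<Rightarrow> real^2 \<Rightarrow> real" where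
  "basis_fun v1 v2 v3 = (\<lambda>(c, m, d) x. c * simplex_spline v1 v2 v3 m x)"

text \<open>
  The dual points are enumerated in the order of their indices; the quasi-interpolant is
  symmetric in them, so the order is immaterial.
\<close>

definition dual_point ::
    "real^2 \<Rightarrow> real^2 \<Rightarrow> real^2 \<Rightarrow> label \<Rightarrow> nat \<Rightarrow> real^2" where
  "dual_point v1 v2 v3 =
    (\<lambda>(c, m, d) r. ps_point v1 v2 v3 (sorted_list_of_multiset d ! (r - 1)))"

text \<open>The sum over \<open>r\<^sub>1 < \<dots> < r\<^sub>k\<close> is the sum over the subsets of \<open>{1..5}\<close> of cardinality \<open>k\<close>.\<close>

definition dual_functional ::
    "real^2 \<Rightarrow> real^2 \<Rightarrow> real^2 \<Rightarrow> label \<Rightarrow> (real^2 \<Rightarrow> real) \<Rightarrow> real" where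
  "dual_functional v1 v2 v3 j f =
    (\<Sum>k = 1..5. 1 / fact 5 * real k ^ 5 * (-1) ^ (k - 1) *
      (\<Sum>R\<in>{R. R \<subseteq> {1..5} \<and> card R = k}.
        f ((1 / real k) *\<^sub>R (\<Sum>r\<in>R. dual_point v1 v2 v3 j r))))"

definition quasi_interpolant ::
    "real^2 \<Rightarrow> real^2 \<Rightarrow> real^2 \<Rightarrow> (real^2 \<Rightarrow> real) \<Rightarrow> real^2 \<Rightarrow> real" where
  "quasi_interpolant v1 v2 v3 f x =
    (\<Sum>j\<in>basis_labels. basis_fun v1 v2 v3 j x * dual_functional v1 v2 v3 j f)"

definition bivariate_poly :: "nat \<Rightarrow> (real^2 \<Rightarrow> real) \<Rightarrow> bool" where
  "bivariate_poly n f \<longleftrightarrow>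
    (\<exists>c :: nat \<Rightarrow> nat \<Rightarrow> real. \<forall>x. f x = (\<Sum>a\<le>n. \<Sum>b\<le>n - a. c a b * (x $ 1) ^ a * (x $ 2) ^ b))"

text \<open>
  \<open>iter_deriv T [u\<^sub>1, \<dots>, u\<^sub>k] f x\<close> is the \<open>k\<close>-th derivative of \<open>f\<close> at \<open>x\<close>, applied to the
  directions \<open>u\<^sub>1, \<dots>, u\<^sub>k\<close>. All derivatives are taken within \<open>T\<close>; on a convex \<open>T\<close> with nonempty
  interior they are unique and only depend on the values of \<open>f\<close> on \<open>T\<close>. For such a \<open>T\<close>,
  \<open>C_on k T f\<close> says that \<open>f\<close> has continuous derivatives up to order \<open>k\<close> on \<open>T\<close>, boundary
  included.
\<close>

primrec iter_deriv ::
    "('a::real_normed_vector) set \<Rightarrow> 'a list \<Rightarrow> ('a \<Rightarrow> real) \<Rightarrow> 'a \<Rightarrow> real" where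
  "iter_deriv T [] f = f"
| "iter_deriv T (u # us) f = (\<lambda>x. frechet_derivative (iter_deriv T us f) (at x within T) u)"

definition C_on :: "nat \<Rightarrow> ('a::real_normed_vector) set \<Rightarrow> ('a \<Rightarrow> real) \<Rightarrow> bool" where
  "C_on k T f \<longleftrightarrow>
    (\<forall>us. length us < k \<longrightarrow> iter_deriv T us f differentiable_on T) \<and>
    (\<forall>us. length us \<le> k \<longrightarrow> continuous_on T (iter_deriv T us f))"

text \<open>
  Norms are taken in \<^typ>\<open>ennreal\<close>, so that no boundedness is presupposed.
  \<open>deriv_norm k T f x\<close> is the operator norm of the \<open>k\<close>-linear form \<open>D\<^sup>k f(x)\<close>.
\<close>

definition deriv_norm ::
    "nat \<Rightarrow> ('a::real_normed_vector) set \<Rightarrow> ('a \<Rightarrow> real) \<Rightarrow> 'a \<Rightarrow> ennreal" where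
  "deriv_norm k T f x =
    (SUP us\<in>{us. length us = k \<and> (\<forall>u\<in>set us. norm u \<le> 1)}. ennreal \<bar>iter_deriv T us f x\<bar>)"

definition sup_norm :: "'a set \<Rightarrow> ('a \<Rightarrow> real) \<Rightarrow> ennreal" where
  "sup_norm T g = (SUP x\<in>T. ennreal \<bar>g x\<bar>)"

definition sup_deriv_norm ::
    "nat \<Rightarrow> ('a::real_normed_vector) set \<Rightarrow> ('a \<Rightarrow> real) \<Rightarrow> ennreal" where
  "sup_deriv_norm k T f = (SUP x\<in>T. deriv_norm k T f x)"

end

theory Submission
  imports Defs "HOL-Probability.Distributions"
begin

text \<open>
  The estimate follows from two properties of the quasi-interpolant \<open>Q\<close>: it reproduces quintic
  polynomials, and it is bounded in the supremum norm by a constant that does not depend on the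
  triangle \<open>T\<close>. Subtracting from \<open>f\<close> its Taylor polynomial of degree 5 at the point under
  consideration then leaves only the Taylor remainder, which is of order \<open>h\<^sup>6\<close>. Boundedness is easy
  once constants are reproduced: the \<open>S\<^sub>j\<close> are nonnegative and sum to 1, and each dual functional is a
  fixed combination of point values at averages of points of \<open>T\<close>.

  For the reproduction of quintics, the weights of the dual functionals are those of the polarization
  identity \<open>quintic_polarization_sum\<close>. Hence the functional of \<open>S\<^sub>j\<close> maps the fifth power of an affine
  function \<open>q\<close> to the product of the values of \<open>q\<close> at the five dual points. By the same identity the
  fifth powers of affine functions span the quintics, so it remains to prove the Marsden-type identity
  that \<open>q(x)\<^sup>5\<close> is the sum over \<open>j\<close> of \<open>S\<^sub>j(x)\<close> times this product.

  Both sides are continuous on \<open>T\<close>. For the splines this is \<open>continuous_on_fibre_volume\<close>; it holds up to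
  the boundary: the volume of a fibre can jump only across a line that contains seven of the eight
  knots, and for the splines at hand such a line carries an edge of \<open>T\<close>. It therefore suffices to
  compare the integrals of both sides against \<open>l\<^sup>-\<^sup>8\<close> for all affine \<open>l\<close> that are positive on \<open>T\<close>, because
  these determine a continuous function (\<open>rational_moments_determine\<close>). The exponent 8 is the number of
  knots: with this exponent the integral of a normalized simplex spline is simply the product of
  \<open>1 / l(k)\<close> over its knots \<open>k\<close> (\<open>nn_integral_fibre_rational\<close>), as one sees by integrating \<open>exp (- l)\<close>
  over the cone above the simplex. The integral of \<open>q\<^sup>5 / l\<^sup>8\<close> over \<open>T\<close> is computed in the same way
  (\<open>triangle_integral_quintic\<close>). Thus no piecewise polynomial formula for a spline is needed, and the
  Marsden-type identity becomes an identity between rational functions of the values of \<open>l\<close> and \<open>q\<close>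
  at the three corners (\<open>marsden_label_sum\<close>). It is verified for each monomial in the values of \<open>q\<close>
  separately; up to a permutation of the corners there are five of them.
\<close>

section \<open>Rational functions integrated over a simplex\<close>

lemma linear_inv_bij:
  fixes f :: "'a::real_vector \<Rightarrow> 'b::real_vector"
  assumes lin: "linear f" and bij: "bij f"
  shows "linear (inv f)"
proof (rule linearI)
  have f: "f (inv f y) = y" and g: "inv f (f x) = x" for x y
    using bij by (simp_all add: bij_def surj_f_inv_f)
  show "inv f (x + y) = inv f x + inv f y" for x y
    using g[of "inv f x + inv f y"] by (simp add: linear_add[OF lin] f)
  show "inv f (c *\<^sub>R x) = c *\<^sub>R inv f x" for c x
    using g[of "c *\<^sub>R inv f x"] by (simp add: linear_cmul[OF lin] f)
qed

lemma linear_inj_imp_bij: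
  fixes f :: "'a::euclidean_space \<Rightarrow> 'b::euclidean_space"
  assumes lin: "linear f" and inj: "inj f" and dim: "DIM('a) = DIM('b)"
  shows "bij f"
proof -
  have "dim (f ` UNIV) = dim (UNIV :: 'a set)"
    using dim_image_eq[OF lin] inj by simp
  then have "dim (f ` UNIV) = DIM('b)" using dim by simp
  then have "surj f"
    using dim_eq_full[of "range f"] linear_subspace_image[OF lin subspace_UNIV] by (metis span_eq_iff)
  with inj show ?thesis by (simp add: bij_def)
qed

text \<open>
  Coordinates with respect to an orthonormal basis preserve the measure, so the determinant formula for
  linear maps of \<open>real^'n\<close> to itself carries over to an arbitrary target space.
  Only the existence of the constant \<open>k\<close> matters below: it cancels in the ratio of fibre volume to
  volume that defines a simplex spline.
\<close>

lemma nn_integral_linear_bij: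
  fixes S :: "real^'n::{finite,wellorder} \<Rightarrow> 'c::euclidean_space"
  assumes lin: "linear S" and bij: "bij S" and dim: "CARD('n) = DIM('c)"
  obtains k :: real where "k > 0"
    "\<And>F. F \<in> borel_measurable borel \<Longrightarrow>
       (\<integral>\<^sup>+y. F y \<partial>lborel) = ennreal k * (\<integral>\<^sup>+t. F (S t) \<partial>lborel)"
proof -
  obtain \<beta> where \<beta>: "bij_betw \<beta> (UNIV::'n set) (Basis::'c set)"
    using dim finite_same_card_bij[of "UNIV::'n set" "Basis::'c set"] by auto
  define \<phi> :: "'c \<Rightarrow> (real,'n) vec" where "\<phi> y = (\<chi> i. y \<bullet> \<beta> i)" for y
  define B where "B = inv S \<circ> inv \<phi>"
  have lin\<phi>: "linear \<phi>"
    by (rule linearI) (simp_all add: \<phi>_def vec_eq_iff inner_add_left)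
  have inj\<phi>: "inj \<phi>"
  proof (rule injI)
    fix x y assume "\<phi> x = \<phi> y"
    then have "x \<bullet> \<beta> i = y \<bullet> \<beta> i" for i by (simp add: \<phi>_def vec_eq_iff)
    then have "x \<bullet> b = y \<bullet> b" if "b \<in> Basis" for b
      using that \<beta> unfolding bij_betw_def by (metis imageE)
    then show "x = y" by (rule euclidean_eqI)
  qed
  have bij\<phi>: "bij \<phi>" using lin\<phi> inj\<phi> by (rule linear_inj_imp_bij) (simp add: dim)
  then have surj\<phi>: "surj \<phi>" by (simp add: bij_def)
  have lininv\<phi>: "linear (inv \<phi>)" by (rule linear_inv_bij[OF lin\<phi> bij\<phi>])
  have lininvS: "linear (inv S)" by (rule linear_inv_bij[OF lin bij])
  have linB: "linear B" unfolding B_def by (rule linear_compose[OF lininv\<phi> lininvS])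
  have bijB: "bij B" unfolding B_def
    by (intro bij_comp bij_imp_bij_inv bij\<phi> bij)
  have det: "det (matrix B) \<noteq> 0"
    using bijB linB by (simp add: det_nz_iff_inj bij_def)
  define k where "k = 1 / \<bar>det (matrix B)\<bar>"
  have kpos: "k > 0" using det by (simp add: k_def)
  have Smeas[measurable]: "S \<in> borel_measurable borel"
    using lin by (intro borel_measurable_continuous_onI linear_continuous_on)
      (simp add: linear_conv_bounded_linear)
  have box: "emeasure lborel (S -` box l u) = ennreal \<bar>det (matrix B)\<bar> * emeasure lborel (box l u)"
    for l u :: 'c
  proof -
    let ?b = "box (\<phi> l) (\<phi> u)"
    have im: "\<phi> ` box l u = ?b"
    proof -
      have "x \<in> box l u \<longleftrightarrow> \<phi> x \<in> ?b" for x
      proof -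
        have "(\<forall>b\<in>Basis. l \<bullet> b < x \<bullet> b \<and> x \<bullet> b < u \<bullet> b) \<longleftrightarrow> (\<forall>i. l \<bullet> \<beta> i < x \<bullet> \<beta> i \<and> x \<bullet> \<beta> i < u \<bullet> \<beta> i)"
          using \<beta> unfolding bij_betw_def by (metis imageE rangeI)
        then show ?thesis by (simp only: mem_box_cart) (simp add: mem_box \<phi>_def)
      qed
      then show ?thesis using surj\<phi> by (auto simp: image_iff) (metis surjD)
    qed
    have e1: "S -` box l u = B ` ?b"
    proof -
      have "B ` ?b = inv S ` (inv \<phi> ` \<phi> ` box l u)" by (simp add: im B_def image_comp)
      also have "\<dots> = inv S ` box l u" using inj\<phi> by (simp add: image_comp)
      also have "\<dots> = S -` box l u" using bij by (simp add: bij_vimage_eq_inv_image)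
      finally show ?thesis by simp
    qed
    have lm: "?b \<in> lmeasurable" by simp
    have "emeasure lborel (S -` box l u) = emeasure lebesgue (B ` ?b)"
      unfolding e1[symmetric] using measurable_sets_borel[OF Smeas, of "box l u"] by simp
    also have "\<dots> = ennreal (measure lebesgue (B ` ?b))"
      using measurable_linear_image[OF linB lm] by (simp add: emeasure_eq_measure2 fmeasurableD2)
    also have "measure lebesgue (B ` ?b) = \<bar>det (matrix B)\<bar> * measure lebesgue ?b"
      by (rule measure_linear_image[OF linB lm])
    also have "ennreal \<dots> = ennreal \<bar>det (matrix B)\<bar> * emeasure lebesgue ?b"
      using lm by (simp add: ennreal_mult emeasure_eq_measure2 fmeasurableD2)
    also have "emeasure lebesgue ?b = emeasure lborel ?b" by simp
    also have "\<dots> = emeasure lborel (box l u)"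
    proof -
      have inner: "(\<phi> u - \<phi> l) \<bullet> axis i 1 = (u - l) \<bullet> \<beta> i" for i
        by (simp add: \<phi>_def inner_axis inner_diff_left)
      have cond: "(\<forall>b\<in>Basis. \<phi> l \<bullet> b \<le> \<phi> u \<bullet> b) \<longleftrightarrow> (\<forall>b\<in>Basis. l \<bullet> b \<le> u \<bullet> b)"
      proof -
        have "(\<forall>b\<in>Basis. \<phi> l \<bullet> b \<le> \<phi> u \<bullet> b) \<longleftrightarrow> (\<forall>i. l \<bullet> \<beta> i \<le> u \<bullet> \<beta> i)"
          by (auto simp: Basis_vec_def inner_axis \<phi>_def)
        also have "\<dots> \<longleftrightarrow> (\<forall>b\<in>Basis. l \<bullet> b \<le> u \<bullet> b)"
          using \<beta> unfolding bij_betw_def by (metis imageE rangeI)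
        finally show ?thesis .
      qed
      have "(\<Prod>b\<in>Basis. (\<phi> u - \<phi> l) \<bullet> b) = (\<Prod>i\<in>UNIV. (\<phi> u - \<phi> l) \<bullet> axis i 1)"
      proof -
        have B: "(Basis :: ((real,'n) vec) set) = (\<lambda>i. axis i 1) ` UNIV" by (auto simp: Basis_vec_def)
        have "inj (\<lambda>i. axis i (1::real))" by (auto simp: inj_on_def axis_eq_axis)
        then show ?thesis unfolding B by (subst prod.reindex) auto
      qed
      also have "\<dots> = (\<Prod>b\<in>Basis. (u - l) \<bullet> b)"
        unfolding inner by (rule prod.reindex_bij_betw[OF \<beta>])
      finally show ?thesis by (simp add: emeasure_lborel_box_eq cond)
    qed
    finally show ?thesis .
  qed
  have eq: "scale_measure (ennreal k) (distr lborel borel S) = lborel"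
  proof (rule lborel_eqI[symmetric])
    fix l u :: 'c assume *: "\<And>b. b \<in> Basis \<Longrightarrow> l \<bullet> b \<le> u \<bullet> b"
    have "emeasure (scale_measure (ennreal k) (distr lborel borel S)) (box l u)
        = ennreal k * (ennreal \<bar>det (matrix B)\<bar> * emeasure lborel (box l u))"
      by (simp add: emeasure_distr box)
    also have "\<dots> = ennreal (k * \<bar>det (matrix B)\<bar>) * emeasure lborel (box l u)"
      using kpos by (simp add: ennreal_mult mult.assoc)
    also have "k * \<bar>det (matrix B)\<bar> = 1" using det by (simp add: k_def)
    finally show "emeasure (scale_measure (ennreal k) (distr lborel borel S)) (box l u)
        = ennreal (\<Prod>b\<in>Basis. (u - l) \<bullet> b)"
      using * by (simp add: emeasure_lborel_box_eq)
  qed simp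
  show ?thesis
  proof (rule that[OF kpos])
    fix F :: "'c \<Rightarrow> ennreal" assume F[measurable]: "F \<in> borel_measurable borel"
    have "(\<integral>\<^sup>+y. F y \<partial>lborel) = (\<integral>\<^sup>+y. F y \<partial>scale_measure (ennreal k) (distr lborel borel S))"
      by (simp add: eq)
    also have "\<dots> = ennreal k * (\<integral>\<^sup>+y. F y \<partial>distr lborel borel S)"
      by (rule nn_integral_scale_measure) simp
    also have "\<dots> = ennreal k * (\<integral>\<^sup>+t. F (S t) \<partial>lborel)"
      by (simp add: nn_integral_distr)
    finally show "(\<integral>\<^sup>+y. F y \<partial>lborel) = ennreal k * (\<integral>\<^sup>+t. F (S t) \<partial>lborel)" .
  qed
qed

text \<open>
  The Gamma integral. It evaluates both the integral along a ray of a cone and, coordinate by coordinate,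
  the integral over an orthant.
\<close>

lemma nn_integral_power_exp:
  fixes L :: real assumes L: "L > 0"
  shows "(\<integral>\<^sup>+s. ennreal (s ^ m * exp (- (L * s))) * indicator {0..} s \<partial>lborel)
       = ennreal (fact m / L ^ (m + 1))"
proof -
  let ?I = "\<integral>\<^sup>+s. ennreal (s ^ m * exp (- (L * s))) * indicator {0..} s \<partial>lborel"
  have "ennreal (fact m) = (\<integral>\<^sup>+x. ennreal (x ^ m * exp (- x)) * indicator {0..} x \<partial>lborel)"
    by (subst nn_intergal_power_times_exp_Ici) simp
  also have "\<dots> = ennreal \<bar>L\<bar> * (\<integral>\<^sup>+x. ennreal ((0 + L * x) ^ m * exp (- (0 + L * x))) * indicator {0..} (0 + L * x) \<partial>lborel)"
    by (rule nn_integral_real_affine) (use L in auto)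
  also have "(\<integral>\<^sup>+x. ennreal ((0 + L * x) ^ m * exp (- (0 + L * x))) * indicator {0..} (0 + L * x) \<partial>lborel)
       = (\<integral>\<^sup>+s. ennreal (L ^ m) * (ennreal (s ^ m * exp (- (L * s))) * indicator {0..} s) \<partial>lborel)"
    using L by (intro nn_integral_cong)
      (auto simp: indicator_def power_mult_distrib zero_le_mult_iff ennreal_mult[symmetric] mult.assoc)
  also have "\<dots> = ennreal (L ^ m) * ?I"
    by (rule nn_integral_cmult) auto
  finally have *: "ennreal (fact m) = ennreal (L ^ (m + 1)) * ?I"
    using L by (simp add: ennreal_mult[symmetric] mult.assoc[symmetric])
  have "ennreal (fact m / L ^ (m + 1)) = ennreal (1 / L ^ (m + 1)) * ennreal (fact m)"
    using L by (simp add: ennreal_mult[symmetric])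
  also have "\<dots> = ennreal (1 / L ^ (m + 1) * L ^ (m + 1)) * ?I"
    unfolding * using L by (simp only: ennreal_mult[symmetric] mult.assoc[symmetric]) (subst ennreal_mult, auto)
  also have "\<dots> = ?I" using L by simp
  finally show ?thesis by simp
qed

lemma nn_integral_lborel_vec_prod:
  fixes g :: "'n::finite \<Rightarrow> real \<Rightarrow> ennreal"
  assumes [measurable]: "\<And>i. g i \<in> borel_measurable borel"
  shows "(\<integral>\<^sup>+t. (\<Prod>i\<in>UNIV. g i (t $ i)) \<partial>(lborel :: (real^'n) measure)) = (\<Prod>i\<in>UNIV. \<integral>\<^sup>+x. g i x \<partial>lborel)"
proof -
  define ix :: "real^'n \<Rightarrow> 'n" where "ix b = (THE i. b = axis i 1)" for b
  have ix[simp]: "ix (axis i 1) = i" for i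
    unfolding ix_def by (auto simp: axis_eq_axis)
  have B: "(Basis :: (real^'n) set) = (\<lambda>i. axis i 1) ` UNIV" by (auto simp: Basis_vec_def)
  have inj: "inj (\<lambda>i::'n. axis i (1::real))" by (auto simp: inj_on_def axis_eq_axis)
  have 1: "(\<Prod>b\<in>Basis. h b) = (\<Prod>i\<in>UNIV. h (axis i 1))" for h :: "real^'n \<Rightarrow> ennreal"
    unfolding B by (subst prod.reindex[OF inj]) simp
  have "(\<integral>\<^sup>+t. (\<Prod>b\<in>Basis. g (ix b) (t \<bullet> b)) \<partial>(lborel :: (real^'n) measure)) = (\<Prod>b\<in>(Basis::(real^'n) set). \<integral>\<^sup>+x. g (ix b) x \<partial>lborel)"
    by (rule nn_integral_lborel_prod) auto
  then show ?thesis unfolding 1 by (simp add: inner_axis)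
qed

lemma nn_integral_lborel_scale:
  fixes h :: "'a::euclidean_space \<Rightarrow> ennreal"
  assumes [measurable]: "h \<in> borel_measurable borel" and s: "s > 0"
  shows "(\<integral>\<^sup>+y. h y \<partial>lborel) = ennreal (s ^ DIM('a)) * (\<integral>\<^sup>+x. h (s *\<^sub>R x) \<partial>lborel)"
proof -
  have "(\<integral>\<^sup>+y. h y \<partial>lborel) = (\<integral>\<^sup>+y. h y \<partial>density (distr lborel borel (\<lambda>x. 0 + s *\<^sub>R x)) (\<lambda>_. \<bar>s\<bar>^DIM('a)))"
    using s by (intro arg_cong[where f = "\<lambda>M. nn_integral M h"] lborel_affine) simp
  also have "\<dots> = ennreal (s ^ DIM('a)) * (\<integral>\<^sup>+x. h (s *\<^sub>R x) \<partial>lborel)"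
    using s by (simp add: nn_integral_density nn_integral_distr nn_integral_cmult)
  finally show ?thesis .
qed

text \<open>
  The vertices of a nondegenerate simplex, indexed by a type so that the orthant that is mapped onto the
  cone over the simplex lives in \<open>real^'n\<close>. One frame will be a lift of eight knots,
  another one the three corners of the triangle.
\<close>

locale affine_frame =
  fixes p :: "'n::{finite,wellorder} \<Rightarrow> 'a::euclidean_space"
  assumes dim: "CARD('n) = DIM('a) + 1"
    and indep: "\<And>u. sum u UNIV = 0 \<Longrightarrow> (\<Sum>i\<in>UNIV. u i *\<^sub>R p i) = 0 \<Longrightarrow> u i = 0"
begin

text \<open>
  The orthant is mapped onto the cone over the simplex placed at height 1.
\<close>

definition cone_map :: "(real,'n) vec \<Rightarrow> real \<times> 'a" where
  "cone_map t = (\<Sum>i\<in>UNIV. t $ i, \<Sum>i\<in>UNIV. (t $ i) *\<^sub>R p i)"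

definition bary :: "'a \<Rightarrow> 'n \<Rightarrow> real" where
  "bary x i = inv cone_map (1, x) $ i"

lemma linear_cone_map: "linear cone_map"
  by (rule linearI)
    (simp_all add: cone_map_def sum.distrib scaleR_left_distrib sum_distrib_left scaleR_sum_right)

lemma bij_cone_map: "bij cone_map"
proof (rule linear_inj_imp_bij[OF linear_cone_map])
  show "inj cone_map"
    unfolding linear_injective_0[OF linear_cone_map]
    using indep by (auto simp: cone_map_def vec_eq_iff zero_prod_def)
  show "DIM((real,'n) vec) = DIM(real \<times> 'a)" using dim by simp
qed

lemma linear_inv_cone_map: "linear (inv cone_map)"
  by (rule linear_inv_bij[OF linear_cone_map bij_cone_map])

lemma inv_cone_map: "inv cone_map (cone_map t) = t" "cone_map (inv cone_map y) = y"
  using bij_cone_map by (simp_all add: bij_def surj_f_inv_f)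

lemma sum_bary: "(\<Sum>i\<in>UNIV. bary x i) = 1" and bary_combination: "(\<Sum>i\<in>UNIV. bary x i *\<^sub>R p i) = x"
  using inv_cone_map(2)[of "(1, x)"] by (simp_all add: cone_map_def bary_def)

lemma bary_unique:
  assumes "(\<Sum>i\<in>UNIV. u i) = 1" "(\<Sum>i\<in>UNIV. u i *\<^sub>R p i) = x"
  shows "bary x i = u i"
  using inv_cone_map(1)[of "\<chi> i. u i"] assms by (simp add: cone_map_def bary_def)

lemma bary_affine:
  "bary ((1 - s) *\<^sub>R x + s *\<^sub>R y) i = (1 - s) * bary x i + s * bary y i"
proof -
  have "inv cone_map ((1 - s) *\<^sub>R (1, x) + s *\<^sub>R (1, y)) = (1 - s) *\<^sub>R inv cone_map (1, x) + s *\<^sub>R inv cone_map (1, y)"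
    unfolding linear_add[OF linear_inv_cone_map] linear_cmul[OF linear_inv_cone_map] by (rule refl)
  then show ?thesis by (simp add: bary_def)
qed

lemma continuous_on_bary[continuous_intros]: "continuous_on A (\<lambda>x. bary x i)"
proof -
  have "continuous_on UNIV (inv cone_map)"
    using linear_inv_cone_map by (simp add: linear_continuous_on linear_conv_bounded_linear)
  then have "continuous_on UNIV (\<lambda>x. inv cone_map (1, x))"
    by (rule continuous_on_compose2) (auto intro!: continuous_intros)
  then have "continuous_on UNIV (\<lambda>x. inv cone_map (1, x) $ i)" by (intro continuous_intros)
  then show ?thesis unfolding bary_def using continuous_on_subset by blast
qed

lemma borel_measurable_bary[measurable]: "(\<lambda>x. bary x i) \<in> borel_measurable borel"
  by (intro borel_measurable_continuous_onI continuous_intros)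

lemma convex_hull_eq_bary: "convex hull (range p) = {x. \<forall>i. bary x i \<ge> 0}"
proof (intro equalityI subsetI)
  have conv: "convex {x. \<forall>i. bary x i \<ge> 0}"
    unfolding convex_alt by (auto simp: bary_affine)
  have "bary (p j) i = (if i = j then 1 else 0)" for i j
    by (rule bary_unique) (simp_all add: if_distrib[of "\<lambda>c. c *\<^sub>R _"] cong: if_cong)
  then have "range p \<subseteq> {x. \<forall>i. bary x i \<ge> 0}" by auto
  then show "x \<in> {x. \<forall>i. bary x i \<ge> 0}" if "x \<in> convex hull (range p)" for x
    using hull_minimal[of "range p" _ convex] conv that by blast
next
  fix x assume "x \<in> {x. \<forall>i. bary x i \<ge> 0}"
  then have "(\<Sum>i\<in>UNIV. bary x i *\<^sub>R p i) \<in> convex hull (range p)"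
    by (intro convex_sum) (auto simp: sum_bary hull_inc)
  then show "x \<in> convex hull (range p)" by (simp add: bary_combination)
qed

lemma sum_bary_pos:
  assumes "\<And>i. l i > 0" "\<And>i. bary x i \<ge> 0"
  shows "(\<Sum>i\<in>UNIV. l i * bary x i) > 0"
proof -
  obtain i where "bary x i \<noteq> 0" using sum_bary[of x] by (metis sum.neutral zero_neq_one)
  with assms(2)[of i] have "bary x i > 0" by simp
  then have "l i * bary x i > 0" using assms(1) by simp
  then show ?thesis
    by (intro sum_pos2[where i = i]) (use assms in \<open>auto simp: less_imp_le\<close>)
qed

text \<open>
  This is Feynman's parametrization of a product of reciprocals, with monomials in the barycentric
  coordinates in the numerator. Integrate the product of the \<open>t i ^ e i * exp (- (l i * t i))\<close> over the orthant: this
  factorizes. Transported to the cone over the simplex, the slice at height \<open>s\<close> is the simplex scaled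
  by \<open>s\<close>; integrating over \<open>s\<close> first leaves the integrand on the left. The case \<open>e = 0\<close>, \<open>l = 1\<close>
  identifies \<open>k\<close> as a multiple of the volume.
\<close>

theorem nn_integral_simplex_rational:
  obtains k :: real where "k > 0"
    "\<And>e l. (\<And>i. l i > 0) \<Longrightarrow>
      (\<integral>\<^sup>+x. ennreal ((\<Prod>i\<in>UNIV. bary x i ^ e i) /
             (\<Sum>i\<in>UNIV. l i * bary x i) ^ (DIM('a) + 1 + sum e UNIV)) * indicator (convex hull (range p)) x \<partial>lborel)
      = ennreal (k / fact (DIM('a) + sum e UNIV) * (\<Prod>i\<in>UNIV. fact (e i) / l i ^ (e i + 1)))"
proof -
  have "CARD('n) = DIM(real \<times> 'a)" using dim by simp
  from nn_integral_linear_bij[OF linear_cone_map bij_cone_map this] obtain k where k: "k > 0"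
    and kF: "\<And>F. F \<in> borel_measurable borel \<Longrightarrow>
       (\<integral>\<^sup>+y. F y \<partial>lborel) = ennreal k * (\<integral>\<^sup>+t. F (cone_map t) \<partial>lborel)"
    by blast
  show ?thesis
  proof (rule that[OF k])
    fix e :: "'n \<Rightarrow> nat" and l :: "'n \<Rightarrow> real" assume l: "\<And>i. l i > 0"
    let ?n = "DIM('a)" and ?E = "sum e UNIV"
    define g where "g i t = ennreal (t ^ e i * exp (- (l i * t))) * indicator {0..} t" for i t
    define L where "L x = (\<Sum>i\<in>UNIV. l i * bary x i)" for x
    define Q where "Q x = (\<Prod>i\<in>UNIV. bary x i ^ e i)" for x
    define \<sigma> where "\<sigma> = convex hull (range p)"
    let ?K = "\<lambda>s x. ennreal (s ^ (?n + ?E) * exp (- (L x * s))) * indicator {0..} s * (ennreal (Q x) * indicator \<sigma> x) :: ennreal"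
    have [measurable]: "g i \<in> borel_measurable borel" for i unfolding g_def by measurable
    have [measurable]: "L \<in> borel_measurable borel" unfolding L_def by measurable
    have [measurable]: "Q \<in> borel_measurable borel" unfolding Q_def by measurable
    have [measurable]: "\<sigma> \<in> sets borel" unfolding \<sigma>_def convex_hull_eq_bary by measurable
    define F where "F y = (\<Prod>i\<in>UNIV. g i (inv cone_map y $ i))" for y
    have "continuous_on UNIV (\<lambda>y. inv cone_map y $ i)" for i
      by (intro continuous_intros)
        (use linear_inv_cone_map in \<open>simp add: linear_continuous_on linear_conv_bounded_linear\<close>)
    then have [measurable]: "(\<lambda>y. inv cone_map y $ i) \<in> borel_measurable borel" for i
      by (rule borel_measurable_continuous_onI)
    have [measurable]: "F \<in> borel_measurable borel" unfolding F_def by measurable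
    have F2[measurable]: "(\<lambda>(s, y). F (s, y)) \<in> borel_measurable (borel \<Otimes>\<^sub>M borel)"
      by (simp add: borel_prod)
    have prodg: "(\<Prod>i\<in>UNIV. g i (s * bary x i)) =
        ennreal (s ^ ?E * exp (- (L x * s))) * (ennreal (Q x) * indicator \<sigma> x)" if s: "s > 0" for s x
    proof (cases "x \<in> \<sigma>")
      case True
      then have b: "bary x i \<ge> 0" for i by (simp add: \<sigma>_def convex_hull_eq_bary)
      have "(\<Prod>i\<in>UNIV. g i (s * bary x i)) = (\<Prod>i\<in>UNIV. ennreal (s ^ e i * bary x i ^ e i * exp (- (l i * (s * bary x i)))))"
        using s b by (simp add: g_def power_mult_distrib)
      also have "\<dots> = ennreal (\<Prod>i\<in>UNIV. s ^ e i * bary x i ^ e i * exp (- (l i * (s * bary x i))))"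
        using s b by (intro prod_ennreal) auto
      also have "(\<Prod>i\<in>UNIV. s ^ e i * bary x i ^ e i * exp (- (l i * (s * bary x i))))
          = s ^ ?E * Q x * exp (- (L x * s))"
        by (simp add: prod.distrib power_sum exp_sum[symmetric] Q_def L_def sum_negf sum_distrib_left
            sum_distrib_right mult_ac)
      finally show ?thesis using True s b
        by (simp add: ennreal_mult[symmetric] Q_def prod_nonneg mult_ac)
    next
      case False
      then obtain i where "bary x i < 0" by (auto simp: \<sigma>_def convex_hull_eq_bary not_le)
      then have "g i (s * bary x i) = 0" using s by (simp add: g_def mult_less_0_iff not_le)
      then have "(\<Prod>i\<in>UNIV. g i (s * bary x i)) = 0" by (simp add: prod_zero_iff) blast
      with False show ?thesis by simp
    qed
    have inv_s: "inv cone_map (s, s *\<^sub>R x) $ i = s * bary x i" for s x i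
    proof -
      have "inv cone_map (s *\<^sub>R (1, x)) = s *\<^sub>R inv cone_map (1, x)"
        by (rule linear_cmul[OF linear_inv_cone_map])
      then show ?thesis by (simp add: bary_def)
    qed
    have Fneg: "F (s, y) = 0" if "s < 0" for s y
    proof -
      have "(\<Sum>i\<in>UNIV. inv cone_map (s, y) $ i) = s"
        using inv_cone_map(2)[of "(s, y)"] by (simp add: cone_map_def)
      moreover have "(\<Sum>i\<in>UNIV. inv cone_map (s, y) $ i) \<ge> 0" if "\<And>i. \<not> inv cone_map (s, y) $ i < 0"
        using that by (intro sum_nonneg) (simp add: not_less)
      ultimately obtain i where "inv cone_map (s, y) $ i < 0"
        using \<open>s < 0\<close> by force
      then have "g i (inv cone_map (s, y) $ i) = 0" by (simp add: g_def)
      then show ?thesis unfolding F_def by (simp add: prod_zero_iff) blast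
    qed
    have slice: "(\<integral>\<^sup>+y. F (s, y) \<partial>lborel) =
        (\<integral>\<^sup>+x. ?K s x \<partial>lborel)"
      if s: "s \<noteq> 0" for s
    proof (cases "s > 0")
      case True
      have "(\<integral>\<^sup>+y. F (s, y) \<partial>lborel) = ennreal (s ^ ?n) * (\<integral>\<^sup>+x. F (s, s *\<^sub>R x) \<partial>lborel)"
        by (rule nn_integral_lborel_scale) (use True in auto)
      also have "\<dots> = (\<integral>\<^sup>+x. ennreal (s ^ ?n) * (ennreal (s ^ ?E * exp (- (L x * s))) * (ennreal (Q x) * indicator \<sigma> x)) \<partial>lborel)"
        by (subst nn_integral_cmult) (simp_all add: F_def inv_s prodg[OF True])
      also have "\<dots> = (\<integral>\<^sup>+x. ?K s x \<partial>lborel)"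
        using True by (intro nn_integral_cong)
          (simp add: ennreal_mult[symmetric] mult.assoc[symmetric] power_add)
      finally show ?thesis .
    next
      case False
      with s have "s < 0" by simp
      then show ?thesis by (simp add: Fneg)
    qed
    have "ennreal k * (\<Prod>i\<in>UNIV. ennreal (fact (e i) / l i ^ (e i + 1))) = ennreal k * (\<integral>\<^sup>+t. (\<Prod>i\<in>UNIV. g i (t $ i)) \<partial>lborel)"
    proof -
      have "(\<integral>\<^sup>+x. g i x \<partial>lborel) = ennreal (fact (e i) / l i ^ (e i + 1))" for i
        unfolding g_def by (rule nn_integral_power_exp[OF l])
      moreover have "(\<integral>\<^sup>+t. (\<Prod>i\<in>UNIV. g i (t $ i)) \<partial>lborel) = (\<Prod>i\<in>UNIV. \<integral>\<^sup>+x. g i x \<partial>lborel)"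
        by (rule nn_integral_lborel_vec_prod) simp
      ultimately show ?thesis by (simp only:)
    qed
    also have "\<dots> = (\<integral>\<^sup>+y. F y \<partial>lborel)"
      by (subst kF) (simp_all add: F_def inv_cone_map)
    also have "\<dots> = (\<integral>\<^sup>+s. \<integral>\<^sup>+y. F (s, y) \<partial>lborel \<partial>lborel)"
      using lborel.nn_integral_fst[of F lborel] by (simp add: lborel_prod)
    also have "\<dots> = (\<integral>\<^sup>+s. \<integral>\<^sup>+x. ?K s x \<partial>lborel \<partial>lborel)"
    proof (rule nn_integral_cong_AE)
      show "AE s in lborel. (\<integral>\<^sup>+y. F (s, y) \<partial>lborel) = (\<integral>\<^sup>+x. ?K s x \<partial>lborel)"
        by (rule eventually_mono[OF AE_lborel_singleton[of "0::real"] slice])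
    qed
    also have "\<dots> = (\<integral>\<^sup>+x. \<integral>\<^sup>+s. ?K s x \<partial>lborel \<partial>lborel)"
      by (rule lborel_pair.Fubini'[symmetric]) measurable
    also have "\<dots> = (\<integral>\<^sup>+x. ennreal (fact (?n + ?E)) * (ennreal (Q x / L x ^ (?n + 1 + ?E)) * indicator \<sigma> x) \<partial>lborel)"
    proof (rule nn_integral_cong)
      fix x
      show "(\<integral>\<^sup>+s. ?K s x \<partial>lborel)
        = ennreal (fact (?n + ?E)) * (ennreal (Q x / L x ^ (?n + 1 + ?E)) * indicator \<sigma> x)"
      proof (cases "x \<in> \<sigma>")
        case True
        then have b: "bary x i \<ge> 0" for i by (simp add: \<sigma>_def convex_hull_eq_bary)
        have Lpos: "L x > 0" unfolding L_def by (rule sum_bary_pos[OF l b])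
        have Qn: "Q x \<ge> 0" unfolding Q_def using b by (simp add: prod_nonneg)
        have "(\<integral>\<^sup>+s. ?K s x \<partial>lborel)
           = ennreal (fact (?n + ?E) / L x ^ (?n + ?E + 1)) * (ennreal (Q x) * indicator \<sigma> x)"
          unfolding nn_integral_power_exp[OF Lpos, symmetric] by (rule nn_integral_multc) measurable
        also have "\<dots> = ennreal (fact (?n + ?E)) * (ennreal (Q x / L x ^ (?n + 1 + ?E)) * indicator \<sigma> x)"
          using True Lpos Qn by (simp add: ennreal_mult[symmetric] del: ennreal_fact)
        finally show ?thesis .
      qed simp
    qed
    also have "\<dots> = ennreal (fact (?n + ?E)) * (\<integral>\<^sup>+x. ennreal (Q x / L x ^ (?n + 1 + ?E)) * indicator \<sigma> x \<partial>lborel)"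
      by (rule nn_integral_cmult) measurable
    finally have main: "ennreal (fact (?n + ?E)) * (\<integral>\<^sup>+x. ennreal (Q x / L x ^ (?n + 1 + ?E)) * indicator \<sigma> x \<partial>lborel)
       = ennreal (k * (\<Prod>i\<in>UNIV. fact (e i) / l i ^ (e i + 1)))"
      (is "_ * ?J = ennreal ?r")
      using k l by (simp add: prod_ennreal ennreal_mult prod_nonneg less_imp_le del: ennreal_fact)
    have "?J = ennreal (1 / fact (?n + ?E)) * (ennreal (fact (?n + ?E)) * ?J)"
      by (simp add: mult.assoc[symmetric] ennreal_mult[symmetric] del: ennreal_fact)
    also have "\<dots> = ennreal (1 / fact (?n + ?E) * ?r)"
      unfolding main using k l by (intro ennreal_mult[symmetric]) (auto intro!: mult_nonneg_nonneg prod_nonneg simp: less_imp_le)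
    finally show "(\<integral>\<^sup>+x. ennreal ((\<Prod>i\<in>UNIV. bary x i ^ e i) /
             (\<Sum>i\<in>UNIV. l i * bary x i) ^ (?n + 1 + ?E)) * indicator (convex hull (range p)) x \<partial>lborel)
      = ennreal (k / fact (?n + ?E) * (\<Prod>i\<in>UNIV. fact (e i) / l i ^ (e i + 1)))"
      by (simp add: Q_def L_def \<sigma>_def)
  qed
qed

end

section \<open>Fibre volumes of simplices\<close>

lemma noncollinear_combination:
  fixes a b c :: "'a::euclidean_space"
  assumes nc: "\<not> collinear {a, b, c}"
    and sum: "x + y + z = 0" "x *\<^sub>R a + y *\<^sub>R b + z *\<^sub>R c = 0"
  shows "x = 0" "y = 0" "z = 0"
proof -
  have abc: "a \<noteq> b" "a \<noteq> c" "b \<noteq> c" and nad: "\<not> affine_dependent {a, b, c}"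
    using nc by (auto simp: collinear_3_eq_affine_dependent)
  have "\<not> (x \<noteq> 0 \<or> y \<noteq> 0 \<or> z \<noteq> 0)"
  proof
    assume "x \<noteq> 0 \<or> y \<noteq> 0 \<or> z \<noteq> 0"
    then have "affine_dependent {a, b, c}"
      unfolding affine_dependent_explicit_finite[OF finite.insertI[OF finite.insertI[OF finite.insertI[OF finite.emptyI]]]]
      using sum abc by (intro exI[of _ "\<lambda>u. if u = a then x else if u = b then y else z"]) (auto simp: add.assoc)
    with nad show False by simp
  qed
  then show "x = 0" "y = 0" "z = 0" by auto
qed

text \<open>
  Three knots that span the plane stay at height 0, and the other five are lifted to the standard
  basis vectors.
\<close>

lemma lifts_knots_exists:
  fixes a b c :: "real^2"
  assumes K: "{#a, b, c#} \<subseteq># K" and size: "size K = 8" and nc: "\<not> collinear {a, b, c}"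
  shows "\<exists>P. lifts_knots P K"
proof -
  define R where "R = K - {#a, b, c#}"
  have KR: "K = {#a, b, c#} + R" unfolding R_def by (rule subset_mset.add_diff_inverse[OF K, symmetric])
  have sR: "size R = 5" using size unfolding KR by simp
  obtain xs where xs: "mset xs = R" using ex_mset by blast
  have len: "length xs = 5" using sR xs by auto
  obtain e :: "nat \<Rightarrow> real^5" where e: "bij_betw e {..<5} Basis"
    using finite_same_card_bij[of "{..<5::nat}" "Basis :: (real^5) set"] by auto
  have einj: "inj_on e {..<5}" and eB: "e i \<in> Basis" if "i < 5" for i
    using e that by (auto simp: bij_betw_def)
  have e0: "e i \<noteq> 0" if "i < 5" for i using eB[OF that] nonzero_Basis by blast
  define f where "f i = (xs ! i, e i)" for i
  define A where "A = {(a, 0), (b, 0), (c, 0::real^5)}"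
  define P where "P = A \<union> f ` {..<5}"
  have abc: "a \<noteq> b" "a \<noteq> c" "b \<noteq> c" using nc by (auto simp: collinear_3_eq_affine_dependent)
  have finj: "inj_on f {..<5}" using einj by (auto simp: inj_on_def f_def)
  have disj: "A \<inter> f ` {..<5} = {}" using e0 by (force simp: A_def f_def)
  have finA: "finite A" by (simp add: A_def)
  have cardA: "card A = 3" using abc by (simp add: A_def card_insert_if)
  have "card P = 8"
    unfolding P_def using disj cardA finA finj by (subst card_Un_disjoint) (auto simp: card_image)
  moreover have "image_mset fst (mset_set P) = K"
  proof -
    have "mset_set P = mset_set A + mset_set (f ` {..<5})"
      unfolding P_def using finA disj by (intro mset_set_Union) auto
    also have "mset_set (f ` {..<5}) = image_mset f (mset_set {..<5})"
      using finj by (rule image_mset_mset_set[symmetric])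
    also have "mset_set A = {#(a, 0), (b, 0), (c, 0)#}"
      using abc by (simp add: A_def)
    finally have "image_mset fst (mset_set P) = {#a, b, c#} + image_mset (\<lambda>i. xs ! i) (mset_set {..<5})"
      by (simp add: f_def multiset.map_comp o_def)
    also have "image_mset (\<lambda>i. xs ! i) (mset_set {..<5}) = R"
    proof -
      have "mset_set {..<5::nat} = mset [0..<5]" by (metis atLeast_upt mset_set_upto_eq_mset_upto)
      then have "image_mset (\<lambda>i. xs ! i) (mset_set {..<5}) = mset (map ((!) xs) [0..<length xs])"
        by (simp add: len)
      then show ?thesis by (simp add: map_nth xs)
    qed
    finally show ?thesis by (simp add: KR)
  qed
  moreover have "\<not> affine_dependent P"
  proof
    assume "affine_dependent P"
    moreover have finP: "finite P" using finA by (simp add: P_def)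
    ultimately obtain U v where U: "sum U P = 0" "(\<Sum>v\<in>P. U v *\<^sub>R v) = 0" and v: "v \<in> P" "U v \<noteq> 0"
      using affine_dependent_explicit_finite[of P] by blast
    have sumP: "sum h P = h (a, 0) + h (b, 0) + h (c, 0) + (\<Sum>i<5. h (f i))"
      for h :: "(real^2) \<times> (real^5) \<Rightarrow> 'x::ab_group_add"
      unfolding P_def using finA disj abc
      by (subst sum.union_disjoint) (auto simp: sum.reindex[OF finj] A_def add.assoc)
    have "snd (\<Sum>v\<in>P. U v *\<^sub>R v) = (\<Sum>i<5. U (f i) *\<^sub>R e i)"
      by (simp add: sumP snd_sum f_def)
    then have s0: "(\<Sum>i<5. U (f i) *\<^sub>R e i) = 0" using U by simp
    have Uf: "U (f i) = 0" if i: "i < 5" for i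
    proof -
      have "(\<Sum>j<5. U (f j) *\<^sub>R e j) \<bullet> e i = (\<Sum>j<5. U (f j) * (if j = i then 1 else 0))"
        unfolding inner_sum_left
      proof (intro sum.cong refl)
        fix j :: nat assume "j \<in> {..<5}"
        then have "e j = e i \<longleftrightarrow> j = i" using einj i by (auto simp: inj_on_def)
        then show "(U (f j) *\<^sub>R e j) \<bullet> e i = U (f j) * (if j = i then 1 else 0)"
          using eB[OF i] eB[of j] \<open>j \<in> {..<5}\<close> by (simp add: inner_Basis)
      qed
      also have "\<dots> = U (f i)" using i by (simp add: if_distrib cong: if_cong)
      finally show ?thesis using s0 by simp
    qed
    have "fst (\<Sum>v\<in>P. U v *\<^sub>R v) = U (a, 0) *\<^sub>R a + U (b, 0) *\<^sub>R b + U (c, 0) *\<^sub>R c"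
      by (simp add: sumP fst_sum Uf)
    then have f0: "U (a, 0) *\<^sub>R a + U (b, 0) *\<^sub>R b + U (c, 0) *\<^sub>R c = 0" using U by simp
    have s: "U (a, 0) + U (b, 0) + U (c, 0) = 0" using U(1) by (simp add: sumP Uf)
    from noncollinear_combination[OF nc s f0] have "U (a, 0) = 0" "U (b, 0) = 0" "U (c, 0) = 0" .
    with Uf v show False by (auto simp: P_def A_def)
  qed
  ultimately show ?thesis unfolding lifts_knots_def using finA by (intro exI[of _ P]) (simp add: P_def)
qed

lemma lifts_knots_frame:
  assumes "lifts_knots P K"
  obtains p :: "8 \<Rightarrow> (real^2) \<times> (real^5)"
  where "affine_frame p" "range p = P" "image_mset (\<lambda>i. fst (p i)) (mset_set UNIV) = K"
proof -
  from assms have fin: "finite P" and card: "card P = 8" and ad: "\<not> affine_dependent P"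
    and K: "image_mset fst (mset_set P) = K" by (auto simp: lifts_knots_def)
  obtain p where p: "bij_betw p (UNIV :: 8 set) P"
    using finite_same_card_bij[of "UNIV :: 8 set" P] fin card by auto
  then have inj: "inj p" and range: "range p = P" by (auto simp: bij_betw_def)
  have "affine_frame p"
  proof
    show "CARD(8) = DIM((real^2) \<times> (real^5)) + 1" by simp
    fix u i assume u: "sum u (UNIV :: 8 set) = 0" "(\<Sum>i\<in>UNIV. u i *\<^sub>R p i) = 0"
    have up: "u (inv p (p i)) = u i" for i using inj by simp
    show "u i = 0"
    proof (rule ccontr)
      assume "u i \<noteq> 0"
      have "(\<Sum>v\<in>P. u (inv p v)) = 0"
        unfolding range[symmetric] by (subst sum.reindex[OF inj]) (simp add: inj u)
      moreover have "(\<Sum>v\<in>P. u (inv p v) *\<^sub>R v) = 0"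
        unfolding range[symmetric] by (subst sum.reindex[OF inj]) (simp add: inj u)
      moreover have "p i \<in> P" "u (inv p (p i)) \<noteq> 0" using range \<open>u i \<noteq> 0\<close> inj by auto
      ultimately have "affine_dependent P"
        unfolding affine_dependent_explicit_finite[OF fin] by blast
      with ad show False by simp
    qed
  qed
  moreover have "image_mset (\<lambda>i. fst (p i)) (mset_set UNIV) = K"
    unfolding K[symmetric] range[symmetric] image_mset_mset_set[OF inj, symmetric]
    by (simp add: multiset.map_comp o_def)
  ultimately show ?thesis using that range by blast
qed

text \<open>
  Fubini's theorem applied to \<open>nn_integral_simplex_rational\<close> with an affine function that depends only on
  the first component. The exponent must be the number of vertices.
\<close>

lemma nn_integral_fibre_rational:
  fixes p :: "'n::{finite,wellorder} \<Rightarrow> 'a::euclidean_space \<times> 'b::euclidean_space"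
  assumes frame: "affine_frame p" and pos: "\<And>i. \<beta> + z \<bullet> fst (p i) > 0"
  defines "\<sigma> \<equiv> convex hull (range p)"
  shows "(\<integral>\<^sup>+x. ennreal (measure lborel {y. (x, y) \<in> \<sigma>} / measure lborel \<sigma> / (\<beta> + z \<bullet> x) ^ CARD('n)) \<partial>lborel)
    = ennreal (\<Prod>i\<in>UNIV. 1 / (\<beta> + z \<bullet> fst (p i)))"
proof -
  interpret affine_frame p by (rule frame)
  let ?n = "DIM('a \<times> 'b)"
  let ?l = "\<lambda>x. \<beta> + z \<bullet> x"
  let ?D = "\<lambda>x. ennreal (measure lborel {y. (x, y) \<in> \<sigma>} / measure lborel \<sigma> / ?l x ^ CARD('n))"
  obtain k where k: "k > 0" and kint: "\<And>e l. (\<And>i. l i > 0) \<Longrightarrow>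
      (\<integral>\<^sup>+x. ennreal ((\<Prod>i\<in>UNIV. bary x i ^ e i) /
             (\<Sum>i\<in>UNIV. l i * bary x i) ^ (?n + 1 + sum e UNIV)) * indicator \<sigma> x \<partial>lborel)
      = ennreal (k / fact (?n + sum e UNIV) * (\<Prod>i\<in>UNIV. fact (e i) / l i ^ (e i + 1)))"
    unfolding \<sigma>_def using nn_integral_simplex_rational by blast
  have comp: "compact \<sigma>" unfolding \<sigma>_def by (intro finite_imp_compact_convex_hull) simp
  have \<sigma>m[measurable]: "\<sigma> \<in> sets borel" using comp by (simp add: compact_imp_closed borel_closed)
  have fib: "{y. (x, y) \<in> \<sigma>} = snd ` (\<sigma> \<inter> {x} \<times> UNIV)" for x by force
  have fibcomp: "compact {y. (x, y) \<in> \<sigma>}" for x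
    unfolding fib
    by (rule compact_continuous_image[OF continuous_on_snd[OF continuous_on_id]
          compact_Int_closed[OF comp closed_Times[OF closed_singleton closed_UNIV]]])
  have fibfin: "emeasure lborel {y. (x, y) \<in> \<sigma>} = ennreal (measure lborel {y. (x, y) \<in> \<sigma>})" for x
    using emeasure_compact_finite[OF fibcomp[of x]] by (intro emeasure_eq_ennreal_measure) auto
  have fin: "emeasure lborel \<sigma> = ennreal (measure lborel \<sigma>)"
    using emeasure_compact_finite[OF comp] by (intro emeasure_eq_ennreal_measure) auto
  have vol: "measure lborel \<sigma> = k / fact ?n"
  proof -
    have "emeasure lborel \<sigma> = (\<integral>\<^sup>+x. indicator \<sigma> x \<partial>lborel)" by simp
    also have "\<dots> = ennreal (k / fact ?n)"
      using kint[of "\<lambda>_. 1" "\<lambda>_. 0"] by (simp add: sum_bary)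
    finally show ?thesis using k fin by simp
  qed
  have aff: "(\<Sum>i\<in>UNIV. ?l (fst (p i)) * bary xy i) = ?l (fst xy)" for xy
  proof -
    have "(\<Sum>i\<in>UNIV. ?l (fst (p i)) * bary xy i) = \<beta> * (\<Sum>i\<in>UNIV. bary xy i) + z \<bullet> fst (\<Sum>i\<in>UNIV. bary xy i *\<^sub>R p i)"
      by (simp add: fst_sum inner_sum_right sum_distrib_left sum.distrib algebra_simps)
    then show ?thesis by (simp add: sum_bary bary_combination)
  qed
  have "ennreal (k / fact ?n) * (\<Prod>i\<in>UNIV. ennreal (1 / ?l (fst (p i))))
      = ennreal (k / fact ?n * (\<Prod>i\<in>UNIV. 1 / ?l (fst (p i))))"
  proof -
    have "(\<Prod>i\<in>UNIV. ennreal (1 / ?l (fst (p i)))) = ennreal (\<Prod>i\<in>UNIV. 1 / ?l (fst (p i)))"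
      using pos by (intro prod_ennreal) (simp add: less_imp_le)
    then show ?thesis using k by (simp only: ennreal_mult'[of "k / fact ?n"] less_imp_le divide_nonneg_pos fact_gt_zero)
  qed
  also have "\<dots> = (\<integral>\<^sup>+xy. ennreal (1 / ?l (fst xy) ^ CARD('n)) * indicator \<sigma> xy \<partial>lborel)"
    using kint[of "\<lambda>i. ?l (fst (p i))" "\<lambda>_. 0", OF pos] by (simp add: aff dim)
  also have "\<dots> = (\<integral>\<^sup>+x. \<integral>\<^sup>+y. ennreal (1 / ?l x ^ CARD('n)) * indicator \<sigma> (x, y) \<partial>lborel \<partial>lborel)"
  proof -
    have [measurable]: "(\<lambda>xy. ?l (fst xy)) \<in> borel_measurable (borel :: ('a \<times> 'b) measure)"
      by (intro borel_measurable_continuous_onI continuous_intros)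
    have "(\<lambda>xy. ennreal (1 / ?l (fst xy) ^ CARD('n)) * indicator \<sigma> xy) \<in> borel_measurable (borel :: ('a \<times> 'b) measure)"
      by measurable
    then have "(\<lambda>xy. ennreal (1 / ?l (fst xy) ^ CARD('n)) * indicator \<sigma> xy) \<in> borel_measurable (lborel \<Otimes>\<^sub>M lborel)"
      by (simp add: lborel_prod)
    from lborel.nn_integral_fst[OF this] show ?thesis by (simp add: lborel_prod)
  qed
  also have "\<dots> = (\<integral>\<^sup>+x. ennreal (1 / ?l x ^ CARD('n)) * emeasure lborel {y. (x, y) \<in> \<sigma>} \<partial>lborel)"
  proof (rule nn_integral_cong)
    fix x
    have m: "{y. (x, y) \<in> \<sigma>} \<in> sets borel" using fibcomp by (simp add: compact_imp_closed borel_closed)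
    have "(\<integral>\<^sup>+y. ennreal (1 / ?l x ^ CARD('n)) * indicator \<sigma> (x, y) \<partial>lborel)
       = (\<integral>\<^sup>+y. ennreal (1 / ?l x ^ CARD('n)) * indicator {y. (x, y) \<in> \<sigma>} y \<partial>lborel)"
      by (simp add: indicator_def)
    also have "\<dots> = ennreal (1 / ?l x ^ CARD('n)) * emeasure lborel {y. (x, y) \<in> \<sigma>}"
      using m by (simp add: nn_integral_cmult_indicator)
    finally show "(\<integral>\<^sup>+y. ennreal (1 / ?l x ^ CARD('n)) * indicator \<sigma> (x, y) \<partial>lborel)
      = ennreal (1 / ?l x ^ CARD('n)) * emeasure lborel {y. (x, y) \<in> \<sigma>}" .
  qed
  also have "\<dots> = (\<integral>\<^sup>+x. ennreal (k / fact ?n) * ?D x \<partial>lborel)"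
  proof (rule nn_integral_cong)
    fix x
    show "ennreal (1 / ?l x ^ CARD('n)) * emeasure lborel {y. (x, y) \<in> \<sigma>} =
      ennreal (k / fact ?n) * ?D x"
      using k by (simp add: fibfin vol ennreal_mult'[symmetric] ennreal_mult''[symmetric] del: ennreal_fact)
  qed
  also have "\<dots> = ennreal (k / fact ?n) * (\<integral>\<^sup>+x. ?D x \<partial>lborel)"
  proof (rule nn_integral_cmult)
    have "\<sigma> \<in> sets (lborel \<Otimes>\<^sub>M lborel)" unfolding lborel_prod using \<sigma>m by simp
    from lborel.measurable_emeasure_Pair[OF this]
    have "(\<lambda>x. emeasure lborel (Pair x -` \<sigma>)) \<in> borel_measurable lborel" .
    then have "(\<lambda>x. measure lborel {y. (x, y) \<in> \<sigma>}) \<in> borel_measurable borel"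
      by (simp add: measure_def vimage_def)
    then show "(\<lambda>x. ?D x) \<in> borel_measurable lborel"
      by measurable
  qed
  finally have "ennreal (fact ?n / k) * (ennreal (k / fact ?n) * (\<Prod>i\<in>UNIV. ennreal (1 / ?l (fst (p i)))))
    = ennreal (fact ?n / k) * (ennreal (k / fact ?n) * (\<integral>\<^sup>+x. ?D x \<partial>lborel))"
    by (rule arg_cong)
  then have "(\<integral>\<^sup>+x. ?D x \<partial>lborel)
    = (\<Prod>i\<in>UNIV. ennreal (1 / ?l (fst (p i))))"
    using k by (simp add: mult.assoc[symmetric] ennreal_mult[symmetric] del: ennreal_fact)
  also have "\<dots> = ennreal (\<Prod>i\<in>UNIV. 1 / ?l (fst (p i)))"
    using pos by (intro prod_ennreal) (simp add: less_imp_le)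
  finally show ?thesis .
qed

text \<open>
  When \<open>x\<close> moves, the indicator function of the fibre over \<open>x\<close> converges at each \<open>y\<close> at which all
  barycentric coordinates of \<open>(x, y)\<close> are different from 0, and dominated convergence applies. A
  coordinate that depends on \<open>y\<close> vanishes only on a hyperplane of the fibre, which is a null set. A
  coordinate that does not depend on \<open>y\<close> is an affine function of \<open>x\<close> which is 1 at one projected
  vertex and 0 at all others; if it changed sign in \<open>T\<close> the fibre would disappear abruptly, and
  the assumption excludes this.
\<close>

lemma continuous_on_fibre_volume:
  fixes p :: "'n::{finite,wellorder} \<Rightarrow> 'a::euclidean_space \<times> 'b::euclidean_space"
  assumes frame: "affine_frame p"
    and facet: "\<And>i \<beta> z x. \<lbrakk>\<And>j. \<beta> + z \<bullet> fst (p j) = (if j = i then 1 else 0); x \<in> T\<rbrakk> \<Longrightarrow> \<beta> + z \<bullet> x \<ge> 0"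
  shows "continuous_on T (\<lambda>x. measure lborel {y. (x, y) \<in> convex hull (range p)})"
proof -
  interpret affine_frame p by (rule frame)
  define \<sigma> where "\<sigma> = convex hull (range p)"
  have mem: "(x, y) \<in> \<sigma> \<longleftrightarrow> (\<forall>i. bary (x, y) i \<ge> 0)" for x y
    by (simp add: \<sigma>_def convex_hull_eq_bary)
  have comp: "compact \<sigma>" unfolding \<sigma>_def by (intro finite_imp_compact_convex_hull) simp
  then obtain B where B: "\<And>xy. xy \<in> \<sigma> \<Longrightarrow> norm xy \<le> B" using compact_imp_bounded bounded_iff by metis
  have fib: "{y. (x, y) \<in> \<sigma>} = snd ` (\<sigma> \<inter> {x} \<times> UNIV)" for x by force
  have fibcomp: "compact {y. (x, y) \<in> \<sigma>}" for x
    unfolding fib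
    by (rule compact_continuous_image[OF continuous_on_snd[OF continuous_on_id]
          compact_Int_closed[OF comp closed_Times[OF closed_singleton closed_UNIV]]])
  have fibm: "{y. (x, y) \<in> \<sigma>} \<in> sets borel" for x
    using fibcomp by (simp add: compact_imp_closed borel_closed)
  define w where "w i = adjoint (\<lambda>y. inv cone_map (0, (0, y)) $ i) 1" for i
  define u where "u i = adjoint (\<lambda>x. inv cone_map (0, (x, 0)) $ i) 1" for i
  have linw: "linear (\<lambda>y. inv cone_map (0, (0, y)) $ i)" for i
  proof (rule linearI)
    show "inv cone_map (0, (0, x + y)) $ i = inv cone_map (0, (0, x)) $ i + inv cone_map (0, (0, y)) $ i" for x y
      using linear_add[OF linear_inv_cone_map, of "(0, (0, x))" "(0, (0, y))"] by simp
    show "inv cone_map (0, (0, c *\<^sub>R x)) $ i = c *\<^sub>R (inv cone_map (0, (0, x)) $ i)" for x c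
      using linear_cmul[OF linear_inv_cone_map, of c "(0, (0, x))"] by simp
  qed
  have linu: "linear (\<lambda>x. inv cone_map (0, (x, 0)) $ i)" for i
  proof (rule linearI)
    show "inv cone_map (0, (x + y, 0)) $ i = inv cone_map (0, (x, 0)) $ i + inv cone_map (0, (y, 0)) $ i" for x y
      using linear_add[OF linear_inv_cone_map, of "(0, (x, 0))" "(0, (y, 0))"] by simp
    show "inv cone_map (0, (c *\<^sub>R x, 0)) $ i = c *\<^sub>R (inv cone_map (0, (x, 0)) $ i)" for x c
      using linear_cmul[OF linear_inv_cone_map, of c "(0, (x, 0))"] by simp
  qed
  have wy: "inv cone_map (0, (0, y)) $ i = w i \<bullet> y" for y i
    using adjoint_works[OF linw[of i], of y 1] by (simp add: w_def inner_commute)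
  have ux: "inv cone_map (0, (x, 0)) $ i = u i \<bullet> x" for x i
    using adjoint_works[OF linu[of i], of x 1] by (simp add: u_def inner_commute)
  have bary_eq: "bary (x, y) i = bary 0 i + u i \<bullet> x + w i \<bullet> y" for x y i
  proof -
    have "inv cone_map ((1, 0) + ((0, (x, 0)) + (0, (0, y)))) = inv cone_map (1, 0) + (inv cone_map (0, (x, 0)) + inv cone_map (0, (0, y)))"
      by (simp only: linear_add[OF linear_inv_cone_map])
    then show ?thesis by (simp add: bary_def wy ux)
  qed
  have nonneg: "bary (x, y) i \<ge> 0" if "w i = 0" "x \<in> T" for x y i
  proof -
    have "bary 0 i + u i \<bullet> fst (p j) = (if j = i then 1 else 0)" for j
    proof -
      have "bary (p j) i = (if i = j then 1 else 0)"
        by (rule bary_unique) (simp_all add: if_distrib[of "\<lambda>c. c *\<^sub>R _"] cong: if_cong)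
      then show ?thesis using bary_eq[of "fst (p j)" "snd (p j)" i] that by (auto split: if_splits)
    qed
    from facet[OF this that(2)] show ?thesis using that by (simp add: bary_eq)
  qed
  have null: "{y. bary (x, y) i = 0} \<in> null_sets lborel" if "w i \<noteq> 0" for x i
  proof -
    have eq: "{y. bary (x, y) i = 0} = {y. w i \<bullet> y = - (bary 0 i + u i \<bullet> x)}"
      by (auto simp: bary_eq)
    have "negligible {y. w i \<bullet> y = - (bary 0 i + u i \<bullet> x)}"
      by (rule negligible_hyperplane) (use that in simp)
    then have "emeasure lebesgue {y. bary (x, y) i = 0} = 0"
      unfolding eq negligible_iff_null_sets by auto
    moreover have "{y. bary (x, y) i = 0} \<in> sets lborel"
      unfolding eq by (simp add: borel_closed closed_hyperplane)
    ultimately show ?thesis by (simp add: null_sets_def)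
  qed
  show ?thesis unfolding continuous_on_sequentially \<sigma>_def[symmetric]
  proof (intro allI ballI impI, elim conjE)
    fix X x assume x: "x \<in> T" and X: "\<forall>n. X n \<in> T" and lim: "X \<longlonglongrightarrow> x"
    have limb: "(\<lambda>n. bary (X n, y) i) \<longlonglongrightarrow> bary (x, y) i" for y i
      unfolding bary_eq by (intro tendsto_intros lim)
    \<comment> \<open>The \<open>y\<close> at which some coordinate with \<open>w i \<noteq> 0\<close> vanishes form a null set.\<close>
    have AE1: "AE y in lborel. \<forall>i\<in>{i. w i \<noteq> 0}. bary (x, y) i \<noteq> 0"
    proof (rule AE_finite_allI)
      fix i assume "i \<in> {i. w i \<noteq> 0}"
      then show "AE y in lborel. bary (x, y) i \<noteq> 0" using null[of i x] by (intro AE_I'[of "{y. bary (x, y) i = 0}"]) auto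
    qed simp
    have ptw: "(\<lambda>n. indicator {y. (X n, y) \<in> \<sigma>} y :: real) \<longlonglongrightarrow> indicator {y. (x, y) \<in> \<sigma>} y"
      if y: "\<forall>i\<in>{i. w i \<noteq> 0}. bary (x, y) i \<noteq> 0" for y
    proof (cases "(x, y) \<in> \<sigma>")
      case True
      have "eventually (\<lambda>n. bary (X n, y) i \<ge> 0) sequentially" for i
      proof (cases "w i = 0")
        case True
        then show ?thesis using nonneg X by simp
      next
        case False
        then have "bary (x, y) i > 0" using y True mem by (auto simp: less_le)
        from order_tendstoD(1)[OF limb this] show ?thesis by (rule eventually_mono) simp
      qed
      then have "eventually (\<lambda>n. \<forall>i. bary (X n, y) i \<ge> 0) sequentially"
        by (intro eventually_all_finite) auto
      then have "eventually (\<lambda>n. indicator {y. (X n, y) \<in> \<sigma>} y = (1::real)) sequentially"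
        by (rule eventually_mono) (simp add: mem)
      then show ?thesis using True by (simp add: tendsto_eventually)
    next
      case False
      then obtain i where "bary (x, y) i < 0" by (auto simp: mem not_le)
      have out: "(X n, y) \<notin> \<sigma>" if "bary (X n, y) i < 0" for n
        using that unfolding mem by (meson not_le)
      have "eventually (\<lambda>n. (X n, y) \<notin> \<sigma>) sequentially"
        by (rule eventually_mono[OF order_tendstoD(2)[OF limb \<open>bary (x, y) i < 0\<close>] out])
      then have "eventually (\<lambda>n. indicator {y. (X n, y) \<in> \<sigma>} y = (0::real)) sequentially"
        by (rule eventually_mono) simp
      then show ?thesis using False by (simp add: tendsto_eventually)
    qed
    have "(\<lambda>n. \<integral>y. indicator {y. (X n, y) \<in> \<sigma>} y \<partial>lborel) \<longlonglongrightarrow> (\<integral>y. indicator {y. (x, y) \<in> \<sigma>} y \<partial>lborel :: real)"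
    proof (rule integral_dominated_convergence[where w = "indicator (cball 0 B)"])
      show "AE y in lborel. (\<lambda>n. indicator {y. (X n, y) \<in> \<sigma>} y :: real) \<longlonglongrightarrow> indicator {y. (x, y) \<in> \<sigma>} y"
        by (rule eventually_mono[OF AE1 ptw])
      have "norm y \<le> B" if "(x', y) \<in> \<sigma>" for x' y
        using B[OF that] norm_snd_le[of y x'] by simp
      then show "AE y in lborel. norm (indicator {y. (X n, y) \<in> \<sigma>} y :: real) \<le> indicator (cball 0 B) y" for n
        by (intro AE_I2) (auto simp: indicator_def)
      show "integrable lborel (indicator (cball (0::'b) B) :: 'b \<Rightarrow> real)"
        using emeasure_lborel_cball_finite[of "0::'b" B] by (simp add: integrable_indicator_iff)
    qed (use fibm in auto)
    then show "((\<lambda>x. measure lborel {y. (x, y) \<in> \<sigma>}) \<circ> X) \<longlonglongrightarrow> measure lborel {y. (x, y) \<in> \<sigma>}"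
      using fibm by (simp add: o_def)
  qed
qed

section \<open>Continuous functions are determined by their rational moments\<close>

text \<open>
  The algebra generated by the exponentials, to which the theorem of Stone and Weierstrass applies.
\<close>

inductive exp_sum :: "('a::euclidean_space \<Rightarrow> real) \<Rightarrow> bool" where
  exp_sum_exp: "exp_sum (\<lambda>x. c * exp (w \<bullet> x))"
| exp_sum_add: "exp_sum f \<Longrightarrow> exp_sum g \<Longrightarrow> exp_sum (\<lambda>x. f x + g x)"

lemma exp_sum_mult_exp:
  assumes "exp_sum g" shows "exp_sum (\<lambda>x. (c * exp (w \<bullet> x)) * g x)"
  using assms
proof (induction rule: exp_sum.induct)
  case (exp_sum_exp c' w')
  have "(\<lambda>x. (c * exp (w \<bullet> x)) * (c' * exp (w' \<bullet> x))) = (\<lambda>x. (c * c') * exp ((w + w') \<bullet> x))"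
    by (simp add: fun_eq_iff inner_add_left exp_add)
  then show ?case by (simp only: exp_sum.exp_sum_exp)
next
  case (exp_sum_add f g)
  then have "exp_sum (\<lambda>x. (c * exp (w \<bullet> x)) * f x + (c * exp (w \<bullet> x)) * g x)"
    by (intro exp_sum.exp_sum_add)
  then show ?case by (simp only: distrib_left)
qed

lemma exp_sum_mult:
  assumes "exp_sum f" "exp_sum g" shows "exp_sum (\<lambda>x. f x * g x)"
  using assms(1)
proof (induction rule: exp_sum.induct)
  case (exp_sum_exp c w)
  show ?case by (rule exp_sum_mult_exp[OF assms(2)])
next
  case (exp_sum_add f h)
  then have "exp_sum (\<lambda>x. f x * g x + h x * g x)"
    by (intro exp_sum.exp_sum_add)
  then show ?case by (simp only: distrib_right)
qed

lemma continuous_on_exp_sum: "exp_sum f \<Longrightarrow> continuous_on T f"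
  by (induction rule: exp_sum.induct) (auto intro!: continuous_intros)

text \<open>
  The dominating function for differentiation under the integral; it does not depend on the increment,
  by Bernoulli's inequality.
\<close>

lemma inverse_power_difference_bound:
  fixes l t :: real assumes l: "l > 0" and t: "t > 0"
  shows "\<bar>(1 / (l + t) ^ N - 1 / l ^ N) / t\<bar> \<le> real N / l ^ (N + 1)"
proof -
  define r where "r = l / (l + t)"
  have r: "0 < r" "r < 1" using l t by (auto simp: r_def)
  have lt: "1 / (l + t) ^ N = r ^ N / l ^ N" using l t by (simp add: r_def power_divide)
  have "1 + real N * (r - 1) \<le> (1 + (r - 1)) ^ N" using r by (intro Bernoulli_inequality) simp
  then have b: "1 - r ^ N \<le> real N * (1 - r)" by (simp add: algebra_simps)
  have "1 - r = t / (l + t)" using l t by (simp add: r_def field_simps)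
  also have "\<dots> \<le> t / l" using l t by (intro divide_left_mono) auto
  finally have "real N * (1 - r) \<le> real N * (t / l)" by (intro mult_left_mono) auto
  with b have b2: "1 - r ^ N \<le> real N * (t / l)" by simp
  have "r ^ N \<le> 1" using r by (simp add: power_le_one)
  then have "(1 - r ^ N) / l ^ N / t \<ge> 0" using l t by (intro divide_nonneg_pos) auto
  moreover have "(1 / (l + t) ^ N - 1 / l ^ N) / t = - ((1 - r ^ N) / l ^ N / t)"
    by (simp add: lt diff_divide_distrib)
  ultimately have "\<bar>(1 / (l + t) ^ N - 1 / l ^ N) / t\<bar> = (1 - r ^ N) / l ^ N / t"
    by (simp only: abs_minus_cancel abs_of_nonneg)
  also have "\<dots> \<le> real N * (t / l) / l ^ N / t"
    using b2 l t by (intro divide_right_mono) auto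
  also have "\<dots> = real N / l ^ (N + 1)" using l t by (simp add: field_simps)
  finally show ?thesis .
qed

text \<open>
  The reciprocal powers of affine functions are not closed under multiplication, so the theorem of Stone
  and Weierstrass does not apply to them directly. Differentiation with respect to the constant term
  \<open>\<beta>\<close> raises the exponent, so all exponents from \<open>m\<close> on occur. Powers of \<open>1 + \<zeta> / n\<close> with
  exponent \<open>- n\<close> converge to \<open>exp (- \<zeta>)\<close>, and for \<open>\<zeta> \<ge> 0\<close> they are bounded by 1. Hence \<open>G\<close> is
  orthogonal to all exponentials, and these span an algebra that separates points.
\<close>

lemma rational_moments_determine:
  fixes T :: "'a::euclidean_space set" and G :: "'a \<Rightarrow> real"
  assumes T: "compact T" "closure (interior T) = T" and G: "continuous_on T G" and m: "m > 0"
    and zero: "\<And>\<beta> z. (\<And>x. x \<in> T \<Longrightarrow> \<beta> + z \<bullet> x > 0) \<Longrightarrow>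
      (LINT x:T|lborel. G x / (\<beta> + z \<bullet> x) ^ m) = 0"
    and x: "x \<in> T"
  shows "G x = 0"
proof -
  have Tm[measurable]: "T \<in> sets borel" using T by (simp add: compact_imp_closed borel_closed)
  have int: "set_integrable lborel T f" if "continuous_on T f" for f :: "'a \<Rightarrow> real"
    unfolding set_integrable_def by (rule borel_integrable_compact[OF T(1) that])
  have meas: "(\<lambda>x. indicator T x *\<^sub>R f x) \<in> borel_measurable lborel" if "continuous_on T f" for f :: "'a \<Rightarrow> real"
    using int[OF that] by (simp add: set_integrable_def borel_measurable_integrable)
  have lim: "(LINT x:T|lborel. f x) = 0"
    if f: "continuous_on T f" and F: "\<And>n. continuous_on T (F n)" "\<And>n. (LINT x:T|lborel. F n x) = 0"
      and ptw: "\<And>x. x \<in> T \<Longrightarrow> (\<lambda>n. F n x) \<longlonglongrightarrow> f x"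
      and w: "continuous_on T w" and bound: "\<And>x n. x \<in> T \<Longrightarrow> \<bar>F n x\<bar> \<le> w x"
    for f w :: "'a \<Rightarrow> real" and F :: "nat \<Rightarrow> 'a \<Rightarrow> real"
  proof -
    have "(\<lambda>n. LINT x:T|lborel. F n x) \<longlonglongrightarrow> (LINT x:T|lborel. f x)"
      unfolding set_lebesgue_integral_def
    proof (rule integral_dominated_convergence[where w = "\<lambda>x. indicator T x *\<^sub>R w x"])
      show "integrable lborel (\<lambda>x. indicator T x *\<^sub>R w x)"
        using int[OF w] by (simp add: set_integrable_def)
      show "AE x in lborel. (\<lambda>n. indicator T x *\<^sub>R F n x) \<longlonglongrightarrow> indicator T x *\<^sub>R f x"
        by (intro AE_I2) (auto simp: indicator_def intro: ptw)
      show "AE x in lborel. norm (indicator T x *\<^sub>R F n x) \<le> indicator T x *\<^sub>R w x" for n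
        by (intro AE_I2) (auto simp: indicator_def intro: bound)
    qed (use meas f F in auto)
    then show ?thesis by (simp add: F(2) LIMSEQ_const_iff)
  qed
  have pow: "(LINT x:T|lborel. G x / (\<beta> + z \<bullet> x) ^ (m + n)) = 0"
    if "\<And>x. x \<in> T \<Longrightarrow> \<beta> + z \<bullet> x > 0" for \<beta> z n
    using that
  proof (induction n arbitrary: \<beta> z)
    case 0
    then show ?case using zero by simp
  next
    case (Suc n)
    let ?N = "m + n"
    let ?l = "\<lambda>x. \<beta> + z \<bullet> x"
    define \<epsilon> where "\<epsilon> j = inverse (real (Suc j))" for j
    let ?d = "\<lambda>j x. (1 / \<epsilon> j) * (G x / (?l x + \<epsilon> j) ^ ?N - G x / ?l x ^ ?N)"
    have \<epsilon>: "\<epsilon> j > 0" for j by (simp add: \<epsilon>_def)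
    have posj: "?l x + \<epsilon> j > 0" if "x \<in> T" for x j using Suc.prems[OF that] \<epsilon>[of j] by simp
    have cj: "continuous_on T (\<lambda>x. G x / (?l x + \<epsilon> j) ^ ?N)" for j
      using posj[of _ j] by (intro continuous_intros G) force
    have c0: "continuous_on T (\<lambda>x. G x / ?l x ^ k)" for k
      using Suc.prems by (intro continuous_intros G) force
    have "(LINT x:T|lborel. (- real ?N) * (G x / ?l x ^ (?N + 1))) = 0"
    proof (rule lim[where F = "\<lambda>j x. ?d j x"
          and w = "\<lambda>x. \<bar>G x\<bar> * (real ?N / ?l x ^ (?N + 1))"])
      show "continuous_on T (\<lambda>x. (- real ?N) * (G x / ?l x ^ (?N + 1)))"
        by (intro continuous_intros c0)
      show "continuous_on T (\<lambda>x. ?d j x)" for j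
        by (intro continuous_on_mult_left continuous_on_diff cj c0)
      have "(LINT x:T|lborel. G x / (?l x + \<epsilon> j) ^ ?N - G x / ?l x ^ ?N) = 0" for j
      proof -
        have "(LINT x:T|lborel. G x / (?l x + \<epsilon> j) ^ ?N) = 0"
          using Suc.IH[of "\<beta> + \<epsilon> j" z] posj by (simp add: add.assoc add.commute add.left_commute)
        moreover have "(LINT x:T|lborel. G x / ?l x ^ ?N) = 0" by (rule Suc.IH[OF Suc.prems])
        ultimately show ?thesis by (subst set_integral_diff(2)) (auto intro: int cj c0)
      qed
      then show "(LINT x:T|lborel. ?d j x) = 0" for j
        unfolding set_integral_mult_right by simp
      show "continuous_on T (\<lambda>x. \<bar>G x\<bar> * (real ?N / ?l x ^ (?N + 1)))"
        using Suc.prems by (intro continuous_intros G) force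
      fix x assume xT: "x \<in> T"
      have l: "?l x > 0" by (rule Suc.prems[OF xT])
      have eq: "?d j x
          = G x * ((1 / (?l x + \<epsilon> j) ^ ?N - 1 / ?l x ^ ?N) / \<epsilon> j)" for j
        by (simp add: algebra_simps diff_divide_distrib)
      show "\<bar>?d j x\<bar> \<le> \<bar>G x\<bar> * (real ?N / ?l x ^ (?N + 1))" for j
        unfolding eq abs_mult by (intro mult_left_mono inverse_power_difference_bound l \<epsilon>) simp
      have "((\<lambda>s. 1 / s ^ ?N) has_field_derivative (- real ?N / ?l x ^ (?N + 1))) (at (?l x))"
      proof -
        have "((\<lambda>s. inverse (s ^ ?N)) has_field_derivative
          - (inverse (?l x ^ ?N) * (real ?N * ?l x ^ (?N - 1)) * inverse (?l x ^ ?N))) (at (?l x))"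
          using l by (auto intro!: derivative_eq_intros)
        moreover define A where "A = ?l x ^ (?N - 1)"
        have A: "A > 0" using l by (simp add: A_def)
        have e1: "?l x ^ ?N = ?l x * A"
          using m unfolding A_def by (cases ?N) auto
        then have e2: "?l x ^ (?N + 1) = ?l x * (?l x * A)" by simp
        have "- (inverse (?l x ^ ?N) * (real ?N * ?l x ^ (?N - 1)) * inverse (?l x ^ ?N)) = - real ?N / ?l x ^ (?N + 1)"
        proof -
          have "- (inverse (s * A) * (N * A) * inverse (s * A)) = - N / (s * (s * A))" if "s > 0" for s N :: real
            using that A by (simp add: field_simps)
          from this[OF l] show ?thesis unfolding e1 e2 A_def[symmetric] .
        qed
        ultimately show ?thesis by (simp add: inverse_eq_divide)
      qed
      then have d: "(\<lambda>h. (1 / (?l x + h) ^ ?N - 1 / ?l x ^ ?N) / h) \<midarrow>0\<rightarrow> - real ?N / ?l x ^ (?N + 1)"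
        by (simp add: DERIV_def)
      have "filterlim \<epsilon> (at 0) sequentially"
        unfolding \<epsilon>_def by (rule filterlim_atI[OF LIMSEQ_inverse_real_of_nat]) simp
      from filterlim_compose[OF d this]
      have "(\<lambda>j. G x * ((1 / (?l x + \<epsilon> j) ^ ?N - 1 / ?l x ^ ?N) / \<epsilon> j)) \<longlonglongrightarrow> G x * (- real ?N / ?l x ^ (?N + 1))"
        by (rule tendsto_mult_left)
      then show "(\<lambda>j. ?d j x) \<longlonglongrightarrow> (- real ?N) * (G x / ?l x ^ (?N + 1))"
        unfolding eq by (simp add: mult.commute)
    qed
    then have "(- real ?N) * (LINT x:T|lborel. G x / ?l x ^ (?N + 1)) = 0"
      by (simp only: set_integral_mult_right)
    then show ?case using m by simp
  qed
  have expz: "(LINT x:T|lborel. G x * exp (w \<bullet> x)) = 0" for w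
  proof -
    have "compact ((\<lambda>x. w \<bullet> x) ` T)" by (intro compact_continuous_image T continuous_intros)
    then obtain a where a: "\<And>x. x \<in> T \<Longrightarrow> w \<bullet> x \<le> a"
      by (meson bounded_imp_bdd_above compact_imp_bounded bdd_above.unfold imageI)
    \<comment> \<open>The shift by \<open>a\<close> only costs a constant factor and makes \<open>\<zeta>\<close> nonnegative.\<close>
    define \<zeta> where "\<zeta> x = a - w \<bullet> x" for x
    have \<zeta>: "\<zeta> x \<ge> 0" if "x \<in> T" for x using a[OF that] by (simp add: \<zeta>_def)
    have ge1: "1 + \<zeta> x / real (m + n) \<ge> 1" if "x \<in> T" for x n using \<zeta>[OF that] by simp
    have cz: "continuous_on T (\<lambda>x. 1 + \<zeta> x / real (m + n))" for n
      unfolding \<zeta>_def using m by (intro continuous_intros) simp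
    have ne: "(1 + \<zeta> x / real (m + n)) ^ (m + n) \<noteq> 0" if "x \<in> T" for x n
      using ge1[OF that, of n] by (intro power_not_zero) linarith
    define H where "H n x = G x / (1 + \<zeta> x / real (m + n)) ^ (m + n)" for n x
    have "(LINT x:T|lborel. G x * exp (- \<zeta> x)) = 0"
    proof (rule lim[where F = H and w = "\<lambda>x. \<bar>G x\<bar>"])
      show "continuous_on T (\<lambda>x. G x * exp (- \<zeta> x))"
        unfolding \<zeta>_def by (intro continuous_intros G)
      show "continuous_on T (H n)" for n
        unfolding H_def using ne by (intro continuous_on_divide continuous_on_power G cz) blast
      show "(LINT x:T|lborel. H n x) = 0" for n
      proof -
        have eq: "1 + \<zeta> x / real (m + n) = (1 + a / real (m + n)) + ((- 1 / real (m + n)) *\<^sub>R w) \<bullet> x" for x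
          by (simp add: \<zeta>_def diff_divide_distrib)
        show ?thesis unfolding H_def eq
        proof (rule pow)
          fix x assume "x \<in> T"
          from ge1[OF this, of n] show "(1 + a / real (m + n)) + ((- 1 / real (m + n)) *\<^sub>R w) \<bullet> x > 0"
            unfolding eq[symmetric] by linarith
        qed
      qed
      show "continuous_on T (\<lambda>x. \<bar>G x\<bar>)" by (intro continuous_intros G)
      fix x assume xT: "x \<in> T"
      show "\<bar>H n x\<bar> \<le> \<bar>G x\<bar>" for n
      proof -
        have "(1 + \<zeta> x / real (m + n)) ^ (m + n) \<ge> 1" using ge1[OF xT] by (rule one_le_power)
        then have "\<bar>G x\<bar> / (1 + \<zeta> x / real (m + n)) ^ (m + n) \<le> \<bar>G x\<bar> / 1"
          by (intro divide_left_mono) auto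
        then show ?thesis using ge1[OF xT, of n] by (simp add: H_def)
      qed
      have "(\<lambda>n. (1 + \<zeta> x / real (n + m)) ^ (n + m)) \<longlonglongrightarrow> exp (\<zeta> x)"
        by (rule LIMSEQ_ignore_initial_segment[OF tendsto_exp_limit_sequentially])
      then have "(\<lambda>n. G x / (1 + \<zeta> x / real (m + n)) ^ (m + n)) \<longlonglongrightarrow> G x / exp (\<zeta> x)"
        by (intro tendsto_intros) (simp_all add: add.commute)
      then show "(\<lambda>n. H n x) \<longlonglongrightarrow> G x * exp (- \<zeta> x)"
        by (simp add: H_def exp_minus field_simps)
    qed
    moreover have "G x * exp (- \<zeta> x) = exp (- a) * (G x * exp (w \<bullet> x))" for x
      by (simp add: \<zeta>_def exp_diff exp_minus field_simps)
    ultimately have "exp (- a) * (LINT x:T|lborel. G x * exp (w \<bullet> x)) = 0"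
      by (simp only: set_integral_mult_right)
    then show ?thesis by simp
  qed
  have sums: "(LINT x:T|lborel. G x * h x) = 0" if "exp_sum h" for h
    using that
  proof (induction rule: exp_sum.induct)
    case (exp_sum_exp c w)
    have "G x * (c * exp (w \<bullet> x)) = c * (G x * exp (w \<bullet> x))" for x by simp
    then show ?case by (simp only: set_integral_mult_right expz mult_zero_right)
  next
    case (exp_sum_add f g)
    have "(LINT x:T|lborel. G x * f x + G x * g x) = (LINT x:T|lborel. G x * f x) + (LINT x:T|lborel. G x * g x)"
      by (intro set_integral_add(2) int continuous_on_mult G continuous_on_exp_sum exp_sum_add.hyps)
    then show ?case unfolding distrib_left using exp_sum_add.IH by simp
  qed
  interpret function_ring_on "{h. exp_sum h}" T
  proof
    show "compact T" by (rule T(1))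
    show "(\<lambda>_::'a. c) \<in> {h. exp_sum h}" for c
      using exp_sum_exp[of c "0::'a"] by simp
    fix x y :: 'a assume "x \<noteq> y"
    then have "(x - y) \<bullet> x - (x - y) \<bullet> y \<noteq> 0"
      unfolding inner_diff_right[symmetric] by simp
    then show "\<exists>f\<in>{h. exp_sum h}. f x \<noteq> f y"
      using exp_sum_exp[of 1 "x - y"] by (intro bexI[of _ "\<lambda>u. 1 * exp ((x - y) \<bullet> u)"]) auto
  qed (auto intro: exp_sum_add exp_sum_mult continuous_on_exp_sum)
  have GG: "continuous_on T (\<lambda>x. G x * G x)" by (intro continuous_intros G)
  let ?C = "LINT x:T|lborel. \<bar>G x\<bar>"
  have "(LINT x:T|lborel. G x * G x) \<le> e * ?C" if e: "e > 0" for e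
  proof -
    obtain h where h: "exp_sum h" "\<And>x. x \<in> T \<Longrightarrow> \<bar>G x - h x\<bar> < e"
      using Stone_Weierstrass_basic[OF G e] by auto
    have ch: "continuous_on T h" using h(1) by (rule continuous_on_exp_sum)
    have "(LINT x:T|lborel. G x * G x) = (LINT x:T|lborel. G x * G x) - (LINT x:T|lborel. G x * h x)"
      by (simp add: sums[OF h(1)])
    also have "\<dots> = (LINT x:T|lborel. G x * G x - G x * h x)"
      by (rule set_integral_diff(2)[symmetric]) (auto intro!: int continuous_intros G ch)
    also have "\<dots> \<le> (LINT x:T|lborel. e * \<bar>G x\<bar>)"
    proof (rule set_integral_mono)
      fix x assume "x \<in> T"
      have "G x * G x - G x * h x = G x * (G x - h x)" by (simp add: algebra_simps)
      also have "\<dots> \<le> \<bar>G x\<bar> * \<bar>G x - h x\<bar>" by (metis abs_ge_self abs_mult)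
      also have "\<dots> \<le> \<bar>G x\<bar> * e" using h(2)[OF \<open>x \<in> T\<close>] by (intro mult_left_mono) auto
      finally show "G x * G x - G x * h x \<le> e * \<bar>G x\<bar>" by (simp add: mult.commute)
    qed (auto intro!: int continuous_intros G ch)
    also have "\<dots> = e * ?C" by (rule set_integral_mult_right)
    finally show ?thesis .
  qed
  note small = this
  have Cn: "?C \<ge> 0" unfolding set_lebesgue_integral_def by (intro Bochner_Integration.integral_nonneg) (simp add: indicator_def)
  have "(LINT x:T|lborel. G x * G x) \<le> 0"
  proof (rule field_le_epsilon)
    fix e :: real assume "e > 0"
    then have "(LINT x:T|lborel. G x * G x) \<le> e / (?C + 1) * ?C" using Cn by (intro small) simp
    also have "\<dots> \<le> e" using Cn \<open>e > 0\<close> by (simp add: field_simps)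
    finally show "(LINT x:T|lborel. G x * G x) \<le> 0 + e" by simp
  qed
  moreover have "(LINT x:T|lborel. G x * G x) \<ge> 0" unfolding set_lebesgue_integral_def by (intro Bochner_Integration.integral_nonneg) (simp add: indicator_def)
  ultimately have "(\<integral>x. indicator T x *\<^sub>R (G x * G x) \<partial>lborel) = 0"
    unfolding set_lebesgue_integral_def by (rule antisym)
  then have AE: "AE x in lborel. indicator T x *\<^sub>R (G x * G x) = 0"
    using int[OF GG] by (subst (asm) integral_nonneg_eq_0_iff_AE) (auto simp: set_integrable_def)
  define U where "U = {x \<in> interior T. G x \<noteq> 0}"
  have "open U"
  proof -
    have "continuous_on (interior T) G" using G interior_subset continuous_on_subset by blast
    from continuous_open_preimage[OF this open_interior, of "- {0}"] show ?thesis
      by (simp add: U_def vimage_def Int_def conj_commute open_Compl)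
  qed
  moreover have "negligible U"
  proof -
    have "AE x in lborel. x \<notin> U"
      using AE by eventually_elim (use interior_subset in \<open>auto simp: U_def indicator_def\<close>)
    then have "emeasure lborel U = 0"
      using \<open>open U\<close> by (subst (asm) AE_iff_measurable[of U]) auto
    then have "emeasure lebesgue U = 0" using \<open>open U\<close> by simp
    then show ?thesis unfolding negligible_iff_null_sets using \<open>open U\<close> by (auto simp: null_sets_def)
  qed
  ultimately have "U = {}" using open_not_negligible by blast
  then have "G y = 0" if "y \<in> interior T" for y using that by (auto simp: U_def)
  moreover have "continuous_on (closure (interior T)) G" "x \<in> closure (interior T)"
    using T(2) G x by simp_all
  ultimately show "G x = 0" using continuous_constant_on_closure[of "interior T" G 0 x] by blast
qed

section \<open>Polarization of fifth powers\<close>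

text \<open>
  An alternating sum over subsets is an iterated difference, one for each element of the set.
\<close>

lemma alternating_sum_Pow_insert:
  fixes F :: "real \<Rightarrow> real" and q :: "'a \<Rightarrow> real"
  assumes "finite A" "a \<notin> A"
  shows "(\<Sum>R\<in>Pow (insert a A). (- 1) ^ card R * F (sum q R)) =
    (\<Sum>R\<in>Pow A. (- 1) ^ card R * (F (sum q R) - F (q a + sum q R)))"
proof -
  have inj: "inj_on (insert a) (Pow A)" 
  proof (rule inj_onI)
    fix R S assume "R \<in> Pow A" "S \<in> Pow A" "insert a R = insert a S"
    then show "R = S" using assms(2) by (subst (asm) insert_ident) auto
  qed
  have "(\<Sum>R\<in>Pow (insert a A). (- 1) ^ card R * F (sum q R)) =
    (\<Sum>R\<in>Pow A. (- 1) ^ card R * F (sum q R)) + (\<Sum>R\<in>insert a ` Pow A. (- 1) ^ card R * F (sum q R))"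
    unfolding Pow_insert using assms by (intro sum.union_disjoint) auto
  also have "(\<Sum>R\<in>insert a ` Pow A. (- 1) ^ card R * F (sum q R)) =
    (\<Sum>R\<in>Pow A. (- 1) ^ card (insert a R) * F (sum q (insert a R)))"
    by (simp add: sum.reindex[OF inj])
  also have "\<dots> = (\<Sum>R\<in>Pow A. - ((- 1) ^ card R * F (q a + sum q R)))"
  proof (rule sum.cong)
    fix R assume "R \<in> Pow A"
    then have "finite R" "a \<notin> R" using assms finite_subset by auto
    then show "(- 1) ^ card (insert a R) * F (sum q (insert a R)) = - ((- 1) ^ card R * F (q a + sum q R))"
      by simp
  qed simp
  finally show ?thesis by (simp add: sum_negf right_diff_distrib sum_subtractf)
qed

text \<open>
  Each difference lowers the degree by 1 and splits off its increment as a factor. The intermediate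
  closed forms keep the identities small.
\<close>

lemma polarization_quintic:
  fixes a b c d e :: real
  defines "F1 \<equiv> \<lambda>t. t ^ 5 - (a + t) ^ 5"
  defines "F2 \<equiv> \<lambda>t. F1 t - F1 (b + t)"
  defines "F3 \<equiv> \<lambda>t. F2 t - F2 (c + t)"
  defines "F4 \<equiv> \<lambda>t. F3 t - F3 (d + t)"
  shows "F4 0 - F4 (e + 0) = - 120 * (a * b * c * d * e)"
proof -
  have 1: "F1 t = - (a * (5 * t ^ 4 + 10 * a * t ^ 3 + 10 * a ^ 2 * t ^ 2 + 5 * a ^ 3 * t + a ^ 4))" for t
    unfolding F1_def by algebra
  have 2: "F2 t = a * b * (20 * t ^ 3 + 30 * (a + b) * t ^ 2 + (20 * a ^ 2 + 30 * a * b + 20 * b ^ 2) * t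
      + (5 * a ^ 3 + 10 * a ^ 2 * b + 10 * a * b ^ 2 + 5 * b ^ 3))" for t
    unfolding F2_def 1 by algebra
  have 3: "F3 t = - (a * b * c * (60 * t ^ 2 + 60 * (a + b + c) * t
      + (20 * a ^ 2 + 20 * b ^ 2 + 20 * c ^ 2 + 30 * a * b + 30 * a * c + 30 * b * c)))" for t
    unfolding F3_def 2 by algebra
  have 4: "F4 t = a * b * c * d * (120 * t + 60 * (a + b + c + d))" for t
    unfolding F4_def 3 by algebra
  show ?thesis unfolding 4 by algebra
qed

text \<open>
  The left-hand side is a dual functional applied to the fifth power of a function whose value at an
  average of points is the average of the values \<open>q r\<close>. The factor \<open>k\<^sup>5\<close> cancels the denominator of the
  average.
\<close>

lemma quintic_polarization_sum:
  fixes q :: "nat \<Rightarrow> real"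
  shows "(\<Sum>k = 1..5. 1 / fact 5 * real k ^ 5 * (-1) ^ (k - 1) *
      (\<Sum>R\<in>{R. R \<subseteq> {1..5} \<and> card R = k}. ((1 / real k) * (\<Sum>r\<in>R. q r)) ^ 5)) = (\<Prod>r = 1..5. q r)"
proof -
  let ?A = "{1..5::nat}"
  let ?h = "\<lambda>R. (- 1) ^ card R * sum q R ^ 5"
  have "(\<Sum>k = 1..5. 1 / fact 5 * real k ^ 5 * (-1) ^ (k - 1) *
      (\<Sum>R\<in>{R. R \<subseteq> ?A \<and> card R = k}. ((1 / real k) * (\<Sum>r\<in>R. q r)) ^ 5)) =
    (\<Sum>k = 1..5. \<Sum>R\<in>{R \<in> Pow ?A - {{}}. card R = k}. - (1 / 120) * ?h R)"
  proof (rule sum.cong)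
    fix k :: nat assume k: "k \<in> {1..5}"
    then have set: "{R. R \<subseteq> ?A \<and> card R = k} = {R \<in> Pow ?A - {{}}. card R = k}" by auto
    have "(- 1 :: real) ^ k = - ((- 1) ^ (k - 1))" using k by (cases k) auto
    then show "1 / fact 5 * real k ^ 5 * (-1) ^ (k - 1) *
      (\<Sum>R\<in>{R. R \<subseteq> ?A \<and> card R = k}. ((1 / real k) * (\<Sum>r\<in>R. q r)) ^ 5) =
      (\<Sum>R\<in>{R \<in> Pow ?A - {{}}. card R = k}. - (1 / 120) * ?h R)"
      unfolding set using k
      by (subst sum_distrib_left, intro sum.cong refl) (auto simp: power_divide power_mult_distrib fact_numeral)
  qed simp
  also have "\<dots> = (\<Sum>R\<in>Pow ?A - {{}}. - (1 / 120) * ?h R)"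
  proof (rule sum.group)
    show "card ` (Pow ?A - {{}}) \<subseteq> {1..5}"
    proof (rule image_subsetI)
      fix R assume "R \<in> Pow ?A - {{}}"
      then have R: "R \<subseteq> ?A" "R \<noteq> {}" by auto
      then have "finite R" using finite_subset by blast
      with R have "card R > 0" "card R \<le> card ?A" using card_mono[of ?A R] by (auto simp: card_gt_0_iff)
      then show "card R \<in> {1..5}" by simp
    qed
  qed auto
  also have "\<dots> = (\<Sum>R\<in>Pow ?A. - (1 / 120) * ?h R)"
    by (rule sum.mono_neutral_left) auto
  also have "\<dots> = - (1 / 120) * (\<Sum>R\<in>Pow ?A. ?h R)" by (simp only: sum_distrib_left)
  also have "(\<Sum>R\<in>Pow ?A. ?h R) = - 120 * (q 1 * q 2 * q 3 * q 4 * q 5)"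
  proof -
    have A: "?A = {1, 2, 3, 4, 5}" by auto
    define F1 where "F1 = (\<lambda>t. t ^ 5 - (q 1 + t) ^ 5)"
    define F2 where "F2 = (\<lambda>t. F1 t - F1 (q 2 + t))"
    define F3 where "F3 = (\<lambda>t. F2 t - F2 (q 3 + t))"
    define F4 where "F4 = (\<lambda>t. F3 t - F3 (q 4 + t))"
    have "(\<Sum>R\<in>Pow {1, 2, 3, 4, 5}. ?h R) = (\<Sum>R\<in>Pow {2, 3, 4, 5}. (- 1) ^ card R * F1 (sum q R))"
      unfolding F1_def by (rule alternating_sum_Pow_insert) auto
    also have "\<dots> = (\<Sum>R\<in>Pow {3, 4, 5}. (- 1) ^ card R * F2 (sum q R))"
      unfolding F2_def by (rule alternating_sum_Pow_insert) auto
    also have "\<dots> = (\<Sum>R\<in>Pow {4, 5}. (- 1) ^ card R * F3 (sum q R))"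
      unfolding F3_def by (rule alternating_sum_Pow_insert) auto
    also have "\<dots> = (\<Sum>R\<in>Pow {5}. (- 1) ^ card R * F4 (sum q R))"
      unfolding F4_def by (rule alternating_sum_Pow_insert) auto
    also have "\<dots> = F4 0 - F4 (q 5 + 0)"
      by (subst alternating_sum_Pow_insert[where F = F4]) auto
    also have "\<dots> = - 120 * (q 1 * q 2 * q 3 * q 4 * q 5)"
      unfolding F4_def F3_def F2_def F1_def by (rule polarization_quintic)
    finally show ?thesis unfolding A .
  qed
  also have "- (1 / 120) * (- 120 * (q 1 * q 2 * q 3 * q 4 * q 5)) = (\<Prod>r = 1..5. q r)"
    by (simp add: numeral_eq_Suc prod.atLeast_Suc_atMost mult_ac)
  finally show ?thesis .
qed

section \<open>The identity of rational functions behind the reproduction of quintics\<close>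

text \<open>
  The values \<open>l\<^sub>1, \<dots>, l\<^sub>6\<close> of an affine function at the corners and the edge midpoints, together with
  their reciprocals. The predicate is invariant under the induced permutations of the indices, which is how the
  following five identities yield all others.
\<close>

definition split_reciprocals ::
    "real \<Rightarrow> real \<Rightarrow> real \<Rightarrow> real \<Rightarrow> real \<Rightarrow> real \<Rightarrow>
     real \<Rightarrow> real \<Rightarrow> real \<Rightarrow> real \<Rightarrow> real \<Rightarrow> real \<Rightarrow> bool" where
  "split_reciprocals l1 l2 l3 l4 l5 l6 a1 a2 a3 a4 a5 a6 \<longleftrightarrow>
    l1 > 0 \<and> l2 > 0 \<and> l3 > 0 \<and>
    l4 = (l1 + l2) / 2 \<and> l5 = (l2 + l3) / 2 \<and> l6 = (l1 + l3) / 2 \<and>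
    a1 = 1 / l1 \<and> a2 = 1 / l2 \<and> a3 = 1 / l3 \<and> a4 = 1 / l4 \<and> a5 = 1 / l5 \<and> a6 = 1 / l6"

text \<open>
  The name lists the exponents of the monomial in the values of \<open>q\<close> at the corners. The left-hand side
  sums over the splines whose dual points contribute to this monomial; an integer factor in front is
  the coefficient of the monomial in the product over the dual points, cleared of denominators. After multiplication by a common denominator \<open>D\<close>, the identity is
  one between polynomials in \<open>l\<^sub>1\<close>, \<open>l\<^sub>4\<close> and \<open>l\<^sub>6\<close>; eliminating the other values in favour of these
  keeps the coefficients integral.
\<close>

lemma marsden_coefficient_500:
  fixes l1 l2 l3 l4 l5 l6 a1 a2 a3 a4 a5 a6 :: real
  assumes "split_reciprocals l1 l2 l3 l4 l5 l6 a1 a2 a3 a4 a5 a6"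
  shows "(1 / 4 * (a1 ^ 6 * a4 * a6)) +
   (1 / 8 * (a1 ^ 5 * a4 ^ 2 * a6)) +
   (1 / 8 * (a1 ^ 4 * a2 * a4 ^ 2 * a6)) +
   (1 / 8 * (a1 ^ 5 * a4 * a6 ^ 2)) +
   (1 / 8 * (a1 ^ 4 * a3 * a4 * a6 ^ 2)) +
   (1 / 4 * (a1 ^ 4 * a2 * a3 * a4 * a6)) = (a1 ^ 6 * a2 * a3)"
    (is "?lhs = ?rhs")
proof -
  from assms have l: "l1 \<noteq> 0" "l2 = 2 * l4 - l1" "l3 = 2 * l6 - l1" "l5 = l4 + l6 - l1"
    and nz: "l2 \<noteq> 0" "l3 \<noteq> 0" "l4 \<noteq> 0" "l5 \<noteq> 0" "l6 \<noteq> 0"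
    and a: "a1 = 1 / l1" "a2 = 1 / l2" "a3 = 1 / l3" "a4 = 1 / l4" "a5 = 1 / l5" "a6 = 1 / l6"
    by (auto simp: split_reciprocals_def)
  define D where "D = 8 * l1 ^ 6 * l2 * l3 * l4 ^ 2 * l6 ^ 2"
  have "?lhs = (2 * l2 * l3 * l4 * l6) / D + (l1 * l2 * l3 * l6) / D + (l1 ^ 2 * l3 * l6) / D + (l1 * l2 * l3 * l4) / D + (l1 ^ 2 * l2 * l4) / D + (2 * l1 ^ 2 * l4 * l6) / D"
    by (intro arg_cong2[where f = "(+)"];
        simp add: a D_def l(1) nz field_simps power_numeral_reduce)
  moreover have "?rhs = (8 * l4 ^ 2 * l6 ^ 2) / D"
    by (simp add: a D_def l(1) nz field_simps power_numeral_reduce)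
  moreover have "2 * l2 * l3 * l4 * l6 + l1 * l2 * l3 * l6 + l1 ^ 2 * l3 * l6 + l1 * l2 * l3 * l4 + l1 ^ 2 * l2 * l4 + 2 * l1 ^ 2 * l4 * l6 = 8 * l4 ^ 2 * l6 ^ 2"
    unfolding l(2-4) by algebra
  ultimately show ?thesis by (simp only: add_divide_distrib[symmetric])
qed

lemma marsden_coefficient_410:
  fixes l1 l2 l3 l4 l5 l6 a1 a2 a3 a4 a5 a6 :: real
  assumes "split_reciprocals l1 l2 l3 l4 l5 l6 a1 a2 a3 a4 a5 a6"
  shows "(1 / 8 * (a1 ^ 5 * a4 ^ 2 * a6)) +
   2 * (1 / 8 * (a1 ^ 4 * a2 * a4 ^ 2 * a6)) +
   (1 / 8 * (a1 ^ 3 * a2 ^ 2 * a4 ^ 2 * a6)) +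
   (1 / 16 * (a1 ^ 2 * a2 ^ 2 * a4 ^ 2 * a5 * a6)) +
   (1 / 4 * (a1 ^ 4 * a2 * a3 * a4 * a6)) +
   (1 / 8 * (a1 ^ 3 * a2 * a3 * a4 ^ 2 * a6)) +
   (1 / 16 * (a1 ^ 2 * a2 * a3 * a4 ^ 2 * a5 * a6)) = (a1 ^ 5 * a2 ^ 2 * a3)"
    (is "?lhs = ?rhs")
proof -
  from assms have l: "l1 \<noteq> 0" "l2 = 2 * l4 - l1" "l3 = 2 * l6 - l1" "l5 = l4 + l6 - l1"
    and nz: "l2 \<noteq> 0" "l3 \<noteq> 0" "l4 \<noteq> 0" "l5 \<noteq> 0" "l6 \<noteq> 0"
    and a: "a1 = 1 / l1" "a2 = 1 / l2" "a3 = 1 / l3" "a4 = 1 / l4" "a5 = 1 / l5" "a6 = 1 / l6"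
    by (auto simp: split_reciprocals_def)
  define D where "D = 16 * l1 ^ 5 * l2 ^ 2 * l3 * l4 ^ 2 * l5 * l6"
  have "?lhs = (2 * l2 ^ 2 * l3 * l5) / D + (4 * l1 * l2 * l3 * l5) / D + (2 * l1 ^ 2 * l3 * l5) / D + (l1 ^ 3 * l3) / D + (4 * l1 * l2 * l4 * l5) / D + (2 * l1 ^ 2 * l2 * l5) / D + (l1 ^ 3 * l2) / D"
    by (intro arg_cong2[where f = "(+)"];
        simp add: a D_def l(1) nz field_simps power_numeral_reduce)
  moreover have "?rhs = (16 * l4 ^ 2 * l5 * l6) / D"
    by (simp add: a D_def l(1) nz field_simps power_numeral_reduce)
  moreover have "2 * l2 ^ 2 * l3 * l5 + 4 * l1 * l2 * l3 * l5 + 2 * l1 ^ 2 * l3 * l5 + l1 ^ 3 * l3 + 4 * l1 * l2 * l4 * l5 + 2 * l1 ^ 2 * l2 * l5 + l1 ^ 3 * l2 = 16 * l4 ^ 2 * l5 * l6"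
    unfolding l(2-4) by algebra
  ultimately show ?thesis by (simp only: add_divide_distrib[symmetric])
qed

lemma marsden_coefficient_320:
  fixes l1 l2 l3 l4 l5 l6 a1 a2 a3 a4 a5 a6 :: real
  assumes "split_reciprocals l1 l2 l3 l4 l5 l6 a1 a2 a3 a4 a5 a6"
  shows "(1 / 8 * (a1 ^ 4 * a2 * a4 ^ 2 * a6)) +
   2 * (1 / 8 * (a1 ^ 3 * a2 ^ 2 * a4 ^ 2 * a6)) +
   3 * (1 / 16 * (a1 ^ 2 * a2 ^ 2 * a4 ^ 2 * a5 * a6)) +
   (1 / 16 * (a1 * a2 ^ 2 * a3 * a4 ^ 2 * a5 * a6)) +
   (1 / 8 * (a1 ^ 2 * a2 ^ 3 * a4 ^ 2 * a5)) +
   (1 / 8 * (a1 ^ 3 * a2 * a3 * a4 ^ 2 * a6)) +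
   2 * (1 / 16 * (a1 ^ 2 * a2 * a3 * a4 ^ 2 * a5 * a6)) = (a1 ^ 4 * a2 ^ 3 * a3)"
    (is "?lhs = ?rhs")
proof -
  from assms have l: "l1 \<noteq> 0" "l2 = 2 * l4 - l1" "l3 = 2 * l6 - l1" "l5 = l4 + l6 - l1"
    and nz: "l2 \<noteq> 0" "l3 \<noteq> 0" "l4 \<noteq> 0" "l5 \<noteq> 0" "l6 \<noteq> 0"
    and a: "a1 = 1 / l1" "a2 = 1 / l2" "a3 = 1 / l3" "a4 = 1 / l4" "a5 = 1 / l5" "a6 = 1 / l6"
    by (auto simp: split_reciprocals_def)
  define D where "D = 16 * l1 ^ 4 * l2 ^ 3 * l3 * l4 ^ 2 * l5 * l6"
  have "?lhs = (2 * l2 ^ 2 * l3 * l5) / D + (4 * l1 * l2 * l3 * l5) / D + (3 * l1 ^ 2 * l2 * l3) / D + (l1 ^ 3 * l2) / D + (2 * l1 ^ 2 * l3 * l6) / D + (2 * l1 * l2 ^ 2 * l5) / D + (2 * l1 ^ 2 * l2 ^ 2) / D"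
    by (intro arg_cong2[where f = "(+)"];
        simp add: a D_def l(1) nz field_simps power_numeral_reduce)
  moreover have "?rhs = (16 * l4 ^ 2 * l5 * l6) / D"
    by (simp add: a D_def l(1) nz field_simps power_numeral_reduce)
  moreover have "2 * l2 ^ 2 * l3 * l5 + 4 * l1 * l2 * l3 * l5 + 3 * l1 ^ 2 * l2 * l3 + l1 ^ 3 * l2 + 2 * l1 ^ 2 * l3 * l6 + 2 * l1 * l2 ^ 2 * l5 + 2 * l1 ^ 2 * l2 ^ 2 = 16 * l4 ^ 2 * l5 * l6"
    unfolding l(2-4) by algebra
  ultimately show ?thesis by (simp only: add_divide_distrib[symmetric])
qed

lemma marsden_coefficient_311:
  fixes l1 l2 l3 l4 l5 l6 a1 a2 a3 a4 a5 a6 :: real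
  assumes "split_reciprocals l1 l2 l3 l4 l5 l6 a1 a2 a3 a4 a5 a6"
  shows "(1 / 16 * (a1 ^ 2 * a2 ^ 2 * a4 ^ 2 * a5 * a6)) +
   (1 / 16 * (a1 * a2 ^ 2 * a3 * a4 ^ 2 * a5 * a6)) +
   (1 / 16 * (a1 ^ 2 * a3 ^ 2 * a4 * a5 * a6 ^ 2)) +
   (1 / 16 * (a1 * a2 * a3 ^ 2 * a4 * a5 * a6 ^ 2)) +
   (1 / 4 * (a1 ^ 4 * a2 * a3 * a4 * a6)) +
   (1 / 8 * (a1 ^ 3 * a2 * a3 * a4 ^ 2 * a6)) +
   2 * (1 / 16 * (a1 ^ 2 * a2 * a3 * a4 ^ 2 * a5 * a6)) +
   (1 / 8 * (a1 ^ 3 * a2 * a3 * a4 * a6 ^ 2)) +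
   2 * (1 / 16 * (a1 ^ 2 * a2 * a3 * a4 * a5 * a6 ^ 2)) = (a1 ^ 4 * a2 ^ 2 * a3 ^ 2)"
    (is "?lhs = ?rhs")
proof -
  from assms have l: "l1 \<noteq> 0" "l2 = 2 * l4 - l1" "l3 = 2 * l6 - l1" "l5 = l4 + l6 - l1"
    and nz: "l2 \<noteq> 0" "l3 \<noteq> 0" "l4 \<noteq> 0" "l5 \<noteq> 0" "l6 \<noteq> 0"
    and a: "a1 = 1 / l1" "a2 = 1 / l2" "a3 = 1 / l3" "a4 = 1 / l4" "a5 = 1 / l5" "a6 = 1 / l6"
    by (auto simp: split_reciprocals_def)
  define D where "D = 16 * l1 ^ 4 * l2 ^ 2 * l3 ^ 2 * l4 ^ 2 * l5 * l6 ^ 2"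
  have "?lhs = (l1 ^ 2 * l3 ^ 2 * l6) / D + (l1 ^ 3 * l3 * l6) / D + (l1 ^ 2 * l2 ^ 2 * l4) / D + (l1 ^ 3 * l2 * l4) / D + (4 * l2 * l3 * l4 * l5 * l6) / D + (2 * l1 * l2 * l3 * l5 * l6) / D + (2 * l1 ^ 2 * l2 * l3 * l6) / D + (2 * l1 * l2 * l3 * l4 * l5) / D + (2 * l1 ^ 2 * l2 * l3 * l4) / D"
    by (intro arg_cong2[where f = "(+)"];
        simp add: a D_def l(1) nz field_simps power_numeral_reduce)
  moreover have "?rhs = (16 * l4 ^ 2 * l5 * l6 ^ 2) / D"
    by (simp add: a D_def l(1) nz field_simps power_numeral_reduce)
  moreover have "l1 ^ 2 * l3 ^ 2 * l6 + l1 ^ 3 * l3 * l6 + l1 ^ 2 * l2 ^ 2 * l4 + l1 ^ 3 * l2 * l4 + 4 * l2 * l3 * l4 * l5 * l6 + 2 * l1 * l2 * l3 * l5 * l6 + 2 * l1 ^ 2 * l2 * l3 * l6 + 2 * l1 * l2 * l3 * l4 * l5 + 2 * l1 ^ 2 * l2 * l3 * l4 = 16 * l4 ^ 2 * l5 * l6 ^ 2"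
    unfolding l(2-4) by algebra
  ultimately show ?thesis by (simp only: add_divide_distrib[symmetric])
qed

lemma marsden_coefficient_221:
  fixes l1 l2 l3 l4 l5 l6 a1 a2 a3 a4 a5 a6 :: real
  assumes "split_reciprocals l1 l2 l3 l4 l5 l6 a1 a2 a3 a4 a5 a6"
  shows "2 * (1 / 16 * (a1 ^ 2 * a2 ^ 2 * a4 ^ 2 * a5 * a6)) +
   (1 / 8 * (a1 * a2 ^ 3 * a3 * a4 ^ 2 * a5)) +
   3 * (1 / 16 * (a1 * a2 ^ 2 * a3 * a4 ^ 2 * a5 * a6)) +
   (1 / 16 * (a1 * a2 * a3 ^ 2 * a4 * a5 * a6 ^ 2)) +
   (1 / 8 * (a1 ^ 3 * a2 * a3 * a4 ^ 2 * a6)) +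
   3 * (1 / 16 * (a1 ^ 2 * a2 * a3 * a4 ^ 2 * a5 * a6)) +
   (1 / 16 * (a1 * a2 * a3 ^ 2 * a4 * a5 ^ 2 * a6)) +
   (1 / 16 * (a1 ^ 2 * a2 * a3 * a4 * a5 * a6 ^ 2)) +
   (1 / 16 * (a1 * a2 ^ 2 * a3 * a4 * a5 ^ 2 * a6)) = (a1 ^ 3 * a2 ^ 3 * a3 ^ 2)"
    (is "?lhs = ?rhs")
proof -
  from assms have l: "l1 \<noteq> 0" "l2 = 2 * l4 - l1" "l3 = 2 * l6 - l1" "l5 = l4 + l6 - l1"
    and nz: "l2 \<noteq> 0" "l3 \<noteq> 0" "l4 \<noteq> 0" "l5 \<noteq> 0" "l6 \<noteq> 0"
    and a: "a1 = 1 / l1" "a2 = 1 / l2" "a3 = 1 / l3" "a4 = 1 / l4" "a5 = 1 / l5" "a6 = 1 / l6"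
    by (auto simp: split_reciprocals_def)
  define D where "D = 16 * l1 ^ 3 * l2 ^ 3 * l3 ^ 2 * l4 ^ 2 * l5 ^ 2 * l6 ^ 2"
  have "?lhs = (2 * l1 * l2 * l3 ^ 2 * l5 * l6) / D + (2 * l1 ^ 2 * l3 * l5 * l6 ^ 2) / D + (3 * l1 ^ 2 * l2 * l3 * l5 * l6) / D + (l1 ^ 2 * l2 ^ 2 * l4 * l5) / D + (2 * l2 ^ 2 * l3 * l5 ^ 2 * l6) / D + (3 * l1 * l2 ^ 2 * l3 * l5 * l6) / D + (l1 ^ 2 * l2 ^ 2 * l4 * l6) / D + (l1 * l2 ^ 2 * l3 * l4 * l5) / D + (l1 ^ 2 * l2 * l3 * l4 * l6) / D"
    by (intro arg_cong2[where f = "(+)"];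
        simp add: a D_def l(1) nz field_simps power_numeral_reduce)
  moreover have "?rhs = (16 * l4 ^ 2 * l5 ^ 2 * l6 ^ 2) / D"
    by (simp add: a D_def l(1) nz field_simps power_numeral_reduce)
  moreover have "2 * l1 * l2 * l3 ^ 2 * l5 * l6 + 2 * l1 ^ 2 * l3 * l5 * l6 ^ 2 + 3 * l1 ^ 2 * l2 * l3 * l5 * l6 + l1 ^ 2 * l2 ^ 2 * l4 * l5 + 2 * l2 ^ 2 * l3 * l5 ^ 2 * l6 + 3 * l1 * l2 ^ 2 * l3 * l5 * l6 + l1 ^ 2 * l2 ^ 2 * l4 * l6 + l1 * l2 ^ 2 * l3 * l4 * l5 + l1 ^ 2 * l2 * l3 * l4 * l6 = 16 * l4 ^ 2 * l5 ^ 2 * l6 ^ 2"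
    unfolding l(2-4) by algebra
  ultimately show ?thesis by (simp only: add_divide_distrib[symmetric])
qed

text \<open>
  With \<open>a\<close> the reciprocals of an affine function at the indexed points, this is, up to a factor common to all
  labels, what a basis function times its dual functional contributes to the integral against \<open>l\<^sup>-\<^sup>8\<close>.
\<close>

definition label_weight :: "(nat \<Rightarrow> real) \<Rightarrow> (nat \<Rightarrow> real) \<Rightarrow> label \<Rightarrow> real" where
  "label_weight a q = (\<lambda>(c, m, d). c * (\<Prod>i\<in>#m. a i) * (\<Prod>i\<in>#d. q i))"

lemma label_weight_act:
  "label_weight a q (act p j) = label_weight (a \<circ> induced_perm p) (q \<circ> induced_perm p) j"
  by (cases j) (simp add: label_weight_def act_def image_mset.compositionality comp_def)

abbreviation (input) "gen1 \<equiv> (1/4, knots [6, 0, 0, 1, 0, 1], {#1, 1, 1, 1, 1#}) :: label"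
abbreviation (input) "gen2 \<equiv> (1/4, knots [5, 0, 0, 2, 0, 1], {#1, 1, 1, 1, 4#}) :: label"
abbreviation (input) "gen3 \<equiv> (1/2, knots [4, 1, 0, 2, 0, 1], {#1, 1, 1, 4, 4#}) :: label"
abbreviation (input) "gen4 \<equiv> (1/2, knots [3, 2, 0, 2, 0, 1], {#1, 1, 2, 4, 4#}) :: label"
abbreviation (input) "gen5 \<equiv> (3/4, knots [2, 2, 0, 2, 1, 1], {#1, 2, 4, 4, 10#}) :: label"
abbreviation (input) "gen6 \<equiv> (1, knots [1, 4, 1, 1, 1, 0], {#2, 2, 2, 4, 5#}) :: label"
abbreviation (input) "gen7 \<equiv> (1/2, knots [1, 3, 1, 2, 1, 0], {#1, 2, 2, 4, 5#}) :: label"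
abbreviation (input) "gen8 \<equiv> (3/4, knots [1, 2, 1, 2, 1, 1], {#1, 2, 4, 5, 10#}) :: label"

abbreviation (input) "t12 \<equiv> Transposition.transpose 1 (2::nat)"
abbreviation (input) "t13 \<equiv> Transposition.transpose 1 (3::nat)"
abbreviation (input) "t23 \<equiv> Transposition.transpose 2 (3::nat)"

lemmas induced_perm_simps =
  induced_perm_def edge_midpoint_def Transposition.transpose_def doubleton_eq_iff

text \<open>
  Three generators are fixed by a transposition, so their orbits have three elements and not six.
\<close>

lemma act_stabilised:
  shows "act t23 gen1 = act id gen1"
    and "act (t12 \<circ> t23) gen1 = act t12 gen1"
    and "act (t13 \<circ> t23) gen1 = act t13 gen1"
    and "act t12 gen5 = act id gen5"
    and "act (t12 \<circ> t23) gen5 = act t13 gen5"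
    and "act (t13 \<circ> t23) gen5 = act t23 gen5"
    and "act t13 gen6 = act id gen6"
    and "act (t12 \<circ> t23) gen6 = act t23 gen6"
    and "act (t13 \<circ> t23) gen6 = act t12 gen6"
  by (simp_all add: act_def knots_6 induced_perm_simps add_ac)

text \<open>
  The list has 39 entries, one for each coset of the stabilizers. It exhausts the basis labels, and there are
  39 of these, so no entry is repeated.
\<close>

lemma sum_basis_labels:
  fixes W :: "label \<Rightarrow> real"
  shows "(\<Sum>j\<in>basis_labels. W j) =
    (\<Sum>j\<leftarrow>[act id gen1, act t12 gen1, act t13 gen1, act id gen2,
      act t12 gen2, act t13 gen2, act t23 gen2, act (t12 \<circ> t23) gen2,
      act (t13 \<circ> t23) gen2, act id gen3, act t12 gen3, act t13 gen3,
      act t23 gen3, act (t12 \<circ> t23) gen3, act (t13 \<circ> t23) gen3, act id gen4,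
      act t12 gen4, act t13 gen4, act t23 gen4, act (t12 \<circ> t23) gen4,
      act (t13 \<circ> t23) gen4, act id gen5, act t13 gen5, act t23 gen5,
      act id gen6, act t12 gen6, act t23 gen6, act id gen7,
      act t12 gen7, act t13 gen7, act t23 gen7, act (t12 \<circ> t23) gen7,
      act (t13 \<circ> t23) gen7, act id gen8, act t12 gen8, act t13 gen8,
      act t23 gen8, act (t12 \<circ> t23) gen8, act (t13 \<circ> t23) gen8]. W j)" (is "_ = sum_list (map W ?xs)")
proof -
  have set: "basis_labels = set ?xs"
  proof (rule equalityI)
    show "set ?xs \<subseteq> basis_labels"
      unfolding basis_labels_def permutes_123 generators_def
      by (simp only: list.set image_insert image_empty Union_insert Union_empty) blast
    show "basis_labels \<subseteq> set ?xs"
      unfolding basis_labels_def permutes_123 generators_def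
      by (simp only: list.set image_insert image_empty Union_insert Union_empty Un_subset_iff
        insert_subset empty_subsetI act_stabilised insert_iff simp_thms)
  qed
  have "distinct ?xs"
    using card_basis_labels unfolding set by (intro card_distinct) simp
  then show ?thesis unfolding set by (rule sum_list_distinct_conv_sum_set[symmetric])
qed

lemma label_weight_generators:
  assumes q: "q 4 = (q 1 + q 2) / 2" "q 5 = (q 2 + q 3) / 2" "q 10 = (q 1 + q 2 + q 3) / 3"
  shows "label_weight a q gen1 = 1 / 4 * (a 1 ^ 6 * a 4 * a 6) * (q 1 ^ 5)"
    and "label_weight a q gen2 = 1 / 8 * (a 1 ^ 5 * a 4 ^ 2 * a 6) * (q 1 ^ 4 * (q 1 + q 2))"
    and "label_weight a q gen3 = 1 / 8 * (a 1 ^ 4 * a 2 * a 4 ^ 2 * a 6) * (q 1 ^ 3 * (q 1 + q 2) ^ 2)"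
    and "label_weight a q gen4 = 1 / 8 * (a 1 ^ 3 * a 2 ^ 2 * a 4 ^ 2 * a 6) * (q 1 ^ 2 * q 2 * (q 1 + q 2) ^ 2)"
    and "label_weight a q gen5 = 1 / 16 * (a 1 ^ 2 * a 2 ^ 2 * a 4 ^ 2 * a 5 * a 6) * (q 1 * q 2 * (q 1 + q 2) ^ 2 * (q 1 + q 2 + q 3))"
    and "label_weight a q gen6 = 1 / 4 * (a 1 * a 2 ^ 4 * a 3 * a 4 * a 5) * (q 2 ^ 3 * (q 1 + q 2) * (q 2 + q 3))"
    and "label_weight a q gen7 = 1 / 8 * (a 1 * a 2 ^ 3 * a 3 * a 4 ^ 2 * a 5) * (q 1 * q 2 ^ 2 * (q 1 + q 2) * (q 2 + q 3))"
    and "label_weight a q gen8 = 1 / 16 * (a 1 * a 2 ^ 2 * a 3 * a 4 ^ 2 * a 5 * a 6) * (q 1 * q 2 * (q 1 + q 2) * (q 2 + q 3) * (q 1 + q 2 + q 3))"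
proof -
  show "label_weight a q gen1 = 1 / 4 * (a 1 ^ 6 * a 4 * a 6) * (q 1 ^ 5)"
    by (simp add: label_weight_def knots_6 q power_numeral_reduce mult_ac)
  show "label_weight a q gen2 = 1 / 8 * (a 1 ^ 5 * a 4 ^ 2 * a 6) * (q 1 ^ 4 * (q 1 + q 2))"
    by (simp add: label_weight_def knots_6 q power_numeral_reduce mult_ac)
  show "label_weight a q gen3 = 1 / 8 * (a 1 ^ 4 * a 2 * a 4 ^ 2 * a 6) * (q 1 ^ 3 * (q 1 + q 2) ^ 2)"
    by (simp add: label_weight_def knots_6 q power_numeral_reduce mult_ac)
  show "label_weight a q gen4 = 1 / 8 * (a 1 ^ 3 * a 2 ^ 2 * a 4 ^ 2 * a 6) * (q 1 ^ 2 * q 2 * (q 1 + q 2) ^ 2)"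
    by (simp add: label_weight_def knots_6 q power_numeral_reduce mult_ac)
  show "label_weight a q gen5 = 1 / 16 * (a 1 ^ 2 * a 2 ^ 2 * a 4 ^ 2 * a 5 * a 6) * (q 1 * q 2 * (q 1 + q 2) ^ 2 * (q 1 + q 2 + q 3))"
    by (simp add: label_weight_def knots_6 q power_numeral_reduce mult_ac)
  show "label_weight a q gen6 = 1 / 4 * (a 1 * a 2 ^ 4 * a 3 * a 4 * a 5) * (q 2 ^ 3 * (q 1 + q 2) * (q 2 + q 3))"
    by (simp add: label_weight_def knots_6 q power_numeral_reduce mult_ac)
  show "label_weight a q gen7 = 1 / 8 * (a 1 * a 2 ^ 3 * a 3 * a 4 ^ 2 * a 5) * (q 1 * q 2 ^ 2 * (q 1 + q 2) * (q 2 + q 3))"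
    by (simp add: label_weight_def knots_6 q power_numeral_reduce mult_ac)
  show "label_weight a q gen8 = 1 / 16 * (a 1 * a 2 ^ 2 * a 3 * a 4 ^ 2 * a 5 * a 6) * (q 1 * q 2 * (q 1 + q 2) * (q 2 + q 3) * (q 1 + q 2 + q 3))"
    by (simp add: label_weight_def knots_6 q power_numeral_reduce mult_ac)
qed

text \<open>
  The products of \<open>q\<close> over the dual points, without denominators, for the generators other than the first.
\<close>

lemma dual_product_expansions:
  fixes x y z :: real
  shows "x ^ 4 * (x + y) = x ^ 5 + (x ^ 4 * y)"
    and "x ^ 3 * (x + y) ^ 2 = x ^ 5 + 2 * (x ^ 4 * y) + (x ^ 3 * y ^ 2)"
    and "x ^ 2 * y * (x + y) ^ 2 = (x ^ 4 * y) + 2 * (x ^ 3 * y ^ 2) + (x ^ 2 * y ^ 3)"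
    and "x * y * (x + y) ^ 2 * (x + y + z) = (x ^ 4 * y) + 3 * (x ^ 3 * y ^ 2) + (x ^ 3 * y * z) + 3 * (x ^ 2 * y ^ 3) + 2 * (x ^ 2 * y ^ 2 * z) + (x * y ^ 4) + (x * y ^ 3 * z)"
    and "y ^ 3 * (x + y) * (y + z) = (x * y ^ 4) + (x * y ^ 3 * z) + y ^ 5 + (y ^ 4 * z)"
    and "x * y ^ 2 * (x + y) * (y + z) = (x ^ 2 * y ^ 3) + (x ^ 2 * y ^ 2 * z) + (x * y ^ 4) + (x * y ^ 3 * z)"
    and "x * y * (x + y) * (y + z) * (x + y + z) = (x ^ 3 * y ^ 2) + (x ^ 3 * y * z) + 2 * (x ^ 2 * y ^ 3) + 3 * (x ^ 2 * y ^ 2 * z) + (x ^ 2 * y * z ^ 2) + (x * y ^ 4) + 2 * (x * y ^ 3 * z) + (x * y ^ 2 * z ^ 2)"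
proof -
  show "x ^ 4 * (x + y) = x ^ 5 + (x ^ 4 * y)" by algebra
  show "x ^ 3 * (x + y) ^ 2 = x ^ 5 + 2 * (x ^ 4 * y) + (x ^ 3 * y ^ 2)" by algebra
  show "x ^ 2 * y * (x + y) ^ 2 = (x ^ 4 * y) + 2 * (x ^ 3 * y ^ 2) + (x ^ 2 * y ^ 3)" by algebra
  show "x * y * (x + y) ^ 2 * (x + y + z) = (x ^ 4 * y) + 3 * (x ^ 3 * y ^ 2) + (x ^ 3 * y * z) + 3 * (x ^ 2 * y ^ 3) + 2 * (x ^ 2 * y ^ 2 * z) + (x * y ^ 4) + (x * y ^ 3 * z)" by algebra
  show "y ^ 3 * (x + y) * (y + z) = (x * y ^ 4) + (x * y ^ 3 * z) + y ^ 5 + (y ^ 4 * z)" by algebra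
  show "x * y ^ 2 * (x + y) * (y + z) = (x ^ 2 * y ^ 3) + (x ^ 2 * y ^ 2 * z) + (x * y ^ 4) + (x * y ^ 3 * z)" by algebra
  show "x * y * (x + y) * (y + z) * (x + y + z) = (x ^ 3 * y ^ 2) + (x ^ 3 * y * z) + 2 * (x ^ 2 * y ^ 3) + 3 * (x ^ 2 * y ^ 2 * z) + (x ^ 2 * y * z ^ 2) + (x * y ^ 4) + 2 * (x * y ^ 3 * z) + (x * y ^ 2 * z ^ 2)" by algebra
qed

text \<open>
  The weights \<open>u1\<close> to \<open>u39\<close> are those of the list in \<open>sum_basis_labels\<close>. Keeping them as
  unknowns separates the expansion in \<open>q\<close> from the rational functions of \<open>l\<close>.
\<close>

lemma collect_monomials:
  fixes x y z :: real
  shows "sum_list [u1 * x ^ 5,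
   u2 * y ^ 5,
   u3 * z ^ 5,
   u4 * (x ^ 4 * (x + y)),
   u5 * (y ^ 4 * (y + x)),
   u6 * (z ^ 4 * (z + y)),
   u7 * (x ^ 4 * (x + z)),
   u8 * (y ^ 4 * (y + z)),
   u9 * (z ^ 4 * (z + x)),
   u10 * (x ^ 3 * (x + y) ^ 2),
   u11 * (y ^ 3 * (y + x) ^ 2),
   u12 * (z ^ 3 * (z + y) ^ 2),
   u13 * (x ^ 3 * (x + z) ^ 2),
   u14 * (y ^ 3 * (y + z) ^ 2),
   u15 * (z ^ 3 * (z + x) ^ 2),
   u16 * (x ^ 2 * y * (x + y) ^ 2),
   u17 * (y ^ 2 * x * (y + x) ^ 2),
   u18 * (z ^ 2 * y * (z + y) ^ 2),
   u19 * (x ^ 2 * z * (x + z) ^ 2),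
   u20 * (y ^ 2 * z * (y + z) ^ 2),
   u21 * (z ^ 2 * x * (z + x) ^ 2),
   u22 * (x * y * (x + y) ^ 2 * (x + y + z)),
   u23 * (z * y * (z + y) ^ 2 * (z + y + x)),
   u24 * (x * z * (x + z) ^ 2 * (x + z + y)),
   u25 * (y ^ 3 * (x + y) * (y + z)),
   u26 * (x ^ 3 * (y + x) * (x + z)),
   u27 * (z ^ 3 * (x + z) * (z + y)),
   u28 * (x * y ^ 2 * (x + y) * (y + z)),
   u29 * (y * x ^ 2 * (y + x) * (x + z)),
   u30 * (z * y ^ 2 * (z + y) * (y + x)),
   u31 * (x * z ^ 2 * (x + z) * (z + y)),
   u32 * (y * z ^ 2 * (y + z) * (z + x)),
   u33 * (z * x ^ 2 * (z + x) * (x + y)),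
   u34 * (x * y * (x + y) * (y + z) * (x + y + z)),
   u35 * (y * x * (y + x) * (x + z) * (y + x + z)),
   u36 * (z * y * (z + y) * (y + x) * (z + y + x)),
   u37 * (x * z * (x + z) * (z + y) * (x + z + y)),
   u38 * (y * z * (y + z) * (z + x) * (y + z + x)),
   u39 * (z * x * (z + x) * (x + y) * (z + x + y))] =
   (u3 + u6 + u9 + u12 + u15 + u27) * z ^ 5 +
   (u6 + 2 * u12 + u18 + u23 + u27 + u32 + u38) * (y * z ^ 4) +
   (u12 + 2 * u18 + u20 + 3 * u23 + u32 + u36 + 2 * u38) * (y ^ 2 * z ^ 3) +
   (u14 + u18 + 2 * u20 + 3 * u23 + u30 + 2 * u36 + u38) * (y ^ 3 * z ^ 2) +
   (u8 + 2 * u14 + u20 + u23 + u25 + u30 + u36) * (y ^ 4 * z) +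
   (u2 + u5 + u8 + u11 + u14 + u25) * y ^ 5 +
   (u9 + 2 * u15 + u21 + u24 + u27 + u31 + u37) * (x * z ^ 4) +
   (u23 + u24 + u27 + u31 + u32 + u36 + 2 * u37 + 2 * u38 + u39) * (x * y * z ^ 3) +
   (2 * u23 + u30 + u32 + u34 + u35 + 3 * u36 + u37 + 3 * u38 + u39) * (x * y ^ 2 * z ^ 2) +
   (u22 + u23 + u25 + u28 + u30 + 2 * u34 + u35 + 2 * u36 + u38) * (x * y ^ 3 * z) +
   (u5 + 2 * u11 + u17 + u22 + u25 + u28 + u34) * (x * y ^ 4) +
   (u15 + u19 + 2 * u21 + 3 * u24 + u31 + 2 * u37 + u39) * (x ^ 2 * z ^ 3) +
   (2 * u24 + u31 + u33 + u34 + u35 + u36 + 3 * u37 + u38 + 3 * u39) * (x ^ 2 * y * z ^ 2) +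
   (2 * u22 + u28 + u29 + 3 * u34 + 3 * u35 + u36 + u37 + u38 + u39) * (x ^ 2 * y ^ 2 * z) +
   (u11 + u16 + 2 * u17 + 3 * u22 + u28 + 2 * u34 + u35) * (x ^ 2 * y ^ 3) +
   (u13 + 2 * u19 + u21 + 3 * u24 + u33 + u37 + 2 * u39) * (x ^ 3 * z ^ 2) +
   (u22 + u24 + u26 + u29 + u33 + u34 + 2 * u35 + u37 + 2 * u39) * (x ^ 3 * y * z) +
   (u10 + 2 * u16 + u17 + 3 * u22 + u29 + u34 + 2 * u35) * (x ^ 3 * y ^ 2) +
   (u7 + 2 * u13 + u19 + u24 + u26 + u33 + u39) * (x ^ 4 * z) +
   (u4 + 2 * u10 + u16 + u22 + u26 + u29 + u35) * (x ^ 4 * y) +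
   (u1 + u4 + u7 + u10 + u13 + u26) * x ^ 5"
  by (simp only: sum_list.Cons sum_list.Nil add_0_right dual_product_expansions)
    (simp only: distrib_left distrib_right mult_ac add_ac)

definition quintic_exponents :: "(nat \<times> nat \<times> nat) list" where
  "quintic_exponents =
    [(0, 0, 5), (0, 1, 4), (0, 2, 3), (0, 3, 2), (0, 4, 1), (0, 5, 0), (1, 0, 4), (1, 1, 3), (1, 2, 2), (1, 3, 1), (1, 4, 0), (2, 0, 3), (2, 1, 2), (2, 2, 1), (2, 3, 0), (3, 0, 2), (3, 1, 1), (3, 2, 0), (4, 0, 1), (4, 1, 0), (5, 0, 0)]"

lemma trinomial_quintic:
  fixes x y z :: real
  shows "(x + y + z) ^ 5 =
    (\<Sum>(i, j, k)\<leftarrow>quintic_exponents. fact 5 / (fact i * fact j * fact k) * (x ^ i * y ^ j * z ^ k))"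
proof -
  have "(x + y + z) ^ 5 = z ^ 5 + 5 * (y * z ^ 4) + 10 * (y ^ 2 * z ^ 3) + 10 * (y ^ 3 * z ^ 2) + 5 * (y ^ 4 * z) + y ^ 5 + 5 * (x * z ^ 4) + 20 * (x * y * z ^ 3) + 30 * (x * y ^ 2 * z ^ 2) + 20 * (x * y ^ 3 * z) + 5 * (x * y ^ 4) + 10 * (x ^ 2 * z ^ 3) + 30 * (x ^ 2 * y * z ^ 2) + 30 * (x ^ 2 * y ^ 2 * z) + 10 * (x ^ 2 * y ^ 3) + 10 * (x ^ 3 * z ^ 2) + 20 * (x ^ 3 * y * z) + 10 * (x ^ 3 * y ^ 2) + 5 * (x ^ 4 * z) + 5 * (x ^ 4 * y) + x ^ 5"
    by algebra
  then show ?thesis by (simp add: quintic_exponents_def fact_numeral)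
qed

lemma label_weight_act_generators:
  assumes p: "induced_perm p 1 = i1" "induced_perm p 2 = i2" "induced_perm p 3 = i3"
      "induced_perm p 4 = i4" "induced_perm p 5 = i5" "induced_perm p 6 = i6" "induced_perm p 10 = 10"
    and q: "q i4 = (q i1 + q i2) / 2" "q i5 = (q i2 + q i3) / 2" "q 10 = (q i1 + q i2 + q i3) / 3"
  shows "label_weight a q (act p gen1) = 1 / 4 * (a i1 ^ 6 * a i4 * a i6) * (q i1 ^ 5)"
    and "label_weight a q (act p gen2) = 1 / 8 * (a i1 ^ 5 * a i4 ^ 2 * a i6) * (q i1 ^ 4 * (q i1 + q i2))"
    and "label_weight a q (act p gen3) = 1 / 8 * (a i1 ^ 4 * a i2 * a i4 ^ 2 * a i6) * (q i1 ^ 3 * (q i1 + q i2) ^ 2)"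
    and "label_weight a q (act p gen4) = 1 / 8 * (a i1 ^ 3 * a i2 ^ 2 * a i4 ^ 2 * a i6) * (q i1 ^ 2 * q i2 * (q i1 + q i2) ^ 2)"
    and "label_weight a q (act p gen5) = 1 / 16 * (a i1 ^ 2 * a i2 ^ 2 * a i4 ^ 2 * a i5 * a i6) * (q i1 * q i2 * (q i1 + q i2) ^ 2 * (q i1 + q i2 + q i3))"
    and "label_weight a q (act p gen6) = 1 / 4 * (a i1 * a i2 ^ 4 * a i3 * a i4 * a i5) * (q i2 ^ 3 * (q i1 + q i2) * (q i2 + q i3))"
    and "label_weight a q (act p gen7) = 1 / 8 * (a i1 * a i2 ^ 3 * a i3 * a i4 ^ 2 * a i5) * (q i1 * q i2 ^ 2 * (q i1 + q i2) * (q i2 + q i3))"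
    and "label_weight a q (act p gen8) = 1 / 16 * (a i1 * a i2 ^ 2 * a i3 * a i4 ^ 2 * a i5 * a i6) * (q i1 * q i2 * (q i1 + q i2) * (q i2 + q i3) * (q i1 + q i2 + q i3))"
  unfolding label_weight_act
  using label_weight_generators[of "q \<circ> induced_perm p" "a \<circ> induced_perm p"]
  by (simp_all add: p q del: One_nat_def)

text \<open>
  The Marsden-type identity after integration against \<open>l\<^sup>-\<^sup>8\<close>. The right-hand side is the
  complete homogeneous polynomial of degree 5 in the quotients \<open>q i / L i\<close>, divided by the product of the
  \<open>L i\<close>, as is to be expected from the integral of \<open>q\<^sup>5 / l\<^sup>8\<close>.
\<close>

lemma marsden_label_sum:
  fixes L q :: "nat \<Rightarrow> real"
  assumes pos: "L 1 > 0" "L 2 > 0" "L 3 > 0"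
    and L: "L 4 = (L 1 + L 2) / 2" "L 5 = (L 2 + L 3) / 2" "L 6 = (L 1 + L 3) / 2"
    and q: "q 4 = (q 1 + q 2) / 2" "q 5 = (q 2 + q 3) / 2" "q 6 = (q 1 + q 3) / 2"
      "q 10 = (q 1 + q 2 + q 3) / 3"
  shows "(\<Sum>j\<in>basis_labels. label_weight (\<lambda>i. 1 / L i) q j) =
    (\<Sum>(i, j, k)\<leftarrow>quintic_exponents. (q 1 ^ i * q 2 ^ j * q 3 ^ k) /
      (L 1 ^ (i + 1) * L 2 ^ (j + 1) * L 3 ^ (k + 1)))"
proof -
  define a where "a i = 1 / L i" for i
  define a1 where "a1 = a 1" define a2 where "a2 = a 2" define a3 where "a3 = a 3"
  define a4 where "a4 = a 4" define a5 where "a5 = a 5" define a6 where "a6 = a 6"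
  define x where "x = q 1" define y where "y = q 2" define z where "z = q 3"
  note folds = a1_def[symmetric] a2_def[symmetric] a3_def[symmetric] a4_def[symmetric] a5_def[symmetric]
    a6_def[symmetric] x_def[symmetric] y_def[symmetric] z_def[symmetric]
  note a_eqs = a1_def a2_def a3_def a4_def a5_def a6_def a_def
  have p0: "induced_perm id 1 = 1" "induced_perm id 2 = 2" "induced_perm id 3 = 3" "induced_perm id 4 = 4" "induced_perm id 5 = 5" "induced_perm id 6 = 6" "induced_perm id 10 = 10"
    by (simp_all add: induced_perm_simps)
  have q0: "q 4 = (q 1 + q 2) / 2" "q 5 = (q 2 + q 3) / 2" "q 10 = (q 1 + q 2 + q 3) / 3"
    by (simp_all add: q add_ac)
  note g0 = label_weight_act_generators[OF p0 q0, of a, unfolded folds]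
  have p1: "induced_perm t12 1 = 2" "induced_perm t12 2 = 1" "induced_perm t12 3 = 3" "induced_perm t12 4 = 4" "induced_perm t12 5 = 6" "induced_perm t12 6 = 5" "induced_perm t12 10 = 10"
    by (simp_all add: induced_perm_simps)
  have q1: "q 4 = (q 2 + q 1) / 2" "q 6 = (q 1 + q 3) / 2" "q 10 = (q 2 + q 1 + q 3) / 3"
    by (simp_all add: q add_ac)
  note g1 = label_weight_act_generators[OF p1 q1, of a, unfolded folds]
  have p2: "induced_perm t13 1 = 3" "induced_perm t13 2 = 2" "induced_perm t13 3 = 1" "induced_perm t13 4 = 5" "induced_perm t13 5 = 4" "induced_perm t13 6 = 6" "induced_perm t13 10 = 10"
    by (simp_all add: induced_perm_simps)
  have q2: "q 5 = (q 3 + q 2) / 2" "q 4 = (q 2 + q 1) / 2" "q 10 = (q 3 + q 2 + q 1) / 3"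
    by (simp_all add: q add_ac)
  note g2 = label_weight_act_generators[OF p2 q2, of a, unfolded folds]
  have p3: "induced_perm t23 1 = 1" "induced_perm t23 2 = 3" "induced_perm t23 3 = 2" "induced_perm t23 4 = 6" "induced_perm t23 5 = 5" "induced_perm t23 6 = 4" "induced_perm t23 10 = 10"
    by (simp_all add: induced_perm_simps)
  have q3: "q 6 = (q 1 + q 3) / 2" "q 5 = (q 3 + q 2) / 2" "q 10 = (q 1 + q 3 + q 2) / 3"
    by (simp_all add: q add_ac)
  note g3 = label_weight_act_generators[OF p3 q3, of a, unfolded folds]
  have p4: "induced_perm (t12 \<circ> t23) 1 = 2" "induced_perm (t12 \<circ> t23) 2 = 3" "induced_perm (t12 \<circ> t23) 3 = 1" "induced_perm (t12 \<circ> t23) 4 = 5" "induced_perm (t12 \<circ> t23) 5 = 6" "induced_perm (t12 \<circ> t23) 6 = 4" "induced_perm (t12 \<circ> t23) 10 = 10"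
    by (simp_all add: induced_perm_simps)
  have q4: "q 5 = (q 2 + q 3) / 2" "q 6 = (q 3 + q 1) / 2" "q 10 = (q 2 + q 3 + q 1) / 3"
    by (simp_all add: q add_ac)
  note g4 = label_weight_act_generators[OF p4 q4, of a, unfolded folds]
  have p5: "induced_perm (t13 \<circ> t23) 1 = 3" "induced_perm (t13 \<circ> t23) 2 = 1" "induced_perm (t13 \<circ> t23) 3 = 2" "induced_perm (t13 \<circ> t23) 4 = 6" "induced_perm (t13 \<circ> t23) 5 = 4" "induced_perm (t13 \<circ> t23) 6 = 5" "induced_perm (t13 \<circ> t23) 10 = 10"
    by (simp_all add: induced_perm_simps)
  have q5: "q 6 = (q 3 + q 1) / 2" "q 4 = (q 1 + q 2) / 2" "q 10 = (q 3 + q 1 + q 2) / 3"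
    by (simp_all add: q add_ac)
  note g5 = label_weight_act_generators[OF p5 q5, of a, unfolded folds]
  have T123: "split_reciprocals (L 1) (L 2) (L 3) (L 4) (L 5) (L 6) a1 a2 a3 a4 a5 a6"
    using pos by (simp add: split_reciprocals_def L a_eqs add_ac)
  have T132: "split_reciprocals (L 1) (L 3) (L 2) (L 6) (L 5) (L 4) a1 a3 a2 a6 a5 a4"
    using pos by (simp add: split_reciprocals_def L a_eqs add_ac)
  have T213: "split_reciprocals (L 2) (L 1) (L 3) (L 4) (L 6) (L 5) a2 a1 a3 a4 a6 a5"
    using pos by (simp add: split_reciprocals_def L a_eqs add_ac)
  have T231: "split_reciprocals (L 2) (L 3) (L 1) (L 5) (L 6) (L 4) a2 a3 a1 a5 a6 a4"
    using pos by (simp add: split_reciprocals_def L a_eqs add_ac)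
  have T312: "split_reciprocals (L 3) (L 1) (L 2) (L 6) (L 4) (L 5) a3 a1 a2 a6 a4 a5"
    using pos by (simp add: split_reciprocals_def L a_eqs add_ac)
  have T321: "split_reciprocals (L 3) (L 2) (L 1) (L 5) (L 4) (L 6) a3 a2 a1 a5 a4 a6"
    using pos by (simp add: split_reciprocals_def L a_eqs add_ac)
  have sum: "(\<Sum>j\<in>basis_labels. label_weight a q j) =
   (a1 * a2 * a3 ^ 6) * z ^ 5 +
   (a1 * a2 ^ 2 * a3 ^ 5) * (y * z ^ 4) +
   (a1 * a2 ^ 3 * a3 ^ 4) * (y ^ 2 * z ^ 3) +
   (a1 * a2 ^ 4 * a3 ^ 3) * (y ^ 3 * z ^ 2) +
   (a1 * a2 ^ 5 * a3 ^ 2) * (y ^ 4 * z) +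
   (a1 * a2 ^ 6 * a3) * y ^ 5 +
   (a1 ^ 2 * a2 * a3 ^ 5) * (x * z ^ 4) +
   (a1 ^ 2 * a2 ^ 2 * a3 ^ 4) * (x * y * z ^ 3) +
   (a1 ^ 2 * a2 ^ 3 * a3 ^ 3) * (x * y ^ 2 * z ^ 2) +
   (a1 ^ 2 * a2 ^ 4 * a3 ^ 2) * (x * y ^ 3 * z) +
   (a1 ^ 2 * a2 ^ 5 * a3) * (x * y ^ 4) +
   (a1 ^ 3 * a2 * a3 ^ 4) * (x ^ 2 * z ^ 3) +
   (a1 ^ 3 * a2 ^ 2 * a3 ^ 3) * (x ^ 2 * y * z ^ 2) +
   (a1 ^ 3 * a2 ^ 3 * a3 ^ 2) * (x ^ 2 * y ^ 2 * z) +
   (a1 ^ 3 * a2 ^ 4 * a3) * (x ^ 2 * y ^ 3) +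
   (a1 ^ 4 * a2 * a3 ^ 3) * (x ^ 3 * z ^ 2) +
   (a1 ^ 4 * a2 ^ 2 * a3 ^ 2) * (x ^ 3 * y * z) +
   (a1 ^ 4 * a2 ^ 3 * a3) * (x ^ 3 * y ^ 2) +
   (a1 ^ 5 * a2 * a3 ^ 2) * (x ^ 4 * z) +
   (a1 ^ 5 * a2 ^ 2 * a3) * (x ^ 4 * y) +
   (a1 ^ 6 * a2 * a3) * x ^ 5"
    using marsden_coefficient_500[OF T312] marsden_coefficient_410[OF T321]
      marsden_coefficient_320[OF T321] marsden_coefficient_320[OF T231]
      marsden_coefficient_410[OF T231] marsden_coefficient_500[OF T213]
      marsden_coefficient_410[OF T312] marsden_coefficient_311[OF T312]
      marsden_coefficient_221[OF T231] marsden_coefficient_311[OF T213]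
      marsden_coefficient_410[OF T213] marsden_coefficient_320[OF T312]
      marsden_coefficient_221[OF T132] marsden_coefficient_221[OF T123]
      marsden_coefficient_320[OF T213] marsden_coefficient_320[OF T132]
      marsden_coefficient_311[OF T123] marsden_coefficient_320[OF T123]
      marsden_coefficient_410[OF T132] marsden_coefficient_410[OF T123]
      marsden_coefficient_500[OF T123]
    unfolding sum_basis_labels list.map g0 g1 g2 g3 g4 g5 collect_monomials
    by (simp only: mult_ac add_ac)
  have a_eq: "(\<lambda>i. 1 / L i) = a" by (simp add: fun_eq_iff a_def)
  have summand: "(q 1 ^ i * q 2 ^ j * q 3 ^ k) / (L 1 ^ (i + 1) * L 2 ^ (j + 1) * L 3 ^ (k + 1))
      = (a1 ^ (i + 1) * a2 ^ (j + 1) * a3 ^ (k + 1)) * (x ^ i * y ^ j * z ^ k)" for i j k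
    by (simp add: a_eqs x_def y_def z_def power_divide)
  show ?thesis
    unfolding a_eq sum summand by (simp add: quintic_exponents_def power_numeral_reduce mult_ac add_ac)
qed

section \<open>Simplex splines on the triangle\<close>

definition corner :: "real^2 \<Rightarrow> real^2 \<Rightarrow> real^2 \<Rightarrow> 3 \<Rightarrow> real^2" where
  "corner v1 v2 v3 i = (if i = 1 then v1 else if i = 2 then v2 else v3)"

lemma corner_simps: "corner v1 v2 v3 1 = v1" "corner v1 v2 v3 2 = v2" "corner v1 v2 v3 3 = v3"
  by (simp_all add: corner_def)

lemma range_corner: "range (corner v1 v2 v3) = {v1, v2, v3}"
  unfolding UNIV_3 by (auto simp: corner_simps)

lemma affine_frame_corner:
  assumes "\<not> collinear {v1, v2, v3}"
  shows "affine_frame (corner v1 v2 v3)"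
proof
  show "CARD(3) = DIM(real^2) + 1" by simp
  fix u :: "3 \<Rightarrow> real" and i
  assume "sum u UNIV = 0" "(\<Sum>i\<in>UNIV. u i *\<^sub>R corner v1 v2 v3 i) = 0"
  then have "u 1 = 0" "u 2 = 0" "u 3 = 0"
    using noncollinear_combination[OF assms, of "u 1" "u 2" "u 3"] by (simp_all add: sum_3 corner_simps)
  then show "u i = 0" using exhaust_3[of i] by auto
qed

lemma compact_closed_triangle: "compact (closed_triangle v1 v2 v3)"
  unfolding closed_triangle_def by (intro finite_imp_compact_convex_hull) simp

lemma interior_closed_triangle:
  assumes "\<not> collinear {v1, v2, v3}"
  shows "interior (closed_triangle v1 v2 v3) \<noteq> {}"
proof -
  have ad: "\<not> affine_dependent {v1, v2, v3}" and card: "card {v1, v2, v3} = Suc DIM(real^2)"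
    using assms by (auto simp: collinear_3_eq_affine_dependent)
  show ?thesis unfolding closed_triangle_def
    using interior_convex_hull_eq_empty[OF card] ad by simp
qed

lemma convex_closed_triangle: "convex (closed_triangle v1 v2 v3)"
  by (simp add: closed_triangle_def)

lemma closure_interior_closed_triangle:
  assumes "\<not> collinear {v1, v2, v3}"
  shows "closure (interior (closed_triangle v1 v2 v3)) = closed_triangle v1 v2 v3"
  using convex_closure_interior[OF convex_closed_triangle interior_closed_triangle[OF assms]]
    compact_closed_triangle by (simp add: compact_imp_closed)

lemma affine_nonneg_triangle:
  assumes "\<beta> + z \<bullet> v1 \<ge> 0" "\<beta> + z \<bullet> v2 \<ge> 0" "\<beta> + z \<bullet> v3 \<ge> (0::real)" "x \<in> closed_triangle v1 v2 v3"
  shows "\<beta> + z \<bullet> x \<ge> 0"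
proof -
  have "closed_triangle v1 v2 v3 \<subseteq> {x. z \<bullet> x \<ge> - \<beta>}"
    unfolding closed_triangle_def using assms(1-3)
    by (intro hull_minimal) (auto simp: convex_halfspace_ge)
  with assms(4) show ?thesis by auto
qed

lemma sum_list_set_integral:
  fixes f :: "'b \<Rightarrow> 'a \<Rightarrow> real"
  assumes "\<And>t. t \<in> set ts \<Longrightarrow> set_integrable M A (f t)"
  shows "set_integrable M A (\<lambda>x. \<Sum>t\<leftarrow>ts. f t x) \<and>
    (LINT x:A|M. (\<Sum>t\<leftarrow>ts. f t x)) = (\<Sum>t\<leftarrow>ts. LINT x:A|M. f t x)"
  using assms
proof (induction ts)
  case Nil
  then show ?case by (simp add: set_integrable_def set_lebesgue_integral_def)
next
  case (Cons t ts)
  then show ?case using set_integral_add[of M A "f t" "\<lambda>x. \<Sum>t\<leftarrow>ts. f t x"] by simp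
qed

lemma prod_UNIV_3: "(\<Prod>i\<in>UNIV. f i) = f 1 * f 2 * f (3::3)" for f :: "3 \<Rightarrow> 'a::comm_monoid_mult"
  unfolding UNIV_3 by (simp add: mult.assoc)

lemma quintic_exponents_sum: "(i, j, k) \<in> set quintic_exponents \<Longrightarrow> i + j + k = 5"
  by (auto simp: quintic_exponents_def)

text \<open>
  Expand \<open>q\<^sup>5\<close> in Bernstein monomials and apply \<open>nn_integral_simplex_rational\<close> to each of them. The
  factorials cancel the multinomial coefficients, and 21 is \<open>7 choose 2\<close>, the normalization of the simplex
  splines.
\<close>

lemma triangle_integral_quintic:
  assumes nc: "\<not> collinear {v1, v2, v3}"
    and pos: "\<beta> + z \<bullet> v1 > 0" "\<beta> + z \<bullet> v2 > 0" "\<beta> + z \<bullet> v3 > (0::real)"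
  shows "(LINT x:closed_triangle v1 v2 v3|lborel. (\<gamma> + w \<bullet> x) ^ 5 / (\<beta> + z \<bullet> x) ^ 8) =
    measure lborel (closed_triangle v1 v2 v3) / 21 *
    (\<Sum>(i, j, k)\<leftarrow>quintic_exponents.
      ((\<gamma> + w \<bullet> v1) ^ i * (\<gamma> + w \<bullet> v2) ^ j * (\<gamma> + w \<bullet> v3) ^ k) /
      ((\<beta> + z \<bullet> v1) ^ (i + 1) * (\<beta> + z \<bullet> v2) ^ (j + 1) * (\<beta> + z \<bullet> v3) ^ (k + 1)))"
proof -
  let ?l1 = "\<beta> + z \<bullet> v1" and ?l2 = "\<beta> + z \<bullet> v2" and ?l3 = "\<beta> + z \<bullet> v3"
  let ?q1 = "\<gamma> + w \<bullet> v1" and ?q2 = "\<gamma> + w \<bullet> v2" and ?q3 = "\<gamma> + w \<bullet> v3"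
  let ?p = "corner v1 v2 v3" and ?T = "closed_triangle v1 v2 v3"
  interpret affine_frame ?p by (rule affine_frame_corner[OF nc])
  have hull: "convex hull (range ?p) = ?T" by (simp add: range_corner closed_triangle_def)
  obtain c where c: "c > 0" and cint: "\<And>e l. (\<And>i. l i > 0) \<Longrightarrow>
      (\<integral>\<^sup>+x. ennreal ((\<Prod>i\<in>UNIV. bary x i ^ e i) /
             (\<Sum>i\<in>UNIV. l i * bary x i) ^ (DIM(real^2) + 1 + sum e UNIV)) * indicator ?T x \<partial>lborel)
      = ennreal (c / fact (DIM(real^2) + sum e UNIV) * (\<Prod>i\<in>UNIV. fact (e i) / l i ^ (e i + 1)))"
    unfolding hull[symmetric] using nn_integral_simplex_rational by blast
  have Tm[measurable]: "?T \<in> sets borel"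
    using compact_closed_triangle by (simp add: compact_imp_closed borel_closed)
  have area: "measure lborel ?T = c / 2"
  proof -
    have "emeasure lborel ?T = (\<integral>\<^sup>+x. indicator ?T x \<partial>lborel)" by simp
    also have "\<dots> = ennreal (c / 2)"
      using cint[of "\<lambda>_. 1" "\<lambda>_. 0"] by (simp add: sum_bary fact_numeral)
    finally show ?thesis using c by (simp add: measure_def)
  qed
  have aff: "\<beta>' + z' \<bullet> x = (\<beta>' + z' \<bullet> v1) * bary x 1 + (\<beta>' + z' \<bullet> v2) * bary x 2 + (\<beta>' + z' \<bullet> v3) * bary x 3"
    for \<beta>' z' x
  proof -
    have s: "bary x 1 + bary x 2 + bary x 3 = 1" using sum_bary[of x] by (simp add: sum_3)
    have x: "x = bary x 1 *\<^sub>R v1 + bary x 2 *\<^sub>R v2 + bary x 3 *\<^sub>R v3"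
      using bary_combination[of x] by (simp add: sum_3 corner_simps)
    have "z' \<bullet> x = bary x 1 * (z' \<bullet> v1) + bary x 2 * (z' \<bullet> v2) + bary x 3 * (z' \<bullet> v3)"
      by (subst x) (simp add: inner_add_right)
    moreover have "\<beta>' = \<beta>' * (bary x 1 + bary x 2 + bary x 3)" using s by simp
    ultimately show ?thesis by (simp add: algebra_simps)
  qed
  have bnn: "bary x i \<ge> 0" if "x \<in> ?T" for x i
    using that unfolding hull[symmetric] convex_hull_eq_bary by simp
  define l where "l i = \<beta> + z \<bullet> ?p i" for i
  have l: "l i > 0" for i using pos by (simp add: l_def corner_def)
  have lx: "(\<Sum>i\<in>UNIV. l i * bary x i) = \<beta> + z \<bullet> x" for x
    using aff[of \<beta> z x] by (simp add: sum_3 l_def corner_simps)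
  have lpos: "\<beta> + z \<bullet> x > 0" if "x \<in> ?T" for x
    using sum_bary_pos[of l x] l bnn[OF that] unfolding lx by blast
  have mono_cont: "continuous_on ?T (\<lambda>x. bary x 1 ^ i * bary x 2 ^ j * bary x 3 ^ k / (\<beta> + z \<bullet> x) ^ 8)" for i j k
    by (intro continuous_intros) (use lpos in force)
  have mono_int: "set_integrable lborel ?T (\<lambda>x. bary x 1 ^ i * bary x 2 ^ j * bary x 3 ^ k / (\<beta> + z \<bullet> x) ^ 8)" for i j k
    unfolding set_integrable_def by (rule borel_integrable_compact[OF compact_closed_triangle mono_cont])
  have mono: "(LINT x:?T|lborel. bary x 1 ^ i * bary x 2 ^ j * bary x 3 ^ k / (\<beta> + z \<bullet> x) ^ 8) =
      c / 5040 * (fact i * fact j * fact k / (?l1 ^ (i + 1) * ?l2 ^ (j + 1) * ?l3 ^ (k + 1)))"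
    if ijk: "i + j + k = 5" for i j k
  proof -
    let ?f = "\<lambda>x. indicator ?T x *\<^sub>R (bary x 1 ^ i * bary x 2 ^ j * bary x 3 ^ k / (\<beta> + z \<bullet> x) ^ 8)"
    let ?r = "c / 5040 * (fact i * fact j * fact k / (?l1 ^ (i + 1) * ?l2 ^ (j + 1) * ?l3 ^ (k + 1)))"
    define e where "e t = (if t = 1 then i else if t = 2 then j else k)" for t :: 3
    have e: "e 1 = i" "e 2 = j" "e 3 = k" by (simp_all add: e_def)
    have se: "sum e UNIV = 5" using ijk by (simp add: sum_3 e)
    have "(\<integral>\<^sup>+x. ennreal (?f x) \<partial>lborel) = (\<integral>\<^sup>+x. ennreal ((\<Prod>i\<in>UNIV. bary x i ^ e i) /
             (\<Sum>i\<in>UNIV. l i * bary x i) ^ (DIM(real^2) + 1 + sum e UNIV)) * indicator ?T x \<partial>lborel)"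
      unfolding lx se by (intro nn_integral_cong) (auto simp: indicator_def prod_UNIV_3 e)
    also have "\<dots> = ennreal (c / fact (DIM(real^2) + sum e UNIV) * (\<Prod>i\<in>UNIV. fact (e i) / l i ^ (e i + 1)))"
      by (rule cint[OF l])
    also have "\<dots> = ennreal ?r"
      unfolding se by (simp add: prod_UNIV_3 e l_def corner_simps fact_numeral mult.assoc)
    finally have nn: "(\<integral>\<^sup>+x. ennreal (?f x) \<partial>lborel) = ennreal ?r" .
    have "integral\<^sup>L lborel ?f = enn2real (\<integral>\<^sup>+x. ennreal (?f x) \<partial>lborel)"
    proof (rule integral_eq_nn_integral)
      show "?f \<in> borel_measurable lborel"
        using mono_int[of i j k] unfolding set_integrable_def by (rule borel_measurable_integrable)
      have "0 \<le> bary x 1 ^ i * bary x 2 ^ j * bary x 3 ^ k / (\<beta> + z \<bullet> x) ^ 8" if "x \<in> ?T" for x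
        by (intro divide_nonneg_pos mult_nonneg_nonneg zero_le_power zero_less_power bnn lpos that)
      then show "AE x in lborel. 0 \<le> ?f x"
        by (intro AE_I2) (simp add: indicator_def)
    qed
    moreover have "?r \<ge> 0" using c pos by (simp add: less_imp_le)
    ultimately show ?thesis unfolding nn set_lebesgue_integral_def by simp
  qed
  define C where "C = (\<lambda>(i, j, k). fact 5 / (fact i * fact j * fact k) * (?q1 ^ i * ?q2 ^ j * ?q3 ^ k))"
  define F where "F = (\<lambda>(i, j, k) x. bary x 1 ^ i * bary x 2 ^ j * bary x 3 ^ k / (\<beta> + z \<bullet> x) ^ 8)"
  have expand: "(\<gamma> + w \<bullet> x) ^ 5 / (\<beta> + z \<bullet> x) ^ 8 = (\<Sum>t\<leftarrow>quintic_exponents. C t * F t x)" for x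
  proof -
    have "(\<gamma> + w \<bullet> x) ^ 5 = (\<Sum>(i, j, k)\<leftarrow>quintic_exponents.
      fact 5 / (fact i * fact j * fact k) * ((?q1 * bary x 1) ^ i * (?q2 * bary x 2) ^ j * (?q3 * bary x 3) ^ k))"
      by (subst aff) (rule trinomial_quintic)
    moreover have "(\<Sum>t\<leftarrow>ts. g t) / d = (\<Sum>t\<leftarrow>ts. g t / d)" for ts :: "(nat \<times> nat \<times> nat) list" and g and d :: real
      by (induction ts) (simp_all add: add_divide_distrib)
    ultimately show ?thesis
      by (simp add: C_def F_def case_prod_beta power_mult_distrib mult_ac)
  qed
  have Fint: "set_integrable lborel ?T (\<lambda>x. C t * F t x)" for t
    by (rule set_integrable_mult_right) (cases t rule: prod_cases3, simp add: F_def mono_int)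
  have "(LINT x:?T|lborel. (\<gamma> + w \<bullet> x) ^ 5 / (\<beta> + z \<bullet> x) ^ 8) = (\<Sum>t\<leftarrow>quintic_exponents. LINT x:?T|lborel. C t * F t x)"
    unfolding expand
    by (rule sum_list_set_integral[THEN conjunct2, OF Fint])
  also have "\<dots> = (\<Sum>t\<leftarrow>quintic_exponents. measure lborel ?T / 21 * (case t of (i, j, k) \<Rightarrow>
      (?q1 ^ i * ?q2 ^ j * ?q3 ^ k) /
      (?l1 ^ (i + 1) * ?l2 ^ (j + 1) * ?l3 ^ (k + 1))))"
  proof (rule arg_cong[where f = sum_list], rule map_cong)
    fix t assume t: "t \<in> set quintic_exponents"
    obtain i j k where ijk: "t = (i, j, k)" by (metis prod_cases3)
    with t have "i + j + k = 5" by (simp add: quintic_exponents_sum)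
    from mono[OF this] have "(LINT x:?T|lborel. C t * F t x) = C t * (c / 5040 * (fact i * fact j * fact k / (?l1 ^ (i + 1) * ?l2 ^ (j + 1) * ?l3 ^ (k + 1))))"
      by (simp only: F_def ijk prod.case set_integral_mult_right)
    also have "\<dots> = measure lborel ?T / 21 * ((?q1 ^ i * ?q2 ^ j * ?q3 ^ k) /
      (?l1 ^ (i + 1) * ?l2 ^ (j + 1) * ?l3 ^ (k + 1)))"
    proof -
      have "120 / A * q * (c / 5040 * (A / D)) = c / 2 / 21 * (q / D)" if "A \<noteq> 0" "D \<noteq> 0" for A D q :: real
        using that by (simp add: field_simps)
      from this[of "fact i * fact j * fact k"] show ?thesis
        using pos by (simp add: C_def ijk area fact_numeral mult_ac)
    qed
    finally show "(LINT x:?T|lborel. C t * F t x) = measure lborel ?T / 21 * (case t of (i, j, k) \<Rightarrow>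
      (?q1 ^ i * ?q2 ^ j * ?q3 ^ k) /
      (?l1 ^ (i + 1) * ?l2 ^ (j + 1) * ?l3 ^ (k + 1)))"
      by (simp add: ijk)
  qed simp
  finally show ?thesis by (simp only: sum_list_const_mult)
qed

lemma knot_simplex_frame:
  fixes a b c :: "real^2"
  assumes "{#a, b, c#} \<subseteq># K" "size K = 8" "\<not> collinear {a, b, c}"
  obtains p :: "8 \<Rightarrow> (real^2) \<times> (real^5)"
  where "affine_frame p" "knot_simplex K = convex hull (range p)"
    "image_mset (\<lambda>i. fst (p i)) (mset_set UNIV) = K"
proof -
  have "lifts_knots (SOME P. lifts_knots P K) K"
    using lifts_knots_exists[OF assms] by (rule someI_ex)
  then show ?thesis by (rule lifts_knots_frame) (use that in \<open>auto simp: knot_simplex_def\<close>)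
qed

text \<open>
  The simplex spline with integral 1; the factor involving the area of the triangle is left out, so only
  the knots enter.
\<close>

definition spline_density :: "(real^2) multiset \<Rightarrow> real^2 \<Rightarrow> real" where
  "spline_density K x = measure lborel {y. (x, y) \<in> knot_simplex K} / measure lborel (knot_simplex K)"

lemma spline_density_nonneg: "spline_density K x \<ge> 0"
  by (simp add: spline_density_def)

lemma simplex_spline_eq_density:
  "simplex_spline v1 v2 v3 m x =
    measure lborel (closed_triangle v1 v2 v3) / 21 * spline_density (image_mset (ps_point v1 v2 v3) m) x"
  by (simp add: simplex_spline_def spline_density_def Let_def choose_two)

lemma spline_density_continuous:
  fixes a b c :: "real^2"
  assumes K: "{#a, b, c#} \<subseteq># K" "size K = 8" "\<not> collinear {a, b, c}"
    and facet: "\<forall>k \<beta> z. k \<in># K \<and> (\<forall>k'\<in>#K - {#k#}. \<beta> + z \<bullet> k' = 0) \<and> \<beta> + z \<bullet> k = 1 \<longrightarrow>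
      (\<forall>x\<in>T. \<beta> + z \<bullet> x \<ge> 0)"
  shows "continuous_on T (spline_density K)"
proof -
  obtain p :: "8 \<Rightarrow> (real^2) \<times> (real^5)" where p: "affine_frame p" "knot_simplex K = convex hull (range p)"
    "image_mset (\<lambda>i. fst (p i)) (mset_set UNIV) = K"
    using knot_simplex_frame[OF K] .
  have "continuous_on T (\<lambda>x. measure lborel {y. (x, y) \<in> convex hull (range p)})"
  proof (rule continuous_on_fibre_volume[OF p(1)])
    fix i \<beta> z x assume val: "\<And>j. \<beta> + z \<bullet> fst (p j) = (if j = i then 1 else 0)" and x: "x \<in> T"
    have "mset_set (UNIV :: 8 set) = add_mset i (mset_set (UNIV - {i}))" by (rule mset_set.remove) auto
    then have K_eq: "K = add_mset (fst (p i)) (image_mset (\<lambda>i. fst (p i)) (mset_set (UNIV - {i})))"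
      using p(3) by simp
    have "\<beta> + z \<bullet> k' = 0" if "k' \<in># K - {#fst (p i)#}" for k'
    proof -
      from that have "k' \<in> (\<lambda>i. fst (p i)) ` (UNIV - {i})" by (simp add: K_eq)
      then obtain j where "k' = fst (p j)" "j \<noteq> i" by blast
      then show ?thesis using val[of j] by simp
    qed
    moreover have "fst (p i) \<in># K" by (simp add: K_eq)
    moreover have "\<beta> + z \<bullet> fst (p i) = 1" using val[of i] by simp
    ultimately show "\<beta> + z \<bullet> x \<ge> 0" using facet x by blast
  qed
  then have "continuous_on T (\<lambda>x. measure lborel {y. (x, y) \<in> knot_simplex K} / measure lborel (knot_simplex K))"
    unfolding p(2) by (cases "measure lborel (convex hull (range p)) = 0") (simp, intro continuous_intros, auto)
  then show ?thesis by (simp add: spline_density_def[abs_def])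
qed

text \<open>
  The integrand vanishes outside \<open>T\<close> because the projected simplex is the convex hull of the knots.
  Its exponent is even, so it is nonnegative even where the affine function is negative.
\<close>

lemma spline_density_integral:
  fixes a b c :: "real^2"
  assumes K: "{#a, b, c#} \<subseteq># K" "size K = 8" "\<not> collinear {a, b, c}"
    and T: "compact T" "convex T" "set_mset K \<subseteq> T" and cont: "continuous_on T (spline_density K)"
    and pos: "\<And>x. x \<in> T \<Longrightarrow> \<beta> + z \<bullet> x > 0"
  shows "(LINT x:T|lborel. spline_density K x / (\<beta> + z \<bullet> x) ^ 8) = (\<Prod>k\<in>#K. 1 / (\<beta> + z \<bullet> k))"
proof -
  obtain p :: "8 \<Rightarrow> (real^2) \<times> (real^5)" where p: "affine_frame p" "knot_simplex K = convex hull (range p)"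
    "image_mset (\<lambda>i. fst (p i)) (mset_set UNIV) = K"
    using knot_simplex_frame[OF K] .
  have pT: "fst (p i) \<in> T" for i
  proof -
    have "fst (p i) \<in># K" unfolding p(3)[symmetric] by simp
    then show ?thesis using T(3) by blast
  qed
  have outside: "spline_density K x = 0" if "x \<notin> T" for x
  proof -
    have "fst ` (convex hull (range p)) = convex hull (fst ` range p)"
      by (rule convex_hull_linear_image) (simp add: linear_fst)
    also have "\<dots> \<subseteq> T" using pT T(2) by (intro hull_minimal) auto
    finally have "{y. (x, y) \<in> knot_simplex K} = {}" using that unfolding p(2) by force
    then show ?thesis by (simp add: spline_density_def)
  qed
  let ?f = "\<lambda>x. spline_density K x / (\<beta> + z \<bullet> x) ^ 8"
  have ind: "indicator T x *\<^sub>R ?f x = ?f x" for x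
    by (cases "x \<in> T") (simp_all add: outside)
  have prod: "(\<Prod>i\<in>UNIV. 1 / (\<beta> + z \<bullet> fst (p i))) = (\<Prod>k\<in>#K. 1 / (\<beta> + z \<bullet> k))"
    unfolding p(3)[symmetric] by (simp add: prod_unfold_prod_mset multiset.map_comp comp_def)
  have nn: "(\<integral>\<^sup>+x. ennreal (?f x) \<partial>lborel) = ennreal (\<Prod>k\<in>#K. 1 / (\<beta> + z \<bullet> k))"
    using nn_integral_fibre_rational[OF p(1), of \<beta> z] pos[OF pT]
    unfolding prod p(2)[symmetric] by (simp add: spline_density_def)
  have "continuous_on T ?f" by (intro continuous_intros cont) (use pos in force)
  then have "integrable lborel (\<lambda>x. indicator T x *\<^sub>R ?f x)"
    by (rule borel_integrable_compact[OF T(1)])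
  then have meas: "?f \<in> borel_measurable lborel"
    unfolding ind by (rule borel_measurable_integrable)
  have "(LINT x:T|lborel. ?f x) = integral\<^sup>L lborel ?f"
    unfolding set_lebesgue_integral_def ind ..
  also have "\<dots> = enn2real (\<integral>\<^sup>+x. ennreal (?f x) \<partial>lborel)"
    by (rule integral_eq_nn_integral[OF meas])
      (intro AE_I2 divide_nonneg_nonneg spline_density_nonneg zero_le_even_power, simp)
  also have "(\<Prod>k\<in>#K. 1 / (\<beta> + z \<bullet> k)) \<ge> 0"
    unfolding prod[symmetric] using pos[OF pT] by (intro prod_nonneg) (simp add: less_imp_le)
  then have "enn2real (\<integral>\<^sup>+x. ennreal (?f x) \<partial>lborel) = (\<Prod>k\<in>#K. 1 / (\<beta> + z \<bullet> k))"
    unfolding nn by simp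
  finally show ?thesis .
qed

lemma ps_point_simps:
  "ps_point v1 v2 v3 1 = v1" "ps_point v1 v2 v3 2 = v2" "ps_point v1 v2 v3 3 = v3"
  "ps_point v1 v2 v3 4 = (1/2) *\<^sub>R (v1 + v2)" "ps_point v1 v2 v3 5 = (1/2) *\<^sub>R (v2 + v3)"
  "ps_point v1 v2 v3 6 = (1/2) *\<^sub>R (v1 + v3)" "ps_point v1 v2 v3 10 = (1/3) *\<^sub>R (v1 + v2 + v3)"
  by (simp_all add: ps_point_def)

lemma affine_ps_point_mid:
  fixes \<beta> :: real and z v1 v2 v3 :: "real^2"
  defines "val \<equiv> \<lambda>i. \<beta> + z \<bullet> ps_point v1 v2 v3 i"
  shows "val 4 = (val 1 + val 2) / 2" "val 5 = (val 2 + val 3) / 2" "val 6 = (val 1 + val 3) / 2"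
    "val 10 = (val 1 + val 2 + val 3) / 3"
  unfolding val_def ps_point_simps inner_scaleR_right inner_add_right by (simp_all add: field_simps)

lemma ps_point_mem:
  assumes "i \<in> {1, 2, 3, 4, 5, 6, 10}"
  shows "ps_point v1 v2 v3 i \<in> closed_triangle v1 v2 v3"
proof -
  let ?T = "closed_triangle v1 v2 v3"
  have v: "v1 \<in> ?T" "v2 \<in> ?T" "v3 \<in> ?T" by (auto simp: closed_triangle_def hull_inc)
  have mid: "(1/2) *\<^sub>R (a + b) \<in> ?T" if "a \<in> ?T" "b \<in> ?T" for a b
    using convexD[OF convex_closed_triangle that, of "1/2" "1/2"] by (simp add: scaleR_add_right)
  have "(1/3) *\<^sub>R (v1 + v2 + v3) \<in> ?T"
    using convexD[OF convex_closed_triangle mid[OF v(1,2)] v(3), of "2/3" "1/3"]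
    by (simp add: scaleR_add_right)
  with v mid assms show ?thesis by (auto simp: ps_point_simps simp del: One_nat_def)
qed

lemma generator_knots_triple:
  assumes nc: "\<not> collinear {v1, v2, v3}" and g: "(c, m, d) \<in> generators"
  shows "\<exists>a b e. {#a, b, e#} \<subseteq># image_mset (ps_point v1 v2 v3) m \<and> \<not> collinear {a, b, e}"
proof -
  let ?P = "ps_point v1 v2 v3"
  have nc': "\<not> collinear {?P 1, ?P 4, ?P 6}"
  proof
    assume "collinear {?P 1, ?P 4, ?P 6}"
    then have "collinear {?P 4, ?P 1, ?P 6}" by (simp only: insert_commute)
    then have c0: "collinear {0, ?P 4 - ?P 1, ?P 6 - ?P 1}"
      by (subst (asm) collinear_3) (simp_all)
    have eq: "?P 4 - ?P 1 = (1/2) *\<^sub>R (v2 - v1)" "?P 6 - ?P 1 = (1/2) *\<^sub>R (v3 - v1)"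
      by (simp_all only: ps_point_simps) (simp_all add: vec_eq_iff field_simps)
    have "v2 - v1 = 0 \<or> v3 - v1 = 0 \<or> (\<exists>c. (1/2) *\<^sub>R (v3 - v1) = (1/2) *\<^sub>R (c *\<^sub>R (v2 - v1)))"
      using c0 unfolding eq collinear_lemma scaleR_left_commute[of _ "1/2"] scaleR_eq_0_iff by simp
    then have "collinear {0, v2 - v1, v3 - v1}"
      unfolding collinear_lemma scaleR_cancel_left by simp
    then have "collinear {v2, v1, v3}" by (subst collinear_3) simp_all
    with nc show False by (simp only: insert_commute)
  qed
  have nc'': "\<not> collinear {?P 1, ?P 2, ?P 3}" using nc by (simp add: ps_point_simps del: One_nat_def)
  have sub: "mset_set A \<subseteq># m" if "A \<subseteq> set_mset m" for A
    using subset_imp_msubset_mset_set[OF that] mset_set_set_mset_msubset[of m]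
    by (meson finite_set_mset subset_mset.order_trans)
  have "{1, 4, 6} \<subseteq> set_mset m \<or> {1, 2, 3} \<subseteq> set_mset m"
  proof -
    have "\<forall>(c, m, d)\<in>generators. {1, 4, 6} \<subseteq> set_mset m \<or> {1, 2, 3} \<subseteq> set_mset m"
      by (simp add: generators_def knots_6)
    with g show ?thesis by blast
  qed
  then have "mset_set {1, 4, 6} \<subseteq># m \<or> mset_set {1, 2, 3} \<subseteq># m" using sub by blast
  then have "{#1, 4, 6#} \<subseteq># m \<or> {#1, 2, 3#} \<subseteq># m" by simp
  then have "{#?P 1, ?P 4, ?P 6#} \<subseteq># image_mset ?P m \<or> {#?P 1, ?P 2, ?P 3#} \<subseteq># image_mset ?P m"
    using image_mset_subseteq_mono[of "{#1, 4, 6#}" m ?P] image_mset_subseteq_mono[of "{#1, 2, 3#}" m ?P] by auto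
  with nc' nc'' show ?thesis by blast
qed

lemma generator_size:
  assumes "(c, m, d) \<in> generators"
  shows "size m = 8 \<and> size d = 5 \<and> c \<ge> 0 \<and> set_mset m \<subseteq> {1, 2, 3, 4, 5, 6} \<and> set_mset d \<subseteq> {1, 2, 3, 4, 5, 6, 10}"
proof -
  have "\<forall>(c, m, d)\<in>generators. size m = 8 \<and> size d = 5 \<and> c \<ge> 0 \<and>
    set_mset m \<subseteq> {1, 2, 3, 4, 5, 6} \<and> set_mset d \<subseteq> {1, 2, 3, 4, 5, 6, 10}"
    by (simp add: generators_def knots_6)
  with assms show ?thesis by blast
qed

text \<open>
  This is the condition of \<open>spline_density_continuous\<close>, expressed through the values of an affine
  function at the indexed points. For most knots of a generator the hypotheses are contradictory,
  since the remaining knots span the plane; otherwise they lie on an edge of the triangle.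
\<close>

lemma generator_facets:
  fixes val :: "nat \<Rightarrow> real"
  assumes g: "(c, m, d) \<in> generators" and i: "i \<in># m"
    and zero: "\<And>j. j \<in># m - {#i#} \<Longrightarrow> val j = 0" and one: "val i = 1"
    and mid: "val 4 = (val 1 + val 2) / 2" "val 5 = (val 2 + val 3) / 2" "val 6 = (val 1 + val 3) / 2"
  shows "val 1 \<ge> 0 \<and> val 2 \<ge> 0 \<and> val 3 \<ge> 0"
proof -
  let ?I = "{1, 2, 3, 4, 5, 6::nat}"
  have "\<forall>(c, m, d)\<in>generators. \<forall>i\<in>?I. count m i > 0 \<longrightarrow>
    (\<forall>j\<in>?I. (if i = j then 1 else 0) < count m j \<longrightarrow> val j = 0) \<longrightarrow> val i = 1 \<longrightarrow>
    val 1 \<ge> 0 \<and> val 2 \<ge> 0 \<and> val 3 \<ge> 0"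
    by (simp add: generators_def knots_6 mid del: One_nat_def)
  moreover have "i \<in> ?I" using i generator_size[OF g] by blast
  moreover have "count m i > 0" using i by simp
  moreover have "\<forall>j\<in>?I. (if i = j then 1 else 0) < count m j \<longrightarrow> val j = 0"
    using zero by (simp add: in_diff_count)
  ultimately show ?thesis using g one by blast
qed

lemma generator_spline:
  assumes nc: "\<not> collinear {v1, v2, v3}" and g: "(c, m, d) \<in> generators"
  defines "T \<equiv> closed_triangle v1 v2 v3"
  shows "continuous_on T (simplex_spline v1 v2 v3 m)"
    and "(\<And>x. x \<in> T \<Longrightarrow> \<beta> + z \<bullet> x > 0) \<Longrightarrow>
      (LINT x:T|lborel. simplex_spline v1 v2 v3 m x / (\<beta> + z \<bullet> x) ^ 8) =
      measure lborel T / 21 * (\<Prod>i\<in>#m. 1 / (\<beta> + z \<bullet> ps_point v1 v2 v3 i))"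
proof -
  let ?P = "ps_point v1 v2 v3"
  let ?K = "image_mset ?P m"
  obtain a b e where K: "{#a, b, e#} \<subseteq># ?K" "\<not> collinear {a, b, e}"
    using generator_knots_triple[OF nc g] by blast
  have size: "size ?K = 8" using generator_size[OF g] by simp
  have facet: "\<beta> + z \<bullet> x \<ge> 0"
    if k: "k \<in># ?K" and zero: "\<And>k'. k' \<in># ?K - {#k#} \<Longrightarrow> \<beta> + z \<bullet> k' = 0"
      and one: "\<beta> + z \<bullet> k = 1" and x: "x \<in> T" for k \<beta> z x
  proof -
    obtain i where i: "i \<in># m" "k = ?P i" using k by auto
    have "image_mset ?P (m - {#i#}) = ?K - {#k#}"
      using i by (subst image_mset_Diff) auto
    then have zero': "\<beta> + z \<bullet> ?P j = 0" if "j \<in># m - {#i#}" for j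
      using zero[of "?P j"] that by (metis image_eqI set_image_mset)
    define val where "val j = \<beta> + z \<bullet> ?P j" for j
    have "val 1 \<ge> 0 \<and> val 2 \<ge> 0 \<and> val 3 \<ge> 0"
    proof (rule generator_facets[OF g i(1)])
      show "val j = 0" if "j \<in># m - {#i#}" for j unfolding val_def by (rule zero'[OF that])
      show "val i = 1" using one i(2) by (simp add: val_def)
      show "val 4 = (val 1 + val 2) / 2" unfolding val_def by (rule affine_ps_point_mid)
      show "val 5 = (val 2 + val 3) / 2" unfolding val_def by (rule affine_ps_point_mid)
      show "val 6 = (val 1 + val 3) / 2" unfolding val_def by (rule affine_ps_point_mid)
    qed
    then have "\<beta> + z \<bullet> v1 \<ge> 0 \<and> \<beta> + z \<bullet> v2 \<ge> 0 \<and> \<beta> + z \<bullet> v3 \<ge> 0"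
      unfolding val_def ps_point_simps(1-3) .
    then show ?thesis
      using affine_nonneg_triangle[of \<beta> z v1 v2 v3 x] x unfolding T_def by blast
  qed
  have cont: "continuous_on T (spline_density ?K)"
    by (rule spline_density_continuous[OF K(1) size K(2)]) (use facet in blast)
  have eq: "simplex_spline v1 v2 v3 m x = measure lborel T / 21 * spline_density ?K x" for x
    unfolding T_def by (rule simplex_spline_eq_density)
  show "continuous_on T (simplex_spline v1 v2 v3 m)"
    unfolding eq[abs_def] by (intro continuous_on_mult_left cont)
  assume pos: "\<And>x. x \<in> T \<Longrightarrow> \<beta> + z \<bullet> x > 0"
  have KT: "set_mset ?K \<subseteq> T"
  proof
    fix y assume "y \<in># ?K"
    then obtain i where i: "i \<in># m" "y = ?P i" by auto
    have "i \<in> {1, 2, 3, 4, 5, 6, 10}" using generator_size[OF g] i(1) by blast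
    then show "y \<in> T" unfolding T_def i(2) by (rule ps_point_mem)
  qed
  have "(LINT x:T|lborel. spline_density ?K x / (\<beta> + z \<bullet> x) ^ 8) = (\<Prod>k\<in>#?K. 1 / (\<beta> + z \<bullet> k))"
    by (rule spline_density_integral[OF K(1) size K(2) _ _ KT cont pos])
      (simp_all add: T_def compact_closed_triangle convex_closed_triangle)
  then show "(LINT x:T|lborel. simplex_spline v1 v2 v3 m x / (\<beta> + z \<bullet> x) ^ 8) =
      measure lborel T / 21 * (\<Prod>i\<in>#m. 1 / (\<beta> + z \<bullet> ps_point v1 v2 v3 i))"
    unfolding eq times_divide_eq_right[symmetric] mult.assoc set_integral_mult_right
    by (simp add: multiset.map_comp comp_def)
qed

text \<open>
  Acting on a label amounts to permuting the corners. This reduces all labels to the eight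
  generators on an arbitrary triangle.
\<close>

lemma ps_point_induced_perm:
  fixes v1 v2 v3 :: "real^2"
  assumes p: "p permutes {1, 2, 3}" and i: "i \<in> {1, 2, 3, 4, 5, 6, 10}"
  defines "w \<equiv> \<lambda>j. ps_point v1 v2 v3 (p j)"
  shows "ps_point v1 v2 v3 (induced_perm p i) = ps_point (w 1) (w 2) (w 3) i"
    and "{w 1, w 2, w 3} = {v1, v2, v3}"
proof -
  have "p \<in> {p. p permutes {1, 2, 3}}" using p by simp
  then have c: "p \<in> {id, t12, t13, t23, t12 \<circ> t23, t13 \<circ> t23}" unfolding permutes_123 .
  show "{w 1, w 2, w 3} = {v1, v2, v3}"
    using c unfolding w_def
    by (elim insertE) (auto simp: Transposition.transpose_def ps_point_simps simp del: One_nat_def)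
  have "\<forall>p\<in>{id, t12, t13, t23, t12 \<circ> t23, t13 \<circ> t23}. \<forall>i\<in>{1, 2, 3, 4, 5, 6, 10}.
    ps_point v1 v2 v3 (induced_perm p i) =
    ps_point (ps_point v1 v2 v3 (p 1)) (ps_point v1 v2 v3 (p 2)) (ps_point v1 v2 v3 (p 3)) i"
    by (simp add: induced_perm_simps ps_point_simps add_ac del: One_nat_def)
  with c i show "ps_point v1 v2 v3 (induced_perm p i) = ps_point (w 1) (w 2) (w 3) i"
    unfolding w_def by blast
qed

section \<open>Taylor polynomials on a convex set\<close>

text \<open>
  At a boundary point of \<open>T\<close> the coordinate directions need not point into \<open>T\<close>. Instead, two
  derivatives agree on all directions that point from \<open>x\<close> to a point of \<open>T\<close>, and those that point to an
  interior ball span the space.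
\<close>

lemma has_derivative_within_unique:
  fixes f :: "'a::euclidean_space \<Rightarrow> 'b::real_normed_vector"
  assumes T: "convex T" "interior T \<noteq> {}" and x: "x \<in> T"
    and D1: "(f has_derivative D1) (at x within T)" and D2: "(f has_derivative D2) (at x within T)"
  shows "D1 = D2"
proof -
  define D where "D h = D1 h - D2 h" for h
  have D: "((\<lambda>x. 0) has_derivative D) (at x within T)"
    using has_derivative_diff[OF D1 D2] unfolding D_def by simp
  have lin: "linear D" using has_derivative_linear[OF D] .
  have zero: "D (y - x) = 0" if y: "y \<in> T" for y
  proof -
    define \<gamma> where "\<gamma> t = x + t *\<^sub>R (y - x)" for t :: real
    have \<gamma>T: "\<gamma> ` {0..1} \<subseteq> T"
    proof
      fix z assume "z \<in> \<gamma> ` {0..1}"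
      then obtain t where t: "0 \<le> t" "t \<le> 1" "z = \<gamma> t" by auto
      then have "z = (1 - t) *\<^sub>R x + t *\<^sub>R y" by (simp add: \<gamma>_def algebra_simps)
      then show "z \<in> T" using T(1) x y t unfolding convex_alt by blast
    qed
    have \<gamma>d: "(\<gamma> has_derivative (\<lambda>s. s *\<^sub>R (y - x))) (at 0 within {0..1})"
      unfolding \<gamma>_def by (auto intro!: derivative_eq_intros)
    have \<gamma>0: "\<gamma> 0 = x" by (simp add: \<gamma>_def)
    have "((\<lambda>x. 0::'b) has_derivative D) (at (\<gamma> 0) within \<gamma> ` {0..1})"
      unfolding \<gamma>0 by (rule has_derivative_subset[OF D \<gamma>T])
    from diff_chain_within[OF \<gamma>d this]
    have "((\<lambda>t. 0::'b) has_derivative (\<lambda>s. D (s *\<^sub>R (y - x)))) (at (0::real) within {0..1})"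
      by (simp add: o_def)
    then have a: "((\<lambda>t. 0::'b) has_vector_derivative D (y - x)) (at (0::real) within {0..1})"
      by (simp add: has_vector_derivative_def linear_cmul[OF lin])
    have b: "((\<lambda>t. 0::'b) has_vector_derivative 0) (at (0::real) within {0..1})" by simp
    show ?thesis
      by (rule vector_derivative_unique_within_closed_interval[of "0::real" 1 0, unfolded cbox_interval, OF _ _ a b]) auto
  qed
  obtain z e where e: "e > 0" "ball z e \<subseteq> T"
    using T(2) by (metis all_not_in_conv mem_interior)
  have "D h = 0" for h
  proof (cases "h = 0")
    case True
    then show ?thesis using lin by (simp add: linear_0)
  next
    case False
    define s where "s = e / (2 * norm h)"
    have s: "s > 0" using e False by (simp add: s_def)
    have "z + s *\<^sub>R h \<in> ball z e" using e False by (simp add: s_def dist_norm)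
    then have "D (z + s *\<^sub>R h - x) = 0" by (intro zero subsetD[OF e(2)])
    moreover have "D (z - x) = 0" using e(1) by (intro zero subsetD[OF e(2)]) simp
    moreover have "D (z + s *\<^sub>R h - x) = D (z - x) + s *\<^sub>R D h"
    proof -
      have "z + s *\<^sub>R h - x = (z - x) + s *\<^sub>R h" by simp
      then show ?thesis by (simp only: linear_add[OF lin] linear_cmul[OF lin])
    qed
    ultimately show ?thesis using s by simp
  qed
  then show ?thesis by (auto simp: D_def fun_eq_iff)
qed

text \<open>
  Linearity in the outermost direction is clear; in the inner ones it is inherited from the linearity of
  differentiation, which within \<open>T\<close> needs the uniqueness of derivatives.
\<close>

lemma iter_deriv_linear:
  fixes f :: "'a::euclidean_space \<Rightarrow> real"
  assumes T: "convex T" "interior T \<noteq> {}" and f: "C_on n T f"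
    and len: "length ws + length us < n" and x: "x \<in> T"
  shows "iter_deriv T (ws @ (a *\<^sub>R u + b *\<^sub>R v) # us) f x =
    a * iter_deriv T (ws @ u # us) f x + b * iter_deriv T (ws @ v # us) f x"
  using len x
proof (induction ws arbitrary: x)
  case Nil
  then have "iter_deriv T us f differentiable (at x within T)"
    using f by (auto simp: C_on_def differentiable_on_def)
  then have lin: "linear (frechet_derivative (iter_deriv T us f) (at x within T))"
    by (rule linear_frechet_derivative)
  show ?case by (simp add: linear_add[OF lin] linear_cmul[OF lin])
next
  case (Cons w ws)
  let ?g = "iter_deriv T (ws @ (a *\<^sub>R u + b *\<^sub>R v) # us) f"
  let ?g1 = "iter_deriv T (ws @ u # us) f" and ?g2 = "iter_deriv T (ws @ v # us) f"
  have diff: "?g1 differentiable (at x within T)" "?g2 differentiable (at x within T)"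
    using f Cons.prems by (auto simp: C_on_def differentiable_on_def)
  have eq: "?g y = a *\<^sub>R ?g1 y + b *\<^sub>R ?g2 y" if "y \<in> T" for y
    using Cons.IH[OF _ that] Cons.prems by simp
  have "((\<lambda>y. a *\<^sub>R ?g1 y + b *\<^sub>R ?g2 y) has_derivative
      (\<lambda>h. a *\<^sub>R frechet_derivative ?g1 (at x within T) h + b *\<^sub>R frechet_derivative ?g2 (at x within T) h)) (at x within T)"
    by (intro has_derivative_add has_derivative_scaleR_right diff[unfolded frechet_derivative_works])
  then have der: "(?g has_derivative
      (\<lambda>h. a *\<^sub>R frechet_derivative ?g1 (at x within T) h + b *\<^sub>R frechet_derivative ?g2 (at x within T) h)) (at x within T)"
    by (rule has_derivative_transform[rotated 2]) (use Cons.prems eq in auto)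
  then have "?g differentiable (at x within T)" by (auto simp: differentiable_def)
  then have "(?g has_derivative frechet_derivative ?g (at x within T)) (at x within T)"
    by (simp only: frechet_derivative_works)
  from has_derivative_within_unique[OF T Cons.prems(2) this der] show ?case by simp
qed

lemma iter_deriv_scale_replicate:
  fixes f :: "'a::euclidean_space \<Rightarrow> real"
  assumes T: "convex T" "interior T \<noteq> {}" and f: "C_on n T f" and x: "x \<in> T"
    and len: "k + length us \<le> n"
  shows "iter_deriv T (replicate k (c *\<^sub>R u) @ us) f x = c ^ k * iter_deriv T (replicate k u @ us) f x"
  using len
proof (induction k arbitrary: us)
  case 0
  then show ?case by simp
next
  case (Suc k)
  have app: "replicate (Suc k) w @ us = replicate k w @ w # us" for w :: 'a
    by (simp add: replicate_app_Cons_same)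
  have "iter_deriv T (replicate (Suc k) (c *\<^sub>R u) @ us) f x = c ^ k * iter_deriv T (replicate k u @ (c *\<^sub>R u) # us) f x"
    unfolding app using Suc by simp
  also have "iter_deriv T (replicate k u @ (c *\<^sub>R u) # us) f x = c * iter_deriv T (replicate k u @ u # us) f x"
    using iter_deriv_linear[OF T f, of "replicate k u" us x c u 0 u] Suc.prems x by simp
  finally show ?case unfolding app by simp
qed

lemma abs_iter_deriv_le:
  fixes f :: "'a::euclidean_space \<Rightarrow> real"
  assumes T: "convex T" "interior T \<noteq> {}" and f: "C_on n T f" and x: "x \<in> T"
    and M: "sup_deriv_norm n T f \<le> ennreal M" "M \<ge> 0"
  shows "\<bar>iter_deriv T (replicate n d) f x\<bar> \<le> norm d ^ n * M"
proof -
  define e where "e = (if d = 0 then 0 else (1 / norm d) *\<^sub>R d)"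
  have e: "d = norm d *\<^sub>R e" "norm e \<le> 1" by (auto simp: e_def)
  have "ennreal \<bar>iter_deriv T (replicate n e) f x\<bar> \<le> deriv_norm n T f x"
    unfolding deriv_norm_def using e by (intro SUP_upper) auto
  also have "\<dots> \<le> sup_deriv_norm n T f"
    unfolding sup_deriv_norm_def using x by (intro SUP_upper)
  also note M(1)
  finally have "\<bar>iter_deriv T (replicate n e) f x\<bar> \<le> M" using M(2) by simp
  moreover have "iter_deriv T (replicate n d) f x = norm d ^ n * iter_deriv T (replicate n e) f x"
    using iter_deriv_scale_replicate[OF T f x, of n "[]" "norm d" e] e(1) by simp
  ultimately show ?thesis by (simp add: abs_mult mult_left_mono)
qed

definition taylor_poly :: "nat \<Rightarrow> 'a::real_normed_vector set \<Rightarrow> ('a \<Rightarrow> real) \<Rightarrow> 'a \<Rightarrow> 'a \<Rightarrow> real" where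
  "taylor_poly n T f x y = (\<Sum>k\<le>n. iter_deriv T (replicate k (y - x)) f x / fact k)"

text \<open>
  The one-dimensional Taylor formula along the segment from \<open>x\<close> to \<open>y\<close>.
\<close>

lemma taylor_poly_error:
  fixes f :: "'a::euclidean_space \<Rightarrow> real"
  assumes T: "convex T" "interior T \<noteq> {}" and f: "C_on (Suc n) T f" and x: "x \<in> T" and y: "y \<in> T"
    and M: "sup_deriv_norm (Suc n) T f \<le> ennreal M" "M \<ge> 0"
  shows "\<bar>f y - taylor_poly n T f x y\<bar> \<le> norm (y - x) ^ Suc n * M / fact n"
proof -
  define d where "d = y - x"
  define \<gamma> where "\<gamma> t = x + t *\<^sub>R d" for t :: real
  define \<phi> where "\<phi> k t = iter_deriv T (replicate k d) f (\<gamma> t)" for k t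
  have \<gamma>T: "\<gamma> t \<in> T" if "t \<in> {0..1}" for t
  proof -
    have "\<gamma> t = (1 - t) *\<^sub>R x + t *\<^sub>R y" by (simp add: \<gamma>_def d_def algebra_simps)
    then show ?thesis using T(1) x y that unfolding convex_alt by auto
  qed
  have der: "(\<phi> k has_field_derivative \<phi> (Suc k) t) (at t within {0..1})"
    if t: "t \<in> {0..1}" and k: "k \<le> n" for k t
  proof -
    have "iter_deriv T (replicate k d) f differentiable (at (\<gamma> t) within T)"
      using f k \<gamma>T[OF t] by (auto simp: C_on_def differentiable_on_def)
    then have D: "(iter_deriv T (replicate k d) f has_derivative
        frechet_derivative (iter_deriv T (replicate k d) f) (at (\<gamma> t) within T)) (at (\<gamma> t) within T)"
      (is "(?g has_derivative ?D) _") by (simp only: frechet_derivative_works)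
    have \<gamma>d: "(\<gamma> has_derivative (\<lambda>s. s *\<^sub>R d)) (at t within {0..1})"
      unfolding \<gamma>_def by (auto intro!: derivative_eq_intros)
    have "(?g has_derivative ?D) (at (\<gamma> t) within \<gamma> ` {0..1})"
      by (rule has_derivative_subset[OF D]) (use \<gamma>T in auto)
    from diff_chain_within[OF \<gamma>d this]
    have "(\<phi> k has_derivative (\<lambda>s. ?D (s *\<^sub>R d))) (at t within {0..1})"
      by (simp add: o_def \<phi>_def[abs_def])
    moreover have "?D (s *\<^sub>R d) = \<phi> (Suc k) t * s" for s
      using linear_cmul[OF has_derivative_linear[OF D]] by (simp add: \<phi>_def)
    ultimately show ?thesis by (simp add: has_field_derivative_def)
  qed
  have "norm (\<phi> 0 1 - (\<Sum>k\<le>n. \<phi> k 0 * (1 - 0) ^ k / fact k)) \<le> (norm d ^ Suc n * M) * norm (1 - 0 :: real) ^ Suc n / fact n"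
  proof (rule field_Taylor[of "{0..1}"])
    show "(\<phi> k has_field_derivative \<phi> (Suc k) t) (at t within {0..1})" if "t \<in> {0..1}" "k \<le> n" for k t
      by (rule der[OF that])
    show "norm (\<phi> (Suc n) t) \<le> norm d ^ Suc n * M" if "t \<in> {0..1}" for t
      using abs_iter_deriv_le[OF T f \<gamma>T[OF that] M, of d] by (simp only: \<phi>_def real_norm_def)
  qed auto
  then show ?thesis by (simp add: \<phi>_def \<gamma>_def d_def taylor_poly_def)
qed

text \<open>
  Polynomials of degree at most \<open>n\<close>, as sums of products of \<open>n\<close> affine functions. Unlike coefficient
  arrays, this form is what polarization needs, and it is read off directly from iterated
  derivatives.
\<close>

inductive affine_product :: "nat \<Rightarrow> ('a::real_inner \<Rightarrow> real) \<Rightarrow> bool" where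
  affine_product_const: "affine_product 0 (\<lambda>x. c)"
| affine_product_mult: "affine_product n f \<Longrightarrow> affine_product (Suc n) (\<lambda>x. (\<beta> + z \<bullet> x) * f x)"
| affine_product_add: "affine_product n f \<Longrightarrow> affine_product n g \<Longrightarrow> affine_product n (\<lambda>x. f x + g x)"

lemma affine_product_scale: "affine_product n f \<Longrightarrow> affine_product n (\<lambda>x. c * f x)"
proof (induction rule: affine_product.induct)
  case (affine_product_const c')
  show ?case by (rule affine_product.affine_product_const)
next
  case (affine_product_mult n f \<beta> z)
  have "(\<lambda>x. c * ((\<beta> + z \<bullet> x) * f x)) = (\<lambda>x. (\<beta> + z \<bullet> x) * (c * f x))" by (simp add: fun_eq_iff)
  then show ?case using affine_product.affine_product_mult[OF affine_product_mult.IH] by simp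
next
  case (affine_product_add n f g)
  show ?case
    unfolding distrib_left by (rule affine_product.affine_product_add[OF affine_product_add.IH])
qed

lemma affine_product_Suc: "affine_product n f \<Longrightarrow> affine_product (Suc n) f"
  using affine_product_mult[of n f 1 0] by simp

lemma affine_product_mono: "affine_product m f \<Longrightarrow> m \<le> n \<Longrightarrow> affine_product n f"
  by (rule dec_induct[of m n "\<lambda>k. affine_product k f"]) (auto intro: affine_product_Suc)

lemma affine_product_sum:
  assumes "\<And>i. i \<in> I \<Longrightarrow> affine_product n (f i)"
  shows "affine_product n (\<lambda>x. \<Sum>i\<in>I. f i x)"
proof -
  have zero: "affine_product n (\<lambda>x. 0)"
    by (rule affine_product_mono[OF affine_product_const]) simp
  show ?thesis using assms
    by (induction I rule: infinite_finite_induct) (auto intro: zero affine_product_add)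
qed

lemma affine_product_monomial:
  "affine_product (a + b) (\<lambda>x::real^2. c * (x $ 1) ^ a * (x $ 2) ^ b)"
proof -
  have p2: "affine_product b (\<lambda>x::real^2. (x $ 2) ^ b)" for b
  proof (induction b)
    case 0
    then show ?case using affine_product_const[of 1] by simp
  next
    case (Suc b)
    from affine_product_mult[OF this, of 0 "axis 2 1"] show ?case by (simp add: inner_axis')
  qed
  have "affine_product (a + b) (\<lambda>x::real^2. (x $ 1) ^ a * (x $ 2) ^ b)"
  proof (induction a)
    case 0
    then show ?case using p2 by simp
  next
    case (Suc a)
    from affine_product_mult[OF this, of 0 "axis 1 1"] show ?case by (simp add: inner_axis' mult.assoc)
  qed
  from affine_product_scale[OF this, of c] show ?thesis by (simp add: mult.assoc)
qed

lemma bivariate_poly_affine_product: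
  assumes "bivariate_poly n f" shows "affine_product n f"
proof -
  obtain c where "\<And>x. f x = (\<Sum>a\<le>n. \<Sum>b\<le>n - a. c a b * (x $ 1) ^ a * (x $ 2) ^ b)"
    using assms unfolding bivariate_poly_def by blast
  then have f: "f = (\<lambda>x. \<Sum>a\<le>n. \<Sum>b\<le>n - a. c a b * (x $ 1) ^ a * (x $ 2) ^ b)" by (rule ext)
  show ?thesis unfolding f
    by (intro affine_product_sum affine_product_mono[OF affine_product_monomial]) auto
qed

text \<open>
  Split one direction \<open>y - x\<close> at a time into its coordinates; each of them is an affine function of \<open>y\<close>.
\<close>

lemma iter_deriv_affine_product:
  fixes f :: "real^2 \<Rightarrow> real"
  assumes T: "convex T" "interior T \<noteq> {}" and f: "C_on n T f" and x: "x \<in> T"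
    and len: "k + length us \<le> n"
  shows "affine_product k (\<lambda>y. iter_deriv T (replicate k (y - x) @ us) f x)"
  using len
proof (induction k arbitrary: us)
  case 0
  then show ?case by (simp add: affine_product_const)
next
  case (Suc k)
  have d: "y - x = (- (x $ 1) + axis 1 1 \<bullet> y) *\<^sub>R axis 1 1 + (- (x $ 2) + axis 2 1 \<bullet> y) *\<^sub>R axis 2 1" for y :: "real^2"
    by (simp add: vec_eq_iff forall_2 inner_axis') (simp add: axis_def)
  have "iter_deriv T (replicate (Suc k) (y - x) @ us) f x =
      (- (x $ 1) + axis 1 1 \<bullet> y) * iter_deriv T (replicate k (y - x) @ axis 1 1 # us) f x +
      (- (x $ 2) + axis 2 1 \<bullet> y) * iter_deriv T (replicate k (y - x) @ axis 2 1 # us) f x" for y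
  proof -
    have eq: "replicate (Suc k) (y - x) @ us = replicate k (y - x) @
      ((- (x $ 1) + axis 1 1 \<bullet> y) *\<^sub>R axis 1 1 + (- (x $ 2) + axis 2 1 \<bullet> y) *\<^sub>R axis 2 1) # us"
      unfolding d[symmetric] by (simp add: replicate_app_Cons_same)
    show ?thesis
      unfolding eq by (rule iter_deriv_linear[OF T f _ x]) (use Suc.prems in simp)
  qed
  moreover have "affine_product (Suc k) (\<lambda>y.
      (- (x $ 1) + axis 1 1 \<bullet> y) * iter_deriv T (replicate k (y - x) @ axis 1 1 # us) f x +
      (- (x $ 2) + axis 2 1 \<bullet> y) * iter_deriv T (replicate k (y - x) @ axis 2 1 # us) f x)"
    using Suc.prems by (intro affine_product_add affine_product_mult Suc.IH) auto
  ultimately show ?case by simp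
qed

lemma taylor_poly_affine_product:
  fixes f :: "real^2 \<Rightarrow> real"
  assumes "convex T" "interior T \<noteq> {}" "C_on n T f" "x \<in> T"
  shows "affine_product n (taylor_poly n T f x)"
proof -
  have "affine_product n (\<lambda>y. (1 / fact k) * iter_deriv T (replicate k (y - x) @ []) f x)" if "k \<le> n" for k
  proof -
    have "affine_product k (\<lambda>y. iter_deriv T (replicate k (y - x) @ []) f x)"
      by (rule iter_deriv_affine_product[OF assms]) (use that in simp)
    from affine_product_scale[OF affine_product_mono[OF this that]] show ?thesis .
  qed
  then have "affine_product n (\<lambda>y. \<Sum>k\<in>{..n}. (1 / fact k) * iter_deriv T (replicate k (y - x) @ []) f x)"
    by (intro affine_product_sum) simp
  then show ?thesis by (simp add: taylor_poly_def[abs_def])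
qed

section \<open>Reproduction of quintics\<close>

lemma basis_label_spline:
  assumes nc: "\<not> collinear {v1, v2, v3}" and j: "(c, m, d) \<in> basis_labels"
  defines "T \<equiv> closed_triangle v1 v2 v3"
  shows "continuous_on T (basis_fun v1 v2 v3 (c, m, d))"
    and "basis_fun v1 v2 v3 (c, m, d) x \<ge> 0"
    and "(\<And>x. x \<in> T \<Longrightarrow> \<beta> + z \<bullet> x > 0) \<Longrightarrow>
      (LINT x:T|lborel. basis_fun v1 v2 v3 (c, m, d) x / (\<beta> + z \<bullet> x) ^ 8) =
      measure lborel T / 21 * (c * (\<Prod>i\<in>#m. 1 / (\<beta> + z \<bullet> ps_point v1 v2 v3 i)))"
    and "size d = 5"
proof -
  obtain p g where p: "p permutes {1, 2, 3}" and g: "g \<in> generators" "(c, m, d) = act p g"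
    using j unfolding basis_labels_def by blast
  obtain c' m' d' where g': "g = (c', m', d')" by (metis prod_cases3)
  with g have gen: "(c, m', d') \<in> generators"
    and m: "m = image_mset (induced_perm p) m'" and d: "d = image_mset (induced_perm p) d'"
    by (simp_all add: act_def)
  let ?P = "ps_point v1 v2 v3"
  define w1 where "w1 = ?P (p 1)"
  define w2 where "w2 = ?P (p 2)"
  define w3 where "w3 = ?P (p 3)"
  note w = w1_def w2_def w3_def
  have pt: "?P (induced_perm p i) = ps_point w1 w2 w3 i" if "i \<in> {1, 2, 3, 4, 5, 6, 10}" for i
    unfolding w by (rule ps_point_induced_perm(1)[OF p that])
  have corners: "{w1, w2, w3} = {v1, v2, v3}"
    unfolding w by (rule ps_point_induced_perm(2)[OF p, of 1]) simp
  then have ncw: "\<not> collinear {w1, w2, w3}" using nc by simp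
  have tri: "closed_triangle w1 w2 w3 = T" by (simp add: T_def closed_triangle_def corners)
  have sz: "size m' = 8 \<and> size d' = 5 \<and> c \<ge> 0 \<and> set_mset m' \<subseteq> {1, 2, 3, 4, 5, 6} \<and> set_mset d' \<subseteq> {1, 2, 3, 4, 5, 6, 10}"
    by (rule generator_size[OF gen])
  have pm: "?P (induced_perm p i) = ps_point w1 w2 w3 i" if "i \<in># m'" for i
  proof (rule pt)
    show "i \<in> {1, 2, 3, 4, 5, 6, 10}" using that sz by blast
  qed
  have K: "image_mset ?P m = image_mset (ps_point w1 w2 w3) m'"
    unfolding m by (simp add: multiset.map_comp comp_def pm cong: image_mset_cong)
  have spl: "simplex_spline v1 v2 v3 m = simplex_spline w1 w2 w3 m'"
    by (simp add: fun_eq_iff simplex_spline_eq_density K tri T_def[symmetric])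
  have bf: "basis_fun v1 v2 v3 (c, m, d) x = c * simplex_spline w1 w2 w3 m' x" for x
    by (simp add: basis_fun_def spl)
  show "continuous_on T (basis_fun v1 v2 v3 (c, m, d))"
    unfolding bf[abs_def]
    using generator_spline(1)[OF ncw gen] unfolding tri by (intro continuous_on_mult_left)
  show "basis_fun v1 v2 v3 (c, m, d) x \<ge> 0"
    unfolding bf simplex_spline_eq_density using sz by (simp add: spline_density_nonneg)
  show "size d = 5" using sz by (simp add: d)
  assume pos: "\<And>x. x \<in> T \<Longrightarrow> \<beta> + z \<bullet> x > 0"
  have "(LINT x:T|lborel. simplex_spline w1 w2 w3 m' x / (\<beta> + z \<bullet> x) ^ 8) =
      measure lborel T / 21 * (\<Prod>i\<in>#m'. 1 / (\<beta> + z \<bullet> ps_point w1 w2 w3 i))"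
    using generator_spline(2)[OF ncw gen, of \<beta> z] pos unfolding tri by blast
  moreover have "(\<Prod>i\<in>#m'. 1 / (\<beta> + z \<bullet> ps_point w1 w2 w3 i)) = (\<Prod>i\<in>#m. 1 / (\<beta> + z \<bullet> ?P i))"
    unfolding m by (simp add: multiset.map_comp comp_def pm cong: image_mset_cong)
  ultimately show "(LINT x:T|lborel. basis_fun v1 v2 v3 (c, m, d) x / (\<beta> + z \<bullet> x) ^ 8) =
      measure lborel T / 21 * (c * (\<Prod>i\<in>#m. 1 / (\<beta> + z \<bullet> ?P i)))"
    unfolding bf times_divide_eq_right[symmetric] set_integral_mult_right by (simp add: mult_ac)
qed

lemma dual_functional_quintic:
  assumes d: "size d = 5"
  shows "dual_functional v1 v2 v3 (c, m, d) (\<lambda>x. (\<gamma> + w \<bullet> x) ^ 5) = (\<Prod>i\<in>#d. \<gamma> + w \<bullet> ps_point v1 v2 v3 i)"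
proof -
  let ?l = "sorted_list_of_multiset d"
  define q where "q r = \<gamma> + w \<bullet> dual_point v1 v2 v3 (c, m, d) r" for r
  have avg: "\<gamma> + w \<bullet> ((1 / real k) *\<^sub>R (\<Sum>r\<in>R. dual_point v1 v2 v3 (c, m, d) r)) = (1 / real k) * (\<Sum>r\<in>R. q r)"
    if "card R = k" "k \<ge> 1" for R k
    using that by (simp add: q_def sum.distrib inner_sum_right field_simps)
  have "dual_functional v1 v2 v3 (c, m, d) (\<lambda>x. (\<gamma> + w \<bullet> x) ^ 5) =
    (\<Sum>k = 1..5. 1 / fact 5 * real k ^ 5 * (-1) ^ (k - 1) *
      (\<Sum>R\<in>{R. R \<subseteq> {1..5} \<and> card R = k}. ((1 / real k) * (\<Sum>r\<in>R. q r)) ^ 5))"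
    unfolding dual_functional_def using avg by (intro sum.cong refl arg_cong2[where f = "(*)"]) auto
  also have "\<dots> = (\<Prod>r = 1..5. q r)" by (rule quintic_polarization_sum)
  also have "\<dots> = (\<Prod>i\<in>#d. \<gamma> + w \<bullet> ps_point v1 v2 v3 i)"
  proof -
    have "length ?l = 5" using d by (metis mset_sorted_list_of_multiset size_mset)
    then obtain a b c' d' e where l: "?l = [a, b, c', d', e]"
      by (auto simp: length_Suc_conv numeral_eq_Suc)
    have "d = mset [a, b, c', d', e]" unfolding l[symmetric] by simp
    then have D: "d = {#a, b, c', d', e#}" by simp
    have "{1..5::nat} = {1, 2, 3, 4, 5}" by auto
    then show ?thesis by (simp add: q_def dual_point_def l) (simp add: D mult.assoc)
  qed
  finally show ?thesis .
qed

lemma quasi_interpolant_add: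
  "quasi_interpolant v1 v2 v3 (\<lambda>x. f x + g x) y = quasi_interpolant v1 v2 v3 f y + quasi_interpolant v1 v2 v3 g y"
  by (simp add: quasi_interpolant_def dual_functional_def sum.distrib distrib_left)

lemma quasi_interpolant_scale:
  "quasi_interpolant v1 v2 v3 (\<lambda>x. c * f x) y = c * quasi_interpolant v1 v2 v3 f y"
  by (simp add: quasi_interpolant_def dual_functional_def sum_distrib_left mult_ac)

text \<open>
  The difference \<open>G\<close> of the two sides is continuous, and its integral against every \<open>l\<^sup>-\<^sup>8\<close> vanishes by
  \<open>marsden_label_sum\<close>.
\<close>

lemma quasi_interpolant_quintic:
  assumes nc: "\<not> collinear {v1, v2, v3}" and x: "x \<in> closed_triangle v1 v2 v3"
  shows "quasi_interpolant v1 v2 v3 (\<lambda>x. (\<gamma> + w \<bullet> x) ^ 5) x = (\<gamma> + w \<bullet> x) ^ 5"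
proof -
  let ?T = "closed_triangle v1 v2 v3" and ?B = "basis_fun v1 v2 v3" and ?P = "ps_point v1 v2 v3"
  define lam where "lam j = dual_functional v1 v2 v3 j (\<lambda>x. (\<gamma> + w \<bullet> x) ^ 5)" for j
  define G where "G x = (\<gamma> + w \<bullet> x) ^ 5 - (\<Sum>j\<in>basis_labels. lam j * ?B j x)" for x
  have cont: "continuous_on ?T (?B j)" if "j \<in> basis_labels" for j
    using basis_label_spline(1)[OF nc] that by (cases j rule: prod_cases3) simp
  have lam: "lam (c, m, d) = (\<Prod>i\<in>#d. \<gamma> + w \<bullet> ?P i)" if "(c, m, d) \<in> basis_labels" for c m d
    unfolding lam_def by (rule dual_functional_quintic[OF basis_label_spline(4)[OF nc that]])
  have "G x = 0"
  proof (rule rational_moments_determine[where m = 8 and T = ?T])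
    show "continuous_on ?T G"
      unfolding G_def by (intro continuous_intros cont)
    fix \<beta> z assume pos: "\<And>x. x \<in> ?T \<Longrightarrow> \<beta> + z \<bullet> x > 0"
    have v: "v1 \<in> ?T" "v2 \<in> ?T" "v3 \<in> ?T" by (auto simp: closed_triangle_def hull_inc)
    define L where "L i = \<beta> + z \<bullet> ?P i" for i
    define q where "q i = \<gamma> + w \<bullet> ?P i" for i
    have int: "set_integrable lborel ?T f" if "continuous_on ?T f" for f :: "real^2 \<Rightarrow> real"
      unfolding set_integrable_def by (rule borel_integrable_compact[OF compact_closed_triangle that])
    have Bc: "continuous_on ?T (\<lambda>x. ?B j x / (\<beta> + z \<bullet> x) ^ 8)" if "j \<in> basis_labels" for j
      by (intro continuous_intros cont that) (use pos in force)
    have qc: "continuous_on ?T (\<lambda>x. (\<gamma> + w \<bullet> x) ^ 5 / (\<beta> + z \<bullet> x) ^ 8)"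
      by (intro continuous_intros) (use pos in force)
    have sumc: "continuous_on ?T (\<lambda>x. \<Sum>j\<in>basis_labels. lam j * (?B j x / (\<beta> + z \<bullet> x) ^ 8))"
      by (intro continuous_intros continuous_on_mult_left Bc)
    have G_eq: "G x / (\<beta> + z \<bullet> x) ^ 8 = (\<gamma> + w \<bullet> x) ^ 5 / (\<beta> + z \<bullet> x) ^ 8
        - (\<Sum>j\<in>basis_labels. lam j * (?B j x / (\<beta> + z \<bullet> x) ^ 8))" for x
      by (simp add: G_def diff_divide_distrib sum_divide_distrib)
    have label: "(LINT x:?T|lborel. lam j * (?B j x / (\<beta> + z \<bullet> x) ^ 8)) =
        measure lborel ?T / 21 * label_weight (\<lambda>i. 1 / L i) q j" if j: "j \<in> basis_labels" for j
    proof (cases j rule: prod_cases3)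
      case (fields c m d)
      with j have j': "(c, m, d) \<in> basis_labels" by simp
      have B: "(LINT x:?T|lborel. ?B (c, m, d) x / (\<beta> + z \<bullet> x) ^ 8) =
          measure lborel ?T / 21 * (c * (\<Prod>i\<in>#m. 1 / (\<beta> + z \<bullet> ?P i)))"
        using basis_label_spline(3)[OF nc j', of \<beta> z] pos by blast
      show ?thesis
        unfolding fields set_integral_mult_right B lam[OF j'] label_weight_def L_def q_def prod.case
        by (simp only: mult_ac)
    qed
    have "(LINT x:?T|lborel. (\<Sum>j\<in>basis_labels. lam j * (?B j x / (\<beta> + z \<bullet> x) ^ 8))) =
        (\<Sum>j\<in>basis_labels. LINT x:?T|lborel. lam j * (?B j x / (\<beta> + z \<bullet> x) ^ 8))"
      unfolding set_lebesgue_integral_def scaleR_sum_right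
      by (rule Bochner_Integration.integral_sum)
        (use int[OF continuous_on_mult_left[OF Bc]] in \<open>simp add: set_integrable_def\<close>)
    also have "\<dots> = measure lborel ?T / 21 * (\<Sum>j\<in>basis_labels. label_weight (\<lambda>i. 1 / L i) q j)"
      unfolding sum_distrib_left by (intro sum.cong refl label)
    also have "(\<Sum>j\<in>basis_labels. label_weight (\<lambda>i. 1 / L i) q j) =
      (\<Sum>(i, j, k)\<leftarrow>quintic_exponents. (q 1 ^ i * q 2 ^ j * q 3 ^ k) /
        (L 1 ^ (i + 1) * L 2 ^ (j + 1) * L 3 ^ (k + 1)))"
    proof (rule marsden_label_sum)
      show "L 1 > 0" "L 2 > 0" "L 3 > 0" by (simp_all only: L_def ps_point_simps pos v)
      show "L 4 = (L 1 + L 2) / 2" "L 5 = (L 2 + L 3) / 2" "L 6 = (L 1 + L 3) / 2"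
        by (simp_all only: L_def affine_ps_point_mid)
      show "q 4 = (q 1 + q 2) / 2" "q 5 = (q 2 + q 3) / 2" "q 6 = (q 1 + q 3) / 2" "q 10 = (q 1 + q 2 + q 3) / 3"
        by (simp_all only: q_def affine_ps_point_mid)
    qed
    also have "measure lborel ?T / 21 * \<dots> = (LINT x:?T|lborel. (\<gamma> + w \<bullet> x) ^ 5 / (\<beta> + z \<bullet> x) ^ 8)"
      using triangle_integral_quintic[OF nc pos[OF v(1)] pos[OF v(2)] pos[OF v(3)], of \<gamma> w]
      by (simp only: L_def q_def ps_point_simps)
    finally have total: "(LINT x:?T|lborel. (\<Sum>j\<in>basis_labels. lam j * (?B j x / (\<beta> + z \<bullet> x) ^ 8))) =
        (LINT x:?T|lborel. (\<gamma> + w \<bullet> x) ^ 5 / (\<beta> + z \<bullet> x) ^ 8)" .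
    show "(LINT x:?T|lborel. G x / (\<beta> + z \<bullet> x) ^ 8) = 0"
      unfolding G_eq set_integral_diff(2)[OF int[OF qc] int[OF sumc]] total by simp
  qed (use x in \<open>simp_all add: compact_closed_triangle closure_interior_closed_triangle[OF nc]\<close>)
  then show ?thesis
    by (simp add: G_def quasi_interpolant_def lam_def mult.commute)
qed

text \<open>
  A constant times a product of five affine functions is a combination of fifth powers by polarization.
  The induction peels the factors off \<open>f\<close> and collects them in \<open>qs\<close>.
\<close>

lemma affine_product_span_quintics:
  assumes add: "\<And>f g. P f \<Longrightarrow> P g \<Longrightarrow> P (\<lambda>x. f x + g x)"
    and scale: "\<And>c f. P f \<Longrightarrow> P (\<lambda>x. c * f x)"
    and quintic: "\<And>\<gamma> w. P (\<lambda>x::'a::real_inner. (\<gamma> + w \<bullet> x) ^ 5 :: real)"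
    and f: "affine_product n f" and len: "length qs + n = 5"
  shows "P (\<lambda>x. (\<Prod>(\<gamma>, w)\<leftarrow>qs. \<gamma> + w \<bullet> x) * f x)"
  using f len
proof (induction arbitrary: qs rule: affine_product.induct)
  case (affine_product_const c)
  have zero: "P (\<lambda>x. 0)" using scale[OF quintic, of 0] by simp
  have sumA: "P (\<lambda>x. \<Sum>i\<in>I. h i x)" if "\<And>i. i \<in> I \<Longrightarrow> P (h i)" for I :: "nat set" and h
    using that by (induction I rule: infinite_finite_induct) (auto intro: zero add)
  have sumB: "P (\<lambda>x. \<Sum>i\<in>I. h i x)" if "\<And>i. i \<in> I \<Longrightarrow> P (h i)" for I :: "nat set set" and h
    using that by (induction I rule: infinite_finite_induct) (auto intro: zero add)
  from affine_product_const have len: "length qs = 5" by simp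
  define a where "a r = fst (qs ! (r - 1))" for r
  define b where "b r = snd (qs ! (r - 1))" for r
  have prod: "(\<Prod>(\<gamma>, w)\<leftarrow>qs. \<gamma> + w \<bullet> x) = (\<Prod>r = 1..5. a r + b r \<bullet> x)" for x
  proof -
    from len obtain q1 q2 q3 q4 q5 where q: "qs = [q1, q2, q3, q4, q5]"
      by (auto simp: length_Suc_conv numeral_eq_Suc)
    have "{1..5::nat} = {1, 2, 3, 4, 5}" by auto
    then show ?thesis by (simp add: q a_def b_def case_prod_beta)
  qed
  have avg: "(1 / real k) * (\<Sum>r\<in>R. a r + b r \<bullet> x) =
      (1 / real k) * (\<Sum>r\<in>R. a r) + ((1 / real k) *\<^sub>R (\<Sum>r\<in>R. b r)) \<bullet> x" for k R x
    by (simp add: sum.distrib inner_sum_left distrib_left)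
  have "P (\<lambda>x. c * (\<Sum>k = 1..5. 1 / fact 5 * real k ^ 5 * (-1) ^ (k - 1) *
      (\<Sum>R\<in>{R. R \<subseteq> {1..5} \<and> card R = k}. ((1 / real k) * (\<Sum>r\<in>R. a r + b r \<bullet> x)) ^ 5)))"
    unfolding avg by (intro scale sumA sumB quintic)
  then show ?case
    unfolding prod quintic_polarization_sum by (simp add: mult.commute)
next
  case (affine_product_mult n f \<beta> z)
  have "P (\<lambda>x. (\<Prod>(\<gamma>, w)\<leftarrow>(\<beta>, z) # qs. \<gamma> + w \<bullet> x) * f x)"
    by (rule affine_product_mult.IH) (use affine_product_mult.prems in simp)
  then show ?case by (simp add: mult_ac)
next
  case (affine_product_add n f g)
  then show ?case unfolding distrib_left by (intro add) auto
qed

lemma quasi_interpolant_affine_product: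
  assumes nc: "\<not> collinear {v1, v2, v3}" and f: "affine_product 5 f" and x: "x \<in> closed_triangle v1 v2 v3"
  shows "quasi_interpolant v1 v2 v3 f x = f x"
  using affine_product_span_quintics[where P = "\<lambda>f. quasi_interpolant v1 v2 v3 f x = f x" and qs = "[]", OF _ _ _ f]
    quasi_interpolant_quintic[OF nc x]
  by (simp add: quasi_interpolant_add quasi_interpolant_scale)

section \<open>The error estimate\<close>

text \<open>
  The sum of the absolute values of the weights of a dual functional, which is the same for all labels.
\<close>

definition dual_bound :: real where
  "dual_bound = (\<Sum>k = 1..5. 1 / fact 5 * real k ^ 5 * real (card {R. R \<subseteq> {1..5::nat} \<and> card R = k}))"

lemma dual_functional_bound:
  assumes j: "(c, m, d) \<in> basis_labels" and d: "size d = 5"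
    and g: "\<And>y. y \<in> closed_triangle v1 v2 v3 \<Longrightarrow> \<bar>g y\<bar> \<le> E"
  shows "\<bar>dual_functional v1 v2 v3 (c, m, d) g\<bar> \<le> dual_bound * E"
proof -
  let ?T = "closed_triangle v1 v2 v3" and ?p = "dual_point v1 v2 v3 (c, m, d)"
  have len: "length (sorted_list_of_multiset d) = 5" using d by (metis mset_sorted_list_of_multiset size_mset)
  have pT: "?p r \<in> ?T" if "r \<in> {1..5}" for r
  proof -
    have "sorted_list_of_multiset d ! (r - 1) \<in> set (sorted_list_of_multiset d)"
      using that len by (intro nth_mem) auto
    then have "sorted_list_of_multiset d ! (r - 1) \<in># d" by simp
    then have "sorted_list_of_multiset d ! (r - 1) \<in> {1, 2, 3, 4, 5, 6, 10}"
      using basis_labels_indices[OF j] by blast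
    then show ?thesis unfolding dual_point_def prod.case by (rule ps_point_mem)
  qed
  have avg: "(1 / real k) *\<^sub>R (\<Sum>r\<in>R. ?p r) \<in> ?T" if R: "R \<subseteq> {1..5}" "card R = k" "k \<ge> 1" for R k
  proof -
    have "finite R" using R(1) finite_subset by blast
    then have "(\<Sum>r\<in>R. (1 / real k) *\<^sub>R ?p r) \<in> ?T"
      using R pT by (intro convex_sum convex_closed_triangle) auto
    then show ?thesis by (simp add: scaleR_sum_right)
  qed
  have "\<bar>dual_functional v1 v2 v3 (c, m, d) g\<bar> \<le>
    (\<Sum>k = 1..5. \<bar>1 / fact 5 * real k ^ 5 * (-1) ^ (k - 1) *
      (\<Sum>R\<in>{R. R \<subseteq> {1..5} \<and> card R = k}. g ((1 / real k) *\<^sub>R (\<Sum>r\<in>R. ?p r)))\<bar>)"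
    unfolding dual_functional_def by (rule sum_abs)
  also have "\<dots> \<le> (\<Sum>k = 1..5. 1 / fact 5 * real k ^ 5 * (real (card {R. R \<subseteq> {1..5::nat} \<and> card R = k}) * E))"
  proof (rule sum_mono)
    fix k :: nat assume k: "k \<in> {1..5}"
    let ?R = "{R. R \<subseteq> {1..5::nat} \<and> card R = k}"
    have "\<bar>\<Sum>R\<in>?R. g ((1 / real k) *\<^sub>R (\<Sum>r\<in>R. ?p r))\<bar> \<le> (\<Sum>R\<in>?R. \<bar>g ((1 / real k) *\<^sub>R (\<Sum>r\<in>R. ?p r))\<bar>)"
      by (rule sum_abs)
    also have "\<dots> \<le> (\<Sum>R\<in>?R. E)"
      using k by (intro sum_mono g avg) auto
    finally have *: "\<bar>\<Sum>R\<in>?R. g ((1 / real k) *\<^sub>R (\<Sum>r\<in>R. ?p r))\<bar> \<le> real (card ?R) * E" by simp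
    show "\<bar>1 / fact 5 * real k ^ 5 * (-1) ^ (k - 1) * (\<Sum>R\<in>?R. g ((1 / real k) *\<^sub>R (\<Sum>r\<in>R. ?p r)))\<bar>
      \<le> 1 / fact 5 * real k ^ 5 * (real (card ?R) * E)"
      using mult_left_mono[OF *, of "1 / fact 5 * real k ^ 5"] by (simp add: abs_mult)
  qed
  also have "\<dots> = dual_bound * E" by (simp add: dual_bound_def sum_distrib_right mult.assoc)
  finally show ?thesis .
qed

lemma dual_bound_nonneg: "dual_bound \<ge> 0"
  unfolding dual_bound_def by (intro sum_nonneg mult_nonneg_nonneg) auto

text \<open>
  The basis functions are nonnegative and sum to 1, the latter being the case \<open>q = 1\<close> of the
  reproduction of quintics.
\<close>

lemma quasi_interpolant_bound:
  assumes nc: "\<not> collinear {v1, v2, v3}" and x: "x \<in> closed_triangle v1 v2 v3"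
    and g: "\<And>y. y \<in> closed_triangle v1 v2 v3 \<Longrightarrow> \<bar>g y\<bar> \<le> E"
  shows "\<bar>quasi_interpolant v1 v2 v3 g x\<bar> \<le> dual_bound * E"
proof -
  let ?B = "basis_fun v1 v2 v3"
  have nonneg: "?B j x \<ge> 0" if "j \<in> basis_labels" for j
    using basis_label_spline(2)[OF nc] that by (cases j rule: prod_cases3) simp
  have one: "dual_functional v1 v2 v3 j (\<lambda>x. 1) = 1" if "j \<in> basis_labels" for j
  proof (cases j rule: prod_cases3)
    case (fields c m d)
    then have "size d = 5" using basis_label_spline(4)[OF nc] that by simp
    from dual_functional_quintic[OF this, of v1 v2 v3 c m 1 0] show ?thesis by (simp add: fields)
  qed
  have "quasi_interpolant v1 v2 v3 (\<lambda>x. 1) x = 1"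
    using quasi_interpolant_quintic[OF nc x, of 1 0] by simp
  then have unity: "(\<Sum>j\<in>basis_labels. ?B j x) = 1"
    by (simp add: quasi_interpolant_def one)
  have dual: "\<bar>dual_functional v1 v2 v3 j g\<bar> \<le> dual_bound * E" if "j \<in> basis_labels" for j
  proof (cases j rule: prod_cases3)
    case (fields c m d)
    with that have j: "(c, m, d) \<in> basis_labels" by simp
    show ?thesis unfolding fields
      by (rule dual_functional_bound[OF j basis_label_spline(4)[OF nc j] g])
  qed
  have "\<bar>quasi_interpolant v1 v2 v3 g x\<bar> \<le> (\<Sum>j\<in>basis_labels. \<bar>?B j x * dual_functional v1 v2 v3 j g\<bar>)"
    unfolding quasi_interpolant_def by (rule sum_abs)
  also have "\<dots> \<le> (\<Sum>j\<in>basis_labels. ?B j x * (dual_bound * E))"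
    using nonneg dual by (intro sum_mono) (simp add: abs_mult mult_left_mono)
  also have "\<dots> = dual_bound * E" by (simp add: sum_distrib_right[symmetric] unity)
  finally show ?thesis .
qed

lemma dist_le_longest_edge:
  assumes "x \<in> closed_triangle v1 v2 v3" "y \<in> closed_triangle v1 v2 v3"
  shows "norm (x - y) \<le> longest_edge v1 v2 v3"
proof -
  have "\<exists>u\<in>{v1, v2, v3}. \<exists>v\<in>{v1, v2, v3}. norm (x - y) \<le> norm (u - v)"
    by (rule simplex_extremal_le_exists) (use assms in \<open>simp_all add: closed_triangle_def\<close>)
  then obtain u v where uv: "u \<in> {v1, v2, v3}" "v \<in> {v1, v2, v3}" "norm (x - y) \<le> norm (u - v)"
    by blast
  have mem: "dist v1 v2 \<le> longest_edge v1 v2 v3" "dist v2 v3 \<le> longest_edge v1 v2 v3" "dist v1 v3 \<le> longest_edge v1 v2 v3"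
    by (simp_all add: longest_edge_def le_max_iff_disj)
  moreover have "0 \<le> longest_edge v1 v2 v3" using mem(1) zero_le_dist order_trans by blast
  ultimately have "dist u v \<le> longest_edge v1 v2 v3"
    using uv(1,2) by (auto simp: dist_commute)
  with uv(3) show ?thesis by (simp add: dist_norm)
qed

text \<open>
  Expanding at the point \<open>x\<close> of evaluation makes the Taylor polynomial \<open>p\<close> agree with \<open>f\<close> at \<open>x\<close>, so
  the error there is the value of the quasi-interpolant of \<open>p - f\<close>.
\<close>

lemma quasi_interpolant_error:
  assumes nc: "\<not> collinear {v1, v2, v3}" and x: "x \<in> closed_triangle v1 v2 v3"
    and f: "C_on 6 (closed_triangle v1 v2 v3) f"
    and M: "sup_deriv_norm 6 (closed_triangle v1 v2 v3) f \<le> ennreal M" "M \<ge> 0"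
  shows "\<bar>f x - quasi_interpolant v1 v2 v3 f x\<bar> \<le> dual_bound / 120 * longest_edge v1 v2 v3 ^ 6 * M"
proof -
  let ?T = "closed_triangle v1 v2 v3" and ?h = "longest_edge v1 v2 v3"
  let ?Q = "quasi_interpolant v1 v2 v3"
  note conv = convex_closed_triangle[of v1 v2 v3] and int = interior_closed_triangle[OF nc]
  define p where "p = taylor_poly 5 ?T f x"
  have f5: "C_on 5 ?T f" using f by (auto simp: C_on_def)
  have Qp: "?Q p x = p x"
    by (rule quasi_interpolant_affine_product[OF nc _ x])
      (simp only: p_def taylor_poly_affine_product[OF conv int f5 x])
  have err: "\<bar>f y - p y\<bar> \<le> norm (y - x) ^ 6 * M / fact 5" if "y \<in> ?T" for y
    using taylor_poly_error[OF conv int, of 5 f x y M] f x that M by (simp add: p_def numeral_eq_Suc del: fact_Suc)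
  have px: "p x = f x" using err[OF x] by simp
  have E: "\<bar>p y + (-1) * f y\<bar> \<le> ?h ^ 6 * M / 120" if y: "y \<in> ?T" for y
  proof -
    have "\<bar>p y + (-1) * f y\<bar> \<le> norm (y - x) ^ 6 * M / 120" using err[OF y] by (simp add: fact_numeral abs_minus_commute)
    also have "\<dots> \<le> ?h ^ 6 * M / 120"
      using dist_le_longest_edge[OF y x] M(2) by (intro divide_right_mono mult_right_mono power_mono) auto
    finally show ?thesis .
  qed
  have "\<bar>f x - ?Q f x\<bar> = \<bar>?Q (\<lambda>y. p y + (-1) * f y) x\<bar>"
    unfolding quasi_interpolant_add quasi_interpolant_scale Qp px by simp
  also have "\<dots> \<le> dual_bound * (?h ^ 6 * M / 120)"
    by (rule quasi_interpolant_bound[OF nc x E])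
  finally show ?thesis by simp
qed

theorem mainTheorem5:
  shows "(\<forall>v1 v2 v3 :: real^2. \<not> collinear {v1, v2, v3} \<longrightarrow>
           (\<forall>f. bivariate_poly 5 f \<longrightarrow>
             (\<forall>x\<in>closed_triangle v1 v2 v3. quasi_interpolant v1 v2 v3 f x = f x))) \<and>
         (\<exists>C::real. C \<ge> 0 \<and>
           (\<forall>v1 v2 v3 :: real^2. \<not> collinear {v1, v2, v3} \<longrightarrow>
             (\<forall>f. C_on 6 (closed_triangle v1 v2 v3) f \<longrightarrow>
               sup_norm (closed_triangle v1 v2 v3) (\<lambda>x. f x - quasi_interpolant v1 v2 v3 f x)
                 \<le> ennreal (C * longest_edge v1 v2 v3 ^ 6) *
                   sup_deriv_norm 6 (closed_triangle v1 v2 v3) f)))"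
proof (intro conjI allI impI ballI)
  fix v1 v2 v3 :: "real^2" and f x
  assume "\<not> collinear {v1, v2, v3}" "bivariate_poly 5 f" "x \<in> closed_triangle v1 v2 v3"
  then show "quasi_interpolant v1 v2 v3 f x = f x"
    by (intro quasi_interpolant_affine_product bivariate_poly_affine_product)
next
  \<comment> \<open>The summand 1 makes \<open>C\<close> positive, as needed when the sixth derivative is unbounded.\<close>
  define C where "C = dual_bound / 120 + 1"
  have C: "C > 0" "dual_bound / 120 \<le> C" using dual_bound_nonneg by (simp_all add: C_def)
  show "\<exists>C::real. C \<ge> 0 \<and>
           (\<forall>v1 v2 v3 :: real^2. \<not> collinear {v1, v2, v3} \<longrightarrow>
             (\<forall>f. C_on 6 (closed_triangle v1 v2 v3) f \<longrightarrow>
               sup_norm (closed_triangle v1 v2 v3) (\<lambda>x. f x - quasi_interpolant v1 v2 v3 f x)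
                 \<le> ennreal (C * longest_edge v1 v2 v3 ^ 6) *
                   sup_deriv_norm 6 (closed_triangle v1 v2 v3) f))"
  proof (intro exI[of _ C] conjI allI impI)
    show "C \<ge> 0" using C by simp
    fix v1 v2 v3 :: "real^2" and f
    assume nc: "\<not> collinear {v1, v2, v3}" and f: "C_on 6 (closed_triangle v1 v2 v3) f"
    let ?T = "closed_triangle v1 v2 v3" and ?h = "longest_edge v1 v2 v3"
    have v: "v1 \<in> ?T" "v2 \<in> ?T" by (auto simp: closed_triangle_def hull_inc)
    have "v1 \<noteq> v2" using nc by auto
    then have h: "?h > 0" using dist_le_longest_edge[OF v] by (smt (verit) norm_le_zero_iff right_minus_eq)
    show "sup_norm ?T (\<lambda>x. f x - quasi_interpolant v1 v2 v3 f x)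
        \<le> ennreal (C * ?h ^ 6) * sup_deriv_norm 6 ?T f"
    proof (cases "sup_deriv_norm 6 ?T f = \<infinity>")
      case True
      then show ?thesis using C h by (simp add: ennreal_mult_top)
    next
      case False
      then obtain M where M: "sup_deriv_norm 6 ?T f = ennreal M" "M \<ge> 0"
        by (cases "sup_deriv_norm 6 ?T f") auto
      have bound: "\<bar>f x - quasi_interpolant v1 v2 v3 f x\<bar> \<le> C * ?h ^ 6 * M" if x: "x \<in> ?T" for x
      proof -
        have "\<bar>f x - quasi_interpolant v1 v2 v3 f x\<bar> \<le> dual_bound / 120 * ?h ^ 6 * M"
          by (rule quasi_interpolant_error[OF nc x f]) (simp_all add: M)
        also have "\<dots> \<le> C * ?h ^ 6 * M"
          using C(2) M(2) h by (intro mult_right_mono) auto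
        finally show ?thesis .
      qed
      have "sup_norm ?T (\<lambda>x. f x - quasi_interpolant v1 v2 v3 f x) \<le> ennreal (C * ?h ^ 6 * M)"
        unfolding sup_norm_def by (intro SUP_least ennreal_leI bound)
      also have "\<dots> = ennreal (C * ?h ^ 6) * sup_deriv_norm 6 ?T f"
        unfolding M(1) using C h M(2) by (intro ennreal_mult) auto
      finally show ?thesis .
    qed
  qed
qed

end
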